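(* Let $d\geq 2$. The smooth Fermat curve $C:F=x^d+y^d+z^d=0$ in $\mathbb{P}^2$ has exactly $3d$ inflectional tangents and their union forms the line arrangement $$\mathcal{A}:\ (x^d+y^d)(y^d+z^d)(x^d+z^d)=0.$$ The union of the curve $C$, the lines in $\mathcal{A}$, and the $3$ coordinate axes produces a new curve $$C':\ F'=xyz(x^d+y^d)(y^d+z^d)(x^d+z^d)(x^d+y^d+z^d)=0$$ of degree $4d+3$, which is free with exponents $(2d+1,2d+1)$. Moreover, the curve $C''\subset C'$ given by $$C'':\ F''=xy(y^d+z^d)(x^d+z^d)(x^d+y^d+z^d)=0$$ has degree $3d+2$ and is free with exponents $(d+1,2d)$. When $d=2$, the curve $C''$ is maximizing of degree $8$.
   Context: For a smooth point $p$ of a plane curve $C$ with tangent line $T_pC$, the inflection order is $\iota_p(C)=(C,T_pC)_p-2$, where $(C,T_pC)_p$ is the intersection multiplicity at $p$; the point $p$ is an inflection point if $\iota_p(C)>0$, and an inflectional tangent is the tangent line at an inflection point. Let $S=\mathbb{C}[x,y,z]$. For a reduced plane curve $G=0$ in $\mathbb{P}^2$ with $G\in S$ homogeneous, let $D_0(G)=\{a\partial_x+b\partial_y+c\partial_z : a,b,c\in S,\ aG_x+bG_y+cG_z=0\}$, a graded $S$-module of rank 2 (a derivation has degree $r$ if $a,b,c$ are homogeneous of degree $r$). The curve $G=0$ is free if $D_0(G)$ is a free graded $S$-module; its exponents $(d_1,d_2)$ are then the degrees of the elements of a homogeneous basis of $D_0(G)$. A reduced plane curve of degree $e$ having only ADE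 (simple) singularities, with total Tjurina number $\tau$ (the sum of the Tjurina numbers of all its singular points), is maximizing if either $e=2m$ and $\tau=3m(m-1)+1$, or $e=2m+1$ and $\tau=3m^2+1$.
   Formalization: For d=2 the Fermat curve is a smooth conic with no inflection points, so "exactly 3d inflectional tangents" is claimed only for d≥3; for d=2 it is shown instead that A is the union of 3d=6 tangent lines of C. *)

theory Defs
  imports
    "HOL-Analysis.Analysis"
    "HOL-Computational_Algebra.Computational_Algebra"
    "HOL-Library.Extended_Nat"
begin

subsection \<open>The polynomial ring in three variables\<close>

text \<open>
  The ring \<open>S\<close> of complex polynomials in \<open>x, y, z\<close> is the iterated polynomial ring
  \<open>\<complex>[x][y][z]\<close>: the outermost variable is \<open>z\<close>, the innermost one is \<open>x\<close>, so the coefficient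
  of \<open>x\<^sup>i y\<^sup>j z\<^sup>k\<close> in \<open>F\<close> is \<open>coeff (coeff (coeff F k) j) i\<close>.
\<close>

type_synonym S = "complex poly poly poly"

definition const3 :: "complex \<Rightarrow> S" where
  "const3 c = [:[:[:c:]:]:]"

definition varx :: S where "varx = [:[:[:0, 1:]:]:]"
definition vary :: S where "vary = [:[:0, 1:]:]"
definition varz :: S where "varz = [:0, 1:]"

definition dx :: "S \<Rightarrow> S" where "dx = map_poly (map_poly pderiv)"
definition dy :: "S \<Rightarrow> S" where "dy = map_poly pderiv"
definition dz :: "S \<Rightarrow> S" where "dz = pderiv"

definition homogeneous :: "nat \<Rightarrow> S \<Rightarrow> bool" where
  "homogeneous n F \<longleftrightarrow>
     (\<forall>i j k. coeff (coeff (coeff F k) j) i \<noteq> 0 \<longrightarrow> i + j + k = n)"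

text \<open>
  Value of \<open>F\<close> at a triple of elements of a \<open>\<complex>\<close>-algebra \<open>R\<close> with structure map \<open>\<iota>\<close>.
\<close>

definition eval3 :: "(complex \<Rightarrow> 'r) \<Rightarrow> S \<Rightarrow> 'r \<times> 'r \<times> 'r \<Rightarrow> 'r::comm_ring_1" where
  "eval3 \<iota> F = (\<lambda>(a, b, c).
     poly (map_poly (\<lambda>G. poly (map_poly (\<lambda>H. poly (map_poly \<iota> H) a) G) b) F) c)"

abbreviation eval :: "S \<Rightarrow> complex \<times> complex \<times> complex \<Rightarrow> complex" where
  "eval \<equiv> eval3 (\<lambda>c. c)"


subsection \<open>Plane curves\<close>

text \<open>
  Every point of \<open>\<P>\<^sup>2\<close> has a unique vector of homogeneous coordinates whose last nonzero
  coordinate is 1; \<open>\<P>\<^sup>2\<close> is identified with the set of these vectors.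
\<close>

definition P2 :: "(complex \<times> complex \<times> complex) set" where
  "P2 = {(a, b, c). c = 1 \<or> (c = 0 \<and> b = 1) \<or> (c = 0 \<and> b = 0 \<and> a = 1)}"

definition plane_curve :: "nat \<Rightarrow> S \<Rightarrow> bool" where
  "plane_curve n F \<longleftrightarrow> n > 0 \<and> F \<noteq> 0 \<and> homogeneous n F"

definition reduced_curve :: "nat \<Rightarrow> S \<Rightarrow> bool" where
  "reduced_curve n F \<longleftrightarrow> plane_curve n F \<and> squarefree F"

definition curve :: "S \<Rightarrow> (complex \<times> complex \<times> complex) set" where
  "curve F = {p \<in> P2. eval F p = 0}"

definition singular_points :: "S \<Rightarrow> (complex \<times> complex \<times> complex) set" where
  "singular_points F =
     {p \<in> curve F. eval (dx F) p = 0 \<and> eval (dy F) p = 0 \<and> eval (dz F) p = 0}"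

definition smooth_points :: "S \<Rightarrow> (complex \<times> complex \<times> complex) set" where
  "smooth_points F = curve F - singular_points F"

text \<open>The linear form defining the tangent line at a smooth point \<open>p\<close>.\<close>

definition tangent_form :: "S \<Rightarrow> complex \<times> complex \<times> complex \<Rightarrow> S" where
  "tangent_form F p =
     const3 (eval (dx F) p) * varx + const3 (eval (dy F) p) * vary + const3 (eval (dz F) p) * varz"

definition tangent_line ::
  "S \<Rightarrow> complex \<times> complex \<times> complex \<Rightarrow> (complex \<times> complex \<times> complex) set" where
  "tangent_line F p = curve (tangent_form F p)"


subsection \<open>Local invariants\<close>

text \<open>
  The affine chart around a point \<open>p\<close> of \<open>\<P>\<^sup>2\<close>: keep a nonzero coordinate of \<open>p\<close> fixed and
  translate the other two by the local coordinates \<open>u, v\<close>, so that \<open>u = v = 0\<close> is \<open>p\<close>.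
\<close>

definition chart ::
  "(complex \<Rightarrow> 'r) \<Rightarrow> complex \<times> complex \<times> complex \<Rightarrow> 'r \<times> 'r \<Rightarrow> 'r \<times> 'r \<times> 'r::comm_ring_1" where
  "chart \<iota> = (\<lambda>(a, b, c) (u, v).
     if c \<noteq> 0 then (\<iota> a + u, \<iota> b + v, \<iota> c)
     else if b \<noteq> 0 then (\<iota> a + u, \<iota> b, \<iota> c + v)
     else (\<iota> a, \<iota> b + u, \<iota> c + v))"

text \<open>
  The completed local ring of \<open>\<P>\<^sup>2\<close> at a point is \<open>\<complex>[[u, v]]\<close>, represented as \<open>\<complex>[[u]][[v]]\<close>.
  Since the colengths used below are those of ideals generated by polynomials in \<open>u, v\<close>, they
  agree with the ones in the algebraic or convergent local ring.
\<close>

type_synonym local_ring = "complex fps fps"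

definition lconst :: "complex \<Rightarrow> local_ring" where
  "lconst c = fps_const (fps_const c)"

definition lu :: local_ring where "lu = fps_const fps_X"
definition lv :: local_ring where "lv = fps_X"

definition du :: "local_ring \<Rightarrow> local_ring" where
  "du f = Abs_fps (\<lambda>n. fps_deriv (fps_nth f n))"
definition dv :: "local_ring \<Rightarrow> local_ring" where
  "dv f = fps_deriv f"

definition germ :: "S \<Rightarrow> complex \<times> complex \<times> complex \<Rightarrow> local_ring" where
  "germ F p = eval3 lconst F (chart lconst p (lu, lv))"

definition ideal_gen :: "local_ring set \<Rightarrow> local_ring set" where
  "ideal_gen A = module.span (*) A"

text \<open>
  The complex dimension of the quotient of the local ring by a subspace \<open>I\<close>, i.e. the least
  size of a finite set spanning the quotient (\<open>\<infinity>\<close> if there is none).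
\<close>

definition colength :: "local_ring set \<Rightarrow> enat" where
  "colength I =
     (INF B \<in> {B. finite B \<and> module.span (\<lambda>c f. lconst c * f) (B \<union> I) = UNIV}. enat (card B))"

definition intersection_mult :: "S \<Rightarrow> S \<Rightarrow> complex \<times> complex \<times> complex \<Rightarrow> enat" where
  "intersection_mult F G p = colength (ideal_gen {germ F p, germ G p})"

definition tjurina :: "S \<Rightarrow> complex \<times> complex \<times> complex \<Rightarrow> enat" where
  "tjurina F p = (let f = germ F p in colength (ideal_gen {f, du f, dv f}))"

definition inflection_order :: "S \<Rightarrow> complex \<times> complex \<times> complex \<Rightarrow> enat" where
  "inflection_order F p = intersection_mult F (tangent_form F p) p - 2"

definition inflection_points :: "S \<Rightarrow> (complex \<times> complex \<times> complex) set" where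
  "inflection_points F = {p \<in> smooth_points F. inflection_order F p > 0}"

definition inflectional_tangents :: "S \<Rightarrow> (complex \<times> complex \<times> complex) set set" where
  "inflectional_tangents F = tangent_line F ` inflection_points F"


subsection \<open>Free curves\<close>

definition scale3 :: "S \<Rightarrow> S \<times> S \<times> S \<Rightarrow> S \<times> S \<times> S" where
  "scale3 s = (\<lambda>(a, b, c). (s * a, s * b, s * c))"

text \<open>
  The derivation \<open>a \<partial>\<^sub>x + b \<partial>\<^sub>y + c \<partial>\<^sub>z\<close> is represented by \<open>(a, b, c)\<close>.
\<close>

definition D0 :: "S \<Rightarrow> (S \<times> S \<times> S) set" where
  "D0 G = {(a, b, c). a * dx G + b * dy G + c * dz G = 0}"

definition homogeneous_derivation :: "nat \<Rightarrow> S \<times> S \<times> S \<Rightarrow> bool" where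
  "homogeneous_derivation r = (\<lambda>(a, b, c). homogeneous r a \<and> homogeneous r b \<and> homogeneous r c)"

definition is_basis_of :: "(S \<times> S \<times> S) set \<Rightarrow> (S \<times> S \<times> S) set \<Rightarrow> bool" where
  "is_basis_of B M \<longleftrightarrow> \<not> module.dependent scale3 B \<and> module.span scale3 B = M"

definition free_with_exponents :: "S \<Rightarrow> nat \<Rightarrow> nat \<Rightarrow> bool" where
  "free_with_exponents G d1 d2 \<longleftrightarrow>
     (\<exists>e. reduced_curve e G) \<and>
     (\<exists>\<theta>1 \<theta>2. \<theta>1 \<noteq> \<theta>2 \<and> is_basis_of {\<theta>1, \<theta>2} (D0 G) \<and>
        homogeneous_derivation d1 \<theta>1 \<and> homogeneous_derivation d2 \<theta>2)"


subsection \<open>Simple singularities and maximizing curves\<close>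

definition holomorphic2_on :: "(complex \<times> complex \<Rightarrow> complex) \<Rightarrow> (complex \<times> complex) set \<Rightarrow> bool" where
  "holomorphic2_on f U \<longleftrightarrow>
     (\<forall>p\<in>U. \<exists>a b. (f has_derivative (\<lambda>(h, k). a * h + b * k)) (at p))"

text \<open>
  The plane curve germs \<open>f = 0\<close> and \<open>g = 0\<close> at the origin are isomorphic: \<open>f\<close> is the product of
  a nonvanishing holomorphic function and of \<open>g\<close> composed with a local biholomorphism.
\<close>

definition analytically_equivalent ::
  "(complex \<times> complex \<Rightarrow> complex) \<Rightarrow> (complex \<times> complex \<Rightarrow> complex) \<Rightarrow> bool" where
  "analytically_equivalent f g \<longleftrightarrow>
     (\<exists>U V \<phi> \<psi> w. open U \<and> open V \<and> (0, 0) \<in> U \<and> \<phi> (0, 0) = (0, 0) \<and>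
        homeomorphism U V \<phi> \<psi> \<and>
        holomorphic2_on (fst \<circ> \<phi>) U \<and> holomorphic2_on (snd \<circ> \<phi>) U \<and>
        holomorphic2_on (fst \<circ> \<psi>) V \<and> holomorphic2_on (snd \<circ> \<psi>) V \<and>
        holomorphic2_on w U \<and> (\<forall>p\<in>U. w p \<noteq> 0) \<and>
        (\<forall>p\<in>U. f p = w p * g (\<phi> p)))"

definition ADE_normal_forms :: "(complex \<times> complex \<Rightarrow> complex) set" where
  "ADE_normal_forms =
     {(\<lambda>(s, t). s ^ 2 + t ^ (k + 1)) | k. k \<ge> 1} \<union>
     {(\<lambda>(s, t). s ^ 2 * t + t ^ (k - 1)) | k. k \<ge> 4} \<union>
     {(\<lambda>(s, t). s ^ 3 + t ^ 4), (\<lambda>(s, t). s ^ 3 + s * t ^ 3), (\<lambda>(s, t). s ^ 3 + t ^ 5)}"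

definition ADE_singularity :: "S \<Rightarrow> complex \<times> complex \<times> complex \<Rightarrow> bool" where
  "ADE_singularity F p \<longleftrightarrow>
     (\<exists>g\<in>ADE_normal_forms.
        analytically_equivalent (\<lambda>q. eval F (chart (\<lambda>c. c) p q)) g)"

definition total_tjurina :: "S \<Rightarrow> enat" where
  "total_tjurina F = (\<Sum>p\<in>singular_points F. tjurina F p)"

definition maximizing_curve :: "nat \<Rightarrow> S \<Rightarrow> bool" where
  "maximizing_curve e F \<longleftrightarrow>
     reduced_curve e F \<and> finite (singular_points F) \<and>
     (\<forall>p\<in>singular_points F. ADE_singularity F p) \<and>
     ((\<exists>m. e = 2 * m \<and> total_tjurina F = enat (3 * m * (m - 1) + 1)) \<or>
      (\<exists>m. e = 2 * m + 1 \<and> total_tjurina F = enat (3 * m ^ 2 + 1)))"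


subsection \<open>The curves built from the Fermat curve\<close>

definition Fermat :: "nat \<Rightarrow> S" where
  "Fermat d = varx ^ d + vary ^ d + varz ^ d"

definition Fermat_arr :: "nat \<Rightarrow> S" where
  "Fermat_arr d = (varx ^ d + vary ^ d) * (vary ^ d + varz ^ d) * (varx ^ d + varz ^ d)"

definition F' :: "nat \<Rightarrow> S" where
  "F' d = varx * vary * varz *
     (varx ^ d + vary ^ d) * (vary ^ d + varz ^ d) * (varx ^ d + varz ^ d) *
     (varx ^ d + vary ^ d + varz ^ d)"

definition F'' :: "nat \<Rightarrow> S" where
  "F'' d = varx * vary *
     (vary ^ d + varz ^ d) * (varx ^ d + varz ^ d) * (varx ^ d + vary ^ d + varz ^ d)"


subsection \<open>Sanity checks\<close>

text \<open>
  The constants \<open>module.span\<close> and \<open>module.dependent\<close> are meaningful for the three scalar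
  multiplications used above.
\<close>

lemma module_scale3: "module scale3"
  by unfold_locales (auto simp: scale3_def algebra_simps)

lemma module_local_ring: "module ((*) :: local_ring \<Rightarrow> local_ring \<Rightarrow> local_ring)"
  by unfold_locales (auto simp: algebra_simps)

lemma module_lconst: "module (\<lambda>c f. lconst c * f)"
  by unfold_locales
    (auto simp: lconst_def algebra_simps simp flip: fps_const_add fps_const_mult)

end

(* Freeness is Saito's criterion: if G is square-free, theta1, theta2 kill G, and
   det(E, theta1, theta2) is a nonzero constant multiple of G for the Euler derivation E, then theta1, theta2
   is a basis of D0(G).  With X = x^d, Y = y^d, Z = z^d, logarithmic derivations of the curves come from those
   of line arrangements in the (X, Y, Z)-plane: the non-Fano arrangement XYZ(X+Y)(Y+Z)(X+Z)(X+Y+Z) for F' and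
   the arrangement XY(Y+Z)(X+Z)(X+Y+Z) for F''; subtracting a multiple of E makes them kill the equation.

   A point of the Fermat curve with xyz <> 0 has a simple tangent, since the quadratic term of the equation
   restricted to the tangent line is a nonzero multiple of (abc)^(d-2); at the points with xyz = 0 the
   contact order is d.

   For d = 2 the singularities of F'' are four D6, two D4 and five A1 points, and 4*6 + 2*4 + 5*1 = 37. *)

theory Submission
  imports Defs "HOL-Computational_Algebra.Field_as_Ring"
begin

subsection \<open>Derivations and ring homomorphisms\<close>

text \<open>A derivation A X d/dX + B Y d/dY + C Z d/dZ in the (X, Y, Z)-plane lifts, up to the
  factor d, to x A d/dx + y B d/dy + z C d/dz. Hence quadratic A, B, C give degree 2d + 1 and linear
  ones give d + 1. The curve of \<open>F''\<close> does not contain the line z = 0, so its second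
  derivation need not be tangent to Z = 0; d/dZ lifts only after multiplication by z^(d-1), and this
  produces the degree 2d.

  A conic has no inflection points, since its tangents have contact order 2. For d = 2 the 3d lines
  of the arrangement are therefore only the tangents at the points with xyz = 0. The proof works
  with these points for all d and identifies them with the inflection points for d \<ge> 3.

  Colengths are infima over spanning sets, so an exact value needs two bounds: coefficient
  functionals vanishing on the ideal give the lower one, an explicit expansion modulo the ideal
  gives the upper one.\<close>

locale derivation =
  fixes D :: "'a::comm_ring_1 \<Rightarrow> 'a"
  assumes add: "D (a + b) = D a + D b"
    and mult: "D (a * b) = D a * b + a * D b"
begin

lemma zero: "D 0 = 0"
  using add[of 0 0] by simp

lemma one: "D 1 = 0"
  using mult[of 1 1] by simp

lemma minus: "D (- a) = - D a"
  using add[of a "- a"] by (simp add: zero add_eq_0_iff)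

lemma diff: "D (a - b) = D a - D b"
  using add[of a "- b"] by (simp add: minus)

lemma sum: "D (sum f A) = (\<Sum>x\<in>A. D (f x))"
  by (induction A rule: infinite_finite_induct) (simp_all add: zero add)

lemma power: "D (a ^ n) = of_nat n * a ^ (n - 1) * D a"
proof (induction n)
  case 0
  then show ?case by (simp add: one)
next
  case (Suc n)
  then show ?case
    by (cases n) (simp_all add: mult algebra_simps)
qed

lemma of_nat: "D (of_nat n) = 0"
  by (induction n) (simp_all add: zero one add)

lemma numeral: "D (numeral k) = 0"
  using of_nat[of "numeral k"] by simp

lemmas rules = add mult zero one minus diff power of_nat numeral

text \<open>The outer variable has coefficients 0 and 1, hence is killed by
  \<open>map_poly D\<close>. Partial derivatives in the inner variables arise in this way from
  \<open>pderiv\<close>, one level down for \<open>dy\<close> and two levels down for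
  \<open>dx\<close>.\<close>

lemma map_poly_derivation: "derivation (map_poly D)"
proof
  fix p q :: "'a poly"
  show "map_poly D (p + q) = map_poly D p + map_poly D q"
    by (intro poly_eqI) (simp add: coeff_map_poly zero add)
  show "map_poly D (p * q) = map_poly D p * q + p * map_poly D q"
    by (intro poly_eqI)
      (simp add: coeff_map_poly zero coeff_mult sum mult sum.distrib)
qed

end

lemma derivation_pderiv: "derivation (pderiv :: 'a::idom poly \<Rightarrow> 'a poly)"
  by unfold_locales (simp_all add: pderiv_add pderiv_mult algebra_simps)

lemma derivation_fps_deriv: "derivation (fps_deriv :: 'a::comm_ring_1 fps \<Rightarrow> 'a fps)"
  by unfold_locales (simp_all add: algebra_simps)

interpretation dz: derivation dz
  unfolding dz_def by (rule derivation_pderiv)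

interpretation dy: derivation dy
  unfolding dy_def by (rule derivation.map_poly_derivation[OF derivation_pderiv])

interpretation dx: derivation dx
  unfolding dx_def
  by (intro derivation.map_poly_derivation derivation_pderiv)

lemma partial_vars [simp]:
  "dx varx = 1" "dx vary = 0" "dx varz = 0"
  "dy varx = 0" "dy vary = 1" "dy varz = 0"
  "dz varx = 0" "dz vary = 0" "dz varz = 1"
  by (simp_all add: dx_def dy_def dz_def varx_def vary_def varz_def map_poly_pCons pderiv_pCons
      one_pCons)

lemmas partial_rules = dx.rules dy.rules dz.rules

section \<open>Ring homomorphisms: evaluation at points and germs\<close>

locale ring_hom =
  fixes h :: "'a::comm_ring_1 \<Rightarrow> 'b::comm_ring_1"
  assumes add: "h (a + b) = h a + h b"
    and mult: "h (a * b) = h a * h b"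
    and one: "h 1 = 1"
begin

lemma zero: "h 0 = 0"
  using add[of 0 0] by simp

lemma minus: "h (- a) = - h a"
  using add[of a "- a"] by (simp add: zero add_eq_0_iff)

lemma diff: "h (a - b) = h a - h b"
  using add[of a "- b"] by (simp add: minus)

lemma sum: "h (sum f A) = (\<Sum>x\<in>A. h (f x))"
  by (induction A rule: infinite_finite_induct) (simp_all add: zero add)

lemma power: "h (a ^ n) = h a ^ n"
  by (induction n) (simp_all add: one mult)

lemma of_nat: "h (of_nat n) = of_nat n"
  by (induction n) (simp_all add: zero one add)

lemma numeral: "h (numeral k) = numeral k"
  using of_nat[of "numeral k"] by simp

lemmas rules = add mult zero one minus diff power of_nat numeral

text \<open>\<open>eval3\<close> is three nested instances of this map, one per variable, so
  evaluation and passage to germs are both ring homomorphisms.\<close>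

lemma poly_map_poly_ring_hom: "ring_hom (\<lambda>p. poly (map_poly h p) c)"
proof
  fix p q :: "'a poly"
  have "map_poly h (p + q) = map_poly h p + map_poly h q"
    by (intro poly_eqI) (simp add: coeff_map_poly zero add)
  then show "poly (map_poly h (p + q)) c = poly (map_poly h p) c + poly (map_poly h q) c"
    by simp
  have "map_poly h (p * q) = map_poly h p * map_poly h q"
    by (intro poly_eqI) (simp add: coeff_map_poly zero coeff_mult sum mult)
  then show "poly (map_poly h (p * q)) c = poly (map_poly h p) c * poly (map_poly h q) c"
    by simp
qed (simp add: one)

end

lemma ring_hom_eval3:
  assumes "ring_hom \<iota>"
  shows "ring_hom (\<lambda>F. eval3 \<iota> F p)"
  by (cases p) (auto simp: eval3_def intro!: ring_hom.poly_map_poly_ring_hom assms)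

lemma eval3_vars:
  assumes "ring_hom \<iota>"
  shows "eval3 \<iota> varx (a, b, c) = a" "eval3 \<iota> vary (a, b, c) = b" "eval3 \<iota> varz (a, b, c) = c"
    "eval3 \<iota> (const3 k) (a, b, c) = \<iota> k"
  using ring_hom.zero[OF assms] ring_hom.one[OF assms]
  by (simp_all add: eval3_def varx_def vary_def varz_def const3_def map_poly_pCons)

lemma ring_hom_lconst: "ring_hom lconst"
  by unfold_locales (simp_all add: lconst_def flip: fps_const_add fps_const_mult)

interpretation lconst: ring_hom lconst
  by (rule ring_hom_lconst)

lemma ring_hom_ident: "ring_hom (\<lambda>c. c)"
  by unfold_locales auto

interpretation eval: ring_hom "\<lambda>F. eval F p" for p
  by (rule ring_hom_eval3[OF ring_hom_ident])

interpretation germ: ring_hom "\<lambda>F. germ F p" for p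
  unfolding germ_def by (rule ring_hom_eval3[OF ring_hom_lconst])

lemmas eval_rules = eval.rules eval3_vars[OF ring_hom_ident]

lemma germ_vars:
  "germ varx (a, b, c) = (if c \<noteq> 0 \<or> b \<noteq> 0 then lconst a + lu else lconst a)"
  "germ vary (a, b, c) = (if c \<noteq> 0 then lconst b + lv else if b \<noteq> 0 then lconst b else lconst b + lu)"
  "germ varz (a, b, c) = (if c \<noteq> 0 then lconst c else lconst c + lv)"
  "germ (const3 k) (a, b, c) = lconst k"
  by (auto simp: germ_def chart_def eval3_vars[OF ring_hom_lconst])

section \<open>Homogeneous polynomials\<close>

lemma homogeneous_mult:
  assumes "homogeneous m F" "homogeneous n G"
  shows "homogeneous (m + n) (F * G)"
  unfolding homogeneous_def
proof (intro allI impI)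
  fix i j k
  assume "coeff (coeff (coeff (F * G) k) j) i \<noteq> 0"
  then have "\<not> (\<forall>a\<le>k. \<forall>b\<le>j. \<forall>c\<le>i.
      coeff (coeff (coeff F a) b) c * coeff (coeff (coeff G (k - a)) (j - b)) (i - c) = 0)"
    unfolding coeff_mult coeff_sum by (metis (no_types, lifting) atMost_iff sum.neutral)
  then obtain a b c where abc: "a \<le> k" "b \<le> j" "c \<le> i"
    "coeff (coeff (coeff F a) b) c \<noteq> 0" "coeff (coeff (coeff G (k - a)) (j - b)) (i - c) \<noteq> 0"
    by (metis mult_eq_0_iff)
  then have "c + b + a = m" "(i - c) + (j - b) + (k - a) = n"
    using assms unfolding homogeneous_def by blast+
  then show "i + j + k = m + n" using abc by linarith
qed

lemma homogeneous_add: "homogeneous n F \<Longrightarrow> homogeneous n G \<Longrightarrow> homogeneous n (F + G)"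
  unfolding homogeneous_def coeff_add by (metis add.right_neutral)

lemma homogeneous_minus: "homogeneous n F \<Longrightarrow> homogeneous n (- F)"
  unfolding homogeneous_def by simp

lemma homogeneous_diff: "homogeneous n F \<Longrightarrow> homogeneous n G \<Longrightarrow> homogeneous n (F - G)"
  using homogeneous_add[of n F "- G"] homogeneous_minus by simp

lemma homogeneous_const3: "homogeneous 0 (const3 c)"
  by (auto simp: homogeneous_def const3_def coeff_pCons split: nat.splits)

lemma homogeneous_vars: "homogeneous 1 varx" "homogeneous 1 vary" "homogeneous 1 varz"
  by (auto simp: homogeneous_def varx_def vary_def varz_def coeff_pCons split: nat.splits)

lemma homogeneous_one: "homogeneous 0 1"
  using homogeneous_const3[of 1] by (simp add: const3_def one_pCons)

lemma homogeneous_power: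
  assumes "homogeneous m F"
  shows "homogeneous (n * m) (F ^ n)"
  by (induction n) (auto simp: homogeneous_one intro: homogeneous_mult assms)

text \<open>The integer factors coming from the Euler derivation and from determinants are
  recognised here as constants of the ground field, the form that Saito's criterion and the degree
  counts use.\<close>

lemma of_nat_S: "of_nat n = const3 (of_nat n)"
  by (simp add: const3_def of_nat_poly)

lemma homogeneous_of_nat: "homogeneous 0 (of_nat n)"
  by (simp add: of_nat_S homogeneous_const3)

subsection \<open>Square-free polynomials\<close>

lemma dvd_const_poly_imp_const:
  fixes q :: "'a::idom poly"
  assumes "q dvd [:a:]" "a \<noteq> 0"
  obtains c where "q = [:c:]" "c dvd a"
proof -
  obtain r where r: "[:a:] = q * r" using assms(1) by (elim dvdE)
  then have "q \<noteq> 0" "r \<noteq> 0" using assms(2) by auto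
  then have "degree q + degree r = degree [:a:]" by (simp add: r degree_mult_eq)
  then have "degree q = 0" by simp
  then obtain c where "q = [:c:]" by (elim degree_eq_zeroE)
  with assms(1) that show thesis by simp
qed

text \<open>The coefficients form a domain such as \<complex>[x][y], not a field, so a constant
  divisor may fail to be a unit. As it divides every coefficient, a single coefficient equal to 1 is
  enough to make it one.\<close>

lemma const_poly_dvd_monic_imp_unit:
  fixes p :: "'a::idom poly"
  assumes "[:c:] dvd p" "coeff p n = 1"
  shows "[:c:] dvd 1"
  using assms by (metis const_poly_dvd_const_poly_iff const_poly_dvd_iff one_pCons)

lemma coprime_monic_const_poly:
  fixes p :: "'a::idom_divide poly"
  assumes "coeff p n = 1" "a \<noteq> 0"
  shows "coprime p [:a:]"
proof (rule coprimeI)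
  fix q assume "q dvd p" "q dvd [:a:]"
  then show "is_unit q"
    by (metis assms const_poly_dvd_monic_imp_unit dvd_const_poly_imp_const)
qed

text \<open>A common divisor divides the nonzero constant \<open>p - q\<close>, hence is itself
  constant, and the coefficient 1 of \<open>p\<close> makes it a unit. This separates z^d + a from
  z^d + b for distinct a and b.\<close>

lemma coprime_monic_if_diff_const_poly:
  fixes p q :: "'a::idom_divide poly"
  assumes "coeff p n = 1" "p - q = [:a:]" "a \<noteq> 0"
  shows "coprime p q"
proof (rule coprimeI)
  fix r assume r: "r dvd p" "r dvd q"
  then have "r dvd [:a:]" by (metis assms(2) dvd_diff)
  with r(1) show "is_unit r"
    by (metis assms(1,3) const_poly_dvd_monic_imp_unit dvd_const_poly_imp_const)
qed

lemma squarefree_const_poly: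
  fixes a :: "'a::idom"
  assumes "squarefree a"
  shows "squarefree [:a:]"
proof (rule squarefreeI)
  fix q :: "'a poly" assume q: "q\<^sup>2 dvd [:a:]"
  have "a \<noteq> 0" using assms by auto
  have "q dvd q\<^sup>2" by simp
  then obtain c where c: "q = [:c:]"
    using q \<open>a \<noteq> 0\<close> by (meson dvd_const_poly_imp_const dvd_trans)
  then have "c\<^sup>2 dvd a" using q by (simp add: power2_eq_square)
  then have "c dvd 1" using assms by (rule squarefreeD[rotated])
  then show "q dvd 1" by (simp add: c one_pCons)
qed

lemma squarefree_X:
  "squarefree [:0, 1 :: 'a::idom:]"
proof (rule squarefreeI)
  fix q :: "'a poly" assume q: "q\<^sup>2 dvd [:0, 1:]"
  then have "degree (q\<^sup>2) \<le> degree [:0, 1 :: 'a:]" by (intro dvd_imp_degree_le) auto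
  moreover have "q \<noteq> 0" using q by auto
  ultimately have "degree q = 0" by (simp add: power2_eq_square degree_mult_eq)
  then obtain c where c: "q = [:c:]" by (elim degree_eq_zeroE)
  have "q dvd q\<^sup>2" by simp
  then have "[:c:] dvd [:0, 1:]" using q c dvd_trans by blast
  then show "q dvd 1" unfolding c by (rule const_poly_dvd_monic_imp_unit[of _ _ 1]) simp
qed

lemma coeff_X_power_plus_const_poly:
  "n > 0 \<Longrightarrow> coeff ([:0, 1:] ^ n + [:a:]) n = (1 :: 'a::comm_ring_1)"
  by (simp add: coeff_pCons flip: monom_altdef[of 1, simplified] split: nat.splits)

text \<open>A repeated factor divides p and p', hence the combination n p - X p' = n a, which is a
  nonzero constant in characteristic 0. So the factor is constant, and the coefficient 1 of p makes
  it a unit.\<close>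

lemma squarefree_X_power_plus_const_poly:
  fixes a :: "'a::{idom,semiring_char_0}"
  assumes "n > 0" "a \<noteq> 0"
  shows "squarefree ([:0, 1:] ^ n + [:a:])"
proof (rule squarefreeI)
  define p where "p = [:0, 1:] ^ n + [:a:]"
  fix q :: "'a poly" assume "q\<^sup>2 dvd [:0, 1:] ^ n + [:a:]"
  then obtain r where "p = q\<^sup>2 * r"
    unfolding p_def by (elim dvdE)
  then have r: "p = q * (q * r)"
    by (simp add: power2_eq_square mult.assoc)
  have "pderiv p = q * (pderiv (q * r) + r * pderiv q)"
    unfolding r by (subst pderiv_mult) (simp add: algebra_simps)
  moreover have "pderiv p = of_nat n * [:0, 1:] ^ (n - 1)"
    unfolding p_def
    using derivation.power[OF derivation_pderiv, of "[:0, 1 :: 'a:]" n]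
    by (simp add: pderiv_add pderiv_pCons)
  moreover have "[:0, 1:] ^ n = [:0, 1 :: 'a:] * [:0, 1:] ^ (n - 1)"
    using assms(1) by (metis Suc_diff_1 power_Suc)
  ultimately have "of_nat n * p - [:0, 1:] * pderiv p = [:of_nat n * a:]"
    by (simp add: p_def of_nat_poly algebra_simps)
  moreover have "q dvd p" "q dvd pderiv p"
    using r \<open>pderiv p = q * _\<close> by simp_all
  ultimately have "q dvd [:of_nat n * a:]"
    by (metis dvd_diff dvd_mult)
  moreover have "of_nat n * a \<noteq> 0" using assms by simp
  ultimately obtain c where c: "q = [:c:]" using dvd_const_poly_imp_const by blast
  have "coeff p n = 1"
    using assms(1) unfolding p_def by (rule coeff_X_power_plus_const_poly)
  then show "q dvd 1"
    using \<open>q dvd p\<close> const_poly_dvd_monic_imp_unit c by blast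
qed

lemma coprime_X_X_power_plus_const_poly:
  fixes a :: "'a::idom_divide"
  assumes "n > 0" "a \<noteq> 0"
  shows "coprime [:0, 1:] ([:0, 1:] ^ n + [:a:])"
proof (rule coprimeI)
  fix r assume r: "r dvd [:0, 1:]" "r dvd [:0, 1:] ^ n + [:a:]"
  have "[:0, 1 :: 'a:] dvd [:0, 1:] ^ n" using assms(1) by (simp add: dvd_power)
  then have "r dvd [:0, 1:] ^ n" using r(1) dvd_trans by blast
  then have "r dvd [:a:]" using r(2) dvd_add_right_iff by blast
  moreover have "coprime [:0, 1:] [:a:]"
    by (rule coprime_monic_const_poly[of _ 1]) (simp_all add: assms)
  ultimately show "is_unit r" using r(1) coprime_common_divisor by blast
qed

section \<open>Square-free polynomials and their gradients\<close>

lemma squarefree_dvd_if_prime_dvd: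
  fixes a b :: "'a::factorial_semiring"
  assumes "squarefree a" "\<And>p. prime p \<Longrightarrow> p dvd a \<Longrightarrow> p dvd b"
  shows "a dvd b"
proof (cases "b = 0")
  case False
  have "a \<noteq> 0" using assms(1) by auto
  then show ?thesis
  proof (rule multiplicity_le_imp_dvd)
    fix p :: 'a assume p: "prime p"
    show "multiplicity p a \<le> multiplicity p b"
    proof (cases "p dvd a")
      case True
      then have "p dvd b" using assms(2) p by blast
      then have "multiplicity p b > 0" using False p
        by (metis multiplicity_gt_zero_iff not_prime_unit)
      moreover have "multiplicity p a \<le> 1"
        using assms(1) \<open>a \<noteq> 0\<close> p squarefree_factorial_semiring'' by blast
      ultimately show ?thesis by linarith
    qed (simp add: not_dvd_imp_multiplicity_0)
  qed
qed simp

lemma dvd_pderiv_imp_const: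
  fixes p :: "'a::{idom,semiring_char_0} poly"
  assumes "p dvd pderiv p"
  shows "degree p = 0"
proof (rule ccontr)
  assume "degree p \<noteq> 0"
  then have "pderiv p \<noteq> 0" by (simp add: pderiv_eq_0_iff)
  then have "degree p \<le> degree (pderiv p)" using assms dvd_imp_degree_le by blast
  then show False using \<open>degree p \<noteq> 0\<close> by (simp add: degree_pderiv)
qed

text \<open>The degree argument is applied in z, then y, then x: once the outer variables are gone,
  the next partial derivative is the derivative of the only remaining coefficient.\<close>

lemma dvd_partials_imp_const:
  fixes p :: S
  assumes "p dvd dx p" "p dvd dy p" "p dvd dz p" 
  obtains c where "p = const3 c"
proof -
  obtain q where q: "p = [:q:]"
    using dvd_pderiv_imp_const assms(3) by (metis degree_eq_zeroE dz_def)
  then have "q dvd pderiv q" using assms(2) by (simp add: dy_def map_poly_pCons)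
  then obtain r where r: "q = [:r:]"
    using dvd_pderiv_imp_const by (metis degree_eq_zeroE)
  then have "r dvd pderiv r" using assms(1) q by (simp add: dx_def map_poly_pCons)
  then obtain c where c: "r = [:c:]"
    using dvd_pderiv_imp_const by (metis degree_eq_zeroE)
  then show thesis using that[of c] q r by (simp add: const3_def)
qed

text \<open>No prime factor of a square-free G divides all partials of G. Write G = p H with p prime
  not dividing H. If p does not divide h, it divides D(G) = D(p) H + p D(H), hence D(p), for each
  partial D, and this makes p constant.\<close>

lemma squarefree_dvd_if_dvd_mult_partials:
  fixes G h :: S
  assumes "squarefree G" "G dvd h * dx G" "G dvd h * dy G" "G dvd h * dz G"
  shows "G dvd h"
proof (rule squarefree_dvd_if_prime_dvd[OF assms(1)])
  fix p assume p: "prime p" "p dvd G"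
  then obtain H where H: "G = p * H" by (elim dvdE)
  have pH: "\<not> p dvd H"
  proof
    assume "p dvd H"
    then have "p\<^sup>2 dvd G" by (simp add: H power2_eq_square)
    then show False using assms(1) p(1) squarefreeD by (metis not_prime_unit)
  qed
  show "p dvd h"
  proof (rule ccontr)
    assume h: "\<not> p dvd h"
    have *: "p dvd D p" if "derivation D" "G dvd h * D G" for D
    proof -
      have "p dvd h * (D p * H + p * D H)"
        using that p(2) by (metis H derivation.mult dvd_trans)
      then have "p dvd D p * H"
        using h p(1) by (metis dvd_add_left_iff dvd_triv_left prime_dvd_mult_iff)
      then show ?thesis using pH p(1) by (metis prime_dvd_mult_iff)
    qed
    obtain c where c: "p = const3 c"
      using *[OF dx.derivation_axioms assms(2)] *[OF dy.derivation_axioms assms(3)]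
        *[OF dz.derivation_axioms assms(4)] by (rule dvd_partials_imp_const)
    then have "c \<noteq> 0" using p(1) by (auto simp: const3_def)
    then have "p dvd 1" by (simp add: c const3_def one_pCons dvd_field_iff)
    then show False using p(1) by (metis not_prime_unit)
  qed
qed

subsection \<open>Saito's criterion\<close>

definition der :: "S \<times> S \<times> S \<Rightarrow> S \<Rightarrow> S" where
  "der = (\<lambda>(a, b, c) F. a * dx F + b * dy F + c * dz F)"

definition det3 :: "S \<times> S \<times> S \<Rightarrow> S \<times> S \<times> S \<Rightarrow> S \<times> S \<times> S \<Rightarrow> S" where
  "det3 = (\<lambda>(a, b, c) (a', b', c') (a'', b'', c'').
     a * (b' * c'' - c' * b'') - b * (a' * c'' - c' * a'') + c * (a' * b'' - b' * a''))"

abbreviation Euler :: "S \<times> S \<times> S" where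
  "Euler \<equiv> (varx, vary, varz)"

lemma derivation_der: "derivation (der \<theta>)"
  by (cases \<theta>, unfold_locales) (simp_all add: der_def partial_rules algebra_simps)

interpretation der: derivation "der \<theta>" for \<theta>
  by (rule derivation_der)

interpretation scale3: module scale3
  by (rule module_scale3)

lemma mem_D0_iff: "\<theta> \<in> D0 G \<longleftrightarrow> der \<theta> G = 0"
  by (cases \<theta>) (simp add: D0_def der_def)

text \<open>Cramer's rule for the linear system whose rows are the three derivations and whose
  unknown is the gradient of G; the brackets are the cofactors.\<close>

lemma det3_mult_partials:
  "det3 \<theta> \<eta> \<zeta> * dx G = der \<theta> G * (fst (snd \<eta>) * snd (snd \<zeta>) - snd (snd \<eta>) * fst (snd \<zeta>))
    - der \<eta> G * (fst (snd \<theta>) * snd (snd \<zeta>) - snd (snd \<theta>) * fst (snd \<zeta>))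
    + der \<zeta> G * (fst (snd \<theta>) * snd (snd \<eta>) - snd (snd \<theta>) * fst (snd \<eta>))"
  "det3 \<theta> \<eta> \<zeta> * dy G = der \<theta> G * (snd (snd \<eta>) * fst \<zeta> - fst \<eta> * snd (snd \<zeta>))
    - der \<eta> G * (snd (snd \<theta>) * fst \<zeta> - fst \<theta> * snd (snd \<zeta>))
    + der \<zeta> G * (snd (snd \<theta>) * fst \<eta> - fst \<theta> * snd (snd \<eta>))"
  "det3 \<theta> \<eta> \<zeta> * dz G = der \<theta> G * (fst \<eta> * fst (snd \<zeta>) - fst (snd \<eta>) * fst \<zeta>)
    - der \<eta> G * (fst \<theta> * fst (snd \<zeta>) - fst (snd \<theta>) * fst \<zeta>)
    + der \<zeta> G * (fst \<theta> * fst (snd \<eta>) - fst (snd \<theta>) * fst \<eta>)"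
  by (cases \<theta>; cases \<eta>; cases \<zeta>; simp add: det3_def der_def algebra_simps)+

text \<open>The linear relation between any four vectors in rank 3, with the determinants of the
  triples as coefficients.\<close>

lemma det3_Cramer:
  "scale3 (det3 \<epsilon> \<eta> \<zeta>) \<theta> =
    scale3 (det3 \<theta> \<eta> \<zeta>) \<epsilon> + scale3 (det3 \<epsilon> \<theta> \<zeta>) \<eta> + scale3 (det3 \<epsilon> \<eta> \<theta>) \<zeta>"
  by (cases \<epsilon>; cases \<theta>; cases \<eta>; cases \<zeta>; simp add: det3_def scale3_def algebra_simps)

lemma det3_scale_add:
  "det3 \<theta> (scale3 r \<eta> + scale3 s \<zeta>) \<zeta> = r * det3 \<theta> \<eta> \<zeta>"
  "det3 \<theta> \<eta> (scale3 r \<eta> + scale3 s \<zeta>) = s * det3 \<theta> \<eta> \<zeta>"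
  by (cases \<theta>; cases \<eta>; cases \<zeta>; simp add: det3_def scale3_def algebra_simps)+

lemma scale3_cancel: "scale3 r \<theta> = scale3 r \<eta> \<longleftrightarrow> r = 0 \<or> \<theta> = \<eta>"
  by (cases \<theta>; cases \<eta>) (auto simp: scale3_def)

text \<open>The three derivations send G to multiples of G, so by Cramer's rule the determinant
  times each partial derivative of G is a multiple of G. Square-freeness then removes the partial
  derivatives.\<close>

lemma squarefree_dvd_det3:
  assumes G: "squarefree G" and E: "der \<epsilon> G = h * G"
    and "\<eta> \<in> D0 G" "\<zeta> \<in> D0 G"
  shows "G dvd det3 \<epsilon> \<eta> \<zeta>"
proof -
  have D0: "der \<eta> G = 0" "der \<zeta> G = 0"
    using assms(3,4) by (simp_all add: mem_D0_iff)
  show ?thesis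
    by (rule squarefree_dvd_if_dvd_mult_partials[OF G];
        simp only: det3_mult_partials E D0 mult_zero_left diff_zero add_0_right;
        intro dvd_mult2 dvd_triv_right)
qed

text \<open>For \<theta> in D0(G) the determinant of \<theta>, \<theta>1, \<theta>2 kills the
  nonzero gradient, so it is 0. The relation between E, \<theta>1, \<theta>2 and \<theta> then
  expresses c G \<theta> through \<theta>1 and \<theta>2, with coefficients that are determinants
  divisible by G; cancelling G and the unit c gives the coordinates of \<theta>.\<close>

theorem Saito_criterion:
  assumes G: "squarefree G" and E: "der Euler G = of_nat n * G" "n > 0"
    and \<theta>: "\<theta>1 \<in> D0 G" "\<theta>2 \<in> D0 G"
    and det: "det3 Euler \<theta>1 \<theta>2 = const3 c * G" "c \<noteq> 0"
  shows "\<theta>1 \<noteq> \<theta>2 \<and> is_basis_of {\<theta>1, \<theta>2} (D0 G)"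
proof -
  have G0: "G \<noteq> 0" using G by auto
  have unit: "const3 (inverse c) * const3 c = 1"
    using det(2) by (simp add: const3_def one_pCons)
  then have c0: "const3 c \<noteq> 0" by auto
  have det0: "det3 Euler \<theta>1 \<theta>2 \<noteq> 0" using det G0 c0 by simp
  \<comment> \<open>Euler's relation: if the gradient vanished, n G would be 0.\<close>
  have grad: "dx G \<noteq> 0 \<or> dy G \<noteq> 0 \<or> dz G \<noteq> 0"
  proof (rule ccontr)
    assume "\<not> ?thesis"
    then have "of_nat n * G = 0" using E(1) by (simp add: der_def)
    then show False using G0 E(2) by simp
  qed
  have ne: "\<theta>1 \<noteq> \<theta>2"
  proof
    assume "\<theta>1 = \<theta>2"
    then have "det3 Euler \<theta>1 \<theta>2 = 0" by (cases \<theta>2) (simp add: det3_def algebra_simps)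
    with det0 show False ..
  qed
  have span: "scale3.span {\<theta>1, \<theta>2} = {scale3 r \<theta>1 + scale3 s \<theta>2 | r s. True}"
  proof (intro set_eqI iffI)
    fix \<theta> assume "\<theta> \<in> scale3.span {\<theta>1, \<theta>2}"
    then obtain r s where "\<theta> - scale3 r \<theta>1 = scale3 s \<theta>2"
      by (auto simp: scale3.span_insert scale3.span_singleton)
    then have "\<theta> = scale3 r \<theta>1 + scale3 s \<theta>2" by (simp add: diff_eq_eq add.commute)
    then show "\<theta> \<in> {scale3 r \<theta>1 + scale3 s \<theta>2 | r s. True}" by blast
  qed (auto intro!: scale3.span_add scale3.span_scale intro: scale3.span_base)
  have sub: "scale3 r \<theta>1 + scale3 s \<theta>2 \<in> D0 G" for r s
  proof -
    have "der (scale3 r \<theta>1 + scale3 s \<theta>2) G = r * der \<theta>1 G + s * der \<theta>2 G"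
      by (cases \<theta>1; cases \<theta>2) (simp add: der_def scale3_def algebra_simps)
    then show ?thesis using \<theta> by (simp add: mem_D0_iff)
  qed
  have sup: "\<theta> \<in> scale3.span {\<theta>1, \<theta>2}" if mem: "\<theta> \<in> D0 G" for \<theta>
  proof -
    have "det3 \<theta> \<theta>1 \<theta>2 * dx G = 0" "det3 \<theta> \<theta>1 \<theta>2 * dy G = 0" "det3 \<theta> \<theta>1 \<theta>2 * dz G = 0"
      using mem \<theta> by (simp_all add: det3_mult_partials mem_D0_iff)
    then have 0: "det3 \<theta> \<theta>1 \<theta>2 = 0" using grad by auto
    obtain r s where rs: "det3 Euler \<theta> \<theta>2 = G * r" "det3 Euler \<theta>1 \<theta> = G * s"
      using squarefree_dvd_det3[OF G E(1) mem \<theta>(2)] squarefree_dvd_det3[OF G E(1) \<theta>(1) mem]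
    by (elim dvdE)
    have "scale3 (G * const3 c) \<theta> = scale3 (G * r) \<theta>1 + scale3 (G * s) \<theta>2"
      using det3_Cramer[of Euler \<theta>1 \<theta>2 \<theta>] by (simp add: 0 rs det(1) mult.commute)
    then have "scale3 G (scale3 (const3 c) \<theta>) = scale3 G (scale3 r \<theta>1 + scale3 s \<theta>2)"
      by (simp add: scale3.scale_right_distrib)
    then have "scale3 (const3 c) \<theta> = scale3 r \<theta>1 + scale3 s \<theta>2"
      using G0 scale3_cancel by blast
    then have "scale3 (const3 (inverse c) * const3 c) \<theta>
      = scale3 (const3 (inverse c) * r) \<theta>1 + scale3 (const3 (inverse c) * s) \<theta>2"
      by (metis scale3.scale_right_distrib scale3.scale_scale)
    then have "\<theta> = scale3 (const3 (inverse c) * r) \<theta>1 + scale3 (const3 (inverse c) * s) \<theta>2"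
      by (simp add: unit)
    then show ?thesis unfolding span by blast
  qed
  have "\<not> scale3.dependent {\<theta>1, \<theta>2}"
  proof
    assume "scale3.dependent {\<theta>1, \<theta>2}"
    then obtain u where u: "(\<exists>v\<in>{\<theta>1, \<theta>2}. u v \<noteq> 0)" "(\<Sum>v\<in>{\<theta>1, \<theta>2}. scale3 (u v) v) = 0"
      by (subst (asm) scale3.dependent_finite) auto
    then have "scale3 (u \<theta>1) \<theta>1 + scale3 (u \<theta>2) \<theta>2 = 0" using ne by simp
    \<comment> \<open>Inserting the relation into one slot of the determinant isolates one of its
      two coefficients.\<close>
    then have "u \<theta>1 * det3 Euler \<theta>1 \<theta>2 = det3 Euler 0 \<theta>2"
      "u \<theta>2 * det3 Euler \<theta>1 \<theta>2 = det3 Euler \<theta>1 0"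
      by (metis det3_scale_add(1), metis det3_scale_add(2))
    then have "u \<theta>1 = 0" "u \<theta>2 = 0"
      using det0 by (cases \<theta>1; cases \<theta>2; simp add: det3_def zero_prod_def)+
    with u(1) show False by auto
  qed
  then show ?thesis
    using ne sub sup span by (auto simp: is_basis_of_def)
qed

subsection \<open>The curves are reduced\<close>

lemma const_poly_mult: "[:a:] * [:b:] = [:a * b :: 'a::comm_semiring_0:]"
  by (simp add: mult.commute)

text \<open>The factors free of z are collected in one constant of \<complex>[x][y][z]; all the
  others are monic in z. Two of the monic factors z^d + a have constants a that differ, hence are
  coprime. The constant xy(x^d + y^d) is handled in the same way with y in the role of z.\<close>

lemma squarefree_F':
  assumes "d > 0"
  shows "squarefree (F' d)"
proof -
  \<comment> \<open>These are the variables as elements of \<complex>[x][y], one level below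
    \<open>varx\<close> and \<open>vary\<close>.\<close>
  define x y where "x = [:[:0, 1 :: complex:]:]" and "y = [:0, 1 :: complex poly:]"
  define A B C where "A = varz ^ d + [:y ^ d:]" and "B = varz ^ d + [:x ^ d:]"
    and "C = varz ^ d + [:y ^ d + x ^ d:]"
  have x: "x \<noteq> 0" and y: "y \<noteq> 0" by (simp_all add: x_def y_def)
  have monic: "coeff (y ^ d + [:a:]) d = 1" for a
    unfolding y_def by (rule coeff_X_power_plus_const_poly[OF assms])
  have xd: "x ^ d = [:[:0, 1:] ^ d:]" by (simp add: x_def poly_const_pow)
  have ne: "y ^ d + x ^ d \<noteq> 0" "y ^ d - x ^ d \<noteq> 0"
  proof -
    have nz: "y ^ d + [:a:] \<noteq> 0" for a using monic[of a] by (metis coeff_0 zero_neq_one)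
    show "y ^ d + x ^ d \<noteq> 0" unfolding xd by (rule nz)
    show "y ^ d - x ^ d \<noteq> 0" 
      unfolding xd diff_conv_add_uminus minus_pCons minus_zero by (rule nz)
  qed
  have monic': "coeff A d = 1" "coeff B d = 1" "coeff C d = 1"
    unfolding A_def B_def C_def varz_def using coeff_X_power_plus_const_poly[OF assms] by auto
  have "squarefree (y * (y ^ d + [:[:0, 1:] ^ d:]))"
    unfolding y_def using assms
    by (intro squarefree_mult_coprime squarefree_X squarefree_X_power_plus_const_poly
        coprime_X_X_power_plus_const_poly) auto
  moreover have "coprime x (y * (y ^ d + [:[:0, 1:] ^ d:]))"
  proof -
    have "coprime y x" "coprime (y ^ d + [:[:0, 1:] ^ d:]) x"
      unfolding x_def
      by (rule coprime_monic_const_poly[of _ 1] coprime_monic_const_poly[OF monic]; simp add: y_def)+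
    then show ?thesis by (simp add: ac_simps)
  qed
  moreover have "squarefree x"
    unfolding x_def by (intro squarefree_const_poly squarefree_X)
  ultimately have "squarefree (x * (y * (y ^ d + x ^ d)))"
    unfolding xd by (blast intro: squarefree_mult_coprime)
  then have "squarefree [:x * (y * (y ^ d + x ^ d)):]" by (rule squarefree_const_poly)
  moreover have "squarefree (varz * (A * (B * C)))"
  proof (intro squarefree_mult_coprime)
    show "squarefree varz" unfolding varz_def by (rule squarefree_X)
    show "squarefree A" "squarefree B" "squarefree C"
      unfolding A_def B_def C_def varz_def using assms x y ne
      by (intro squarefree_X_power_plus_const_poly; simp)+
    show "coprime B C"
      by (rule coprime_monic_if_diff_const_poly[OF monic'(2), of _ "- (y ^ d)"])
        (simp_all add: B_def C_def y)
    have "coprime A B"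
      by (rule coprime_monic_if_diff_const_poly[OF monic'(1), of _ "y ^ d - x ^ d"])
        (use ne in \<open>simp_all add: A_def B_def\<close>)
    moreover have "coprime A C"
      by (rule coprime_monic_if_diff_const_poly[OF monic'(1), of _ "- (x ^ d)"])
        (simp_all add: A_def C_def x)
    ultimately show "coprime A (B * C)" by simp
    have "coprime varz A" "coprime varz B" "coprime varz C"
      unfolding A_def B_def C_def varz_def using assms x y ne
      by (intro coprime_X_X_power_plus_const_poly; simp)+
    then show "coprime varz (A * (B * C))" by simp
  qed
  moreover have "coprime [:x * (y * (y ^ d + x ^ d)):] (varz * (A * (B * C)))"
  proof -
    have nz: "x * (y * (y ^ d + x ^ d)) \<noteq> 0" using x y ne by simp
    have "coprime varz [:x * (y * (y ^ d + x ^ d)):]"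
      by (rule coprime_monic_const_poly[of _ 1, OF _ nz]) (simp add: varz_def)
    moreover have "coprime A [:x * (y * (y ^ d + x ^ d)):]" "coprime B [:x * (y * (y ^ d + x ^ d)):]"
      "coprime C [:x * (y * (y ^ d + x ^ d)):]"
      by (rule coprime_monic_const_poly[OF _ nz], rule monic')+
    ultimately show ?thesis by (simp add: coprime_commute)
  qed
  ultimately have "squarefree ([:x * (y * (y ^ d + x ^ d)):] * (varz * (A * (B * C))))"
    by (blast intro: squarefree_mult_coprime)
  moreover have "[:x * (y * (y ^ d + x ^ d)):] = varx * (vary * (vary ^ d + varx ^ d))"
    by (simp only: varx_def vary_def x_def[symmetric] y_def[symmetric] poly_const_pow
        const_poly_mult add_pCons add_0_left)
  moreover have "A = vary ^ d + varz ^ d" "B = varx ^ d + varz ^ d" "C = varx ^ d + vary ^ d + varz ^ d"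
    by (simp_all add: A_def B_def C_def varx_def vary_def x_def y_def poly_const_pow add.commute)
  ultimately have "squarefree (varx * (vary * (vary ^ d + varx ^ d)) *
      (varz * ((vary ^ d + varz ^ d) * ((varx ^ d + varz ^ d) * (varx ^ d + vary ^ d + varz ^ d)))))"
    by (simp only:)
  then show ?thesis by (simp add: F'_def ac_simps)
qed

lemma squarefree_F'': "d > 0 \<Longrightarrow> squarefree (F'' d)"
  by (rule squarefree_mono[OF _ squarefree_F'])
    (auto simp: F'_def F''_def intro!: dvdI[of _ _ "varz * (varx ^ d + vary ^ d)"])

section \<open>Degrees of the curves\<close>

lemma homogeneous_var_power:
  "homogeneous n (varx ^ n)" "homogeneous n (vary ^ n)" "homogeneous n (varz ^ n)"
  using homogeneous_power[OF homogeneous_vars(1)] homogeneous_power[OF homogeneous_vars(2)]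
    homogeneous_power[OF homogeneous_vars(3)] by fastforce+

lemma homogeneous_of_nat_mult: "homogeneous n F \<Longrightarrow> homogeneous n (of_nat k * F)"
  using homogeneous_mult[OF homogeneous_of_nat, of n F k] by simp

lemma homogeneous_zero: "homogeneous n 0"
  by (simp add: homogeneous_def)

lemmas homogeneous_intros = homogeneous_of_nat_mult homogeneous_mult homogeneous_add
  homogeneous_diff homogeneous_minus homogeneous_zero homogeneous_vars homogeneous_var_power

lemma plane_curve_Fermat:
  assumes "d > 0"
  shows "plane_curve d (Fermat d)"
proof -
  have "eval (Fermat d) (1, 0, 0) = 1"
    using assms by (simp add: Fermat_def eval_rules)
  then have "Fermat d \<noteq> 0" by (auto simp: eval.zero)
  then show ?thesis
    using assms by (auto simp: plane_curve_def Fermat_def intro!: homogeneous_intros)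
qed

lemma reduced_curve_F':
  assumes "d > 0"
  shows "reduced_curve (4 * d + 3) (F' d)"
proof -
  \<comment> \<open>The degree is spelled out factor by factor, so that the rule for products can
    match it.\<close>
  have "homogeneous (1 + 1 + 1 + d + d + d + d) (F' d)"
    unfolding F'_def by (intro homogeneous_intros)
  moreover have "1 + 1 + 1 + d + d + d + d = 4 * d + 3" by simp
  ultimately have "homogeneous (4 * d + 3) (F' d)" by (simp only:)
  then show ?thesis
    using squarefree_F'[OF assms] by (auto simp: reduced_curve_def plane_curve_def)
qed

lemma reduced_curve_F'':
  assumes "d > 0"
  shows "reduced_curve (3 * d + 2) (F'' d)"
proof -
  have "homogeneous (1 + 1 + d + d + d) (F'' d)"
    unfolding F''_def by (intro homogeneous_intros)
  moreover have "1 + 1 + d + d + d = 3 * d + 2" by simp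
  ultimately have "homogeneous (3 * d + 2) (F'' d)" by (simp only:)
  then show ?thesis
    using squarefree_F''[OF assms] by (auto simp: reduced_curve_def plane_curve_def)
qed

subsection \<open>The curves are free\<close>

lemma der_vars [simp]:
  "der (a, b, c) varx = a" "der (a, b, c) vary = b" "der (a, b, c) varz = c"
  by (simp_all add: der_def)

lemma der_log_mult:
  assumes "der \<theta> F = k * F" "der \<theta> G = l * G"
  shows "der \<theta> (F * G) = (k + l) * (F * G)"
  by (simp add: der.mult assms algebra_simps)

lemma der_log_power:
  assumes "der \<theta> F = k * F" "n > 0"
  shows "der \<theta> (F ^ n) = of_nat n * (k * F ^ n)"
proof -
  have "F ^ n = F ^ (n - 1) * F" using assms(2) by (cases n) simp_all
  then show ?thesis unfolding der.power assms(1) by (simp add: mult_ac)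
qed

text \<open>By hypothesis X A d/dX + Y B d/dY + Z C d/dZ is logarithmic along the four lines of the
  arrangement other than the axes, with cofactors \<open>k1\<close>, ..., \<open>k4\<close>. Its
  lift sends x^d to d A x^d, so these lines pull back to factors with cofactors d \<open>k1\<close>,
  ..., d \<open>k4\<close>, and the axes contribute A + B + C.\<close>

lemma der_F':
  fixes d :: nat and A B C k1 k2 k3 k4 :: S
  defines "X \<equiv> varx ^ d" and "Y \<equiv> vary ^ d" and "Z \<equiv> varz ^ d"
  assumes "d > 0"
    and 1: "A * X + B * Y = k1 * (X + Y)"
    and 2: "B * Y + C * Z = k2 * (Y + Z)"
    and 3: "A * X + C * Z = k3 * (X + Z)"
    and 4: "A * X + B * Y + C * Z = k4 * (X + Y + Z)"
  shows "der (varx * A, vary * B, varz * C) (F' d) =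
    (A + B + C + of_nat d * (k1 + k2 + k3 + k4)) * F' d"
proof -
  let ?\<theta> = "(varx * A, vary * B, varz * C)"
  have vars: "der ?\<theta> varx = A * varx" "der ?\<theta> vary = B * vary" "der ?\<theta> varz = C * varz"
    by simp_all
  have pow: "der ?\<theta> X = of_nat d * (A * X)" "der ?\<theta> Y = of_nat d * (B * Y)"
    "der ?\<theta> Z = of_nat d * (C * Z)"
    unfolding X_def Y_def Z_def by (rule der_log_power; simp add: \<open>d > 0\<close>)+
  have lines: "der ?\<theta> (X + Y) = of_nat d * k1 * (X + Y)" "der ?\<theta> (Y + Z) = of_nat d * k2 * (Y + Z)"
    "der ?\<theta> (X + Z) = of_nat d * k3 * (X + Z)"
    by (simp_all only: der.add pow mult.assoc distrib_left[symmetric] 1 2 3)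
  have conic: "der ?\<theta> (X + Y + Z) = of_nat d * k4 * (X + Y + Z)"
    by (simp only: der.add pow mult.assoc distrib_left[symmetric] 4)
  have "der ?\<theta> (varx * vary * varz * (X + Y) * (Y + Z) * (X + Z) * (X + Y + Z)) =
    (A + B + C + of_nat d * k1 + of_nat d * k2 + of_nat d * k3 + of_nat d * k4) *
    (varx * vary * varz * (X + Y) * (Y + Z) * (X + Z) * (X + Y + Z))"
    by (intro der_log_mult vars lines conic)
  moreover have "F' d = varx * vary * varz * (X + Y) * (Y + Z) * (X + Z) * (X + Y + Z)"
    by (simp add: F'_def X_def Y_def Z_def)
  moreover have "A + B + C + of_nat d * k1 + of_nat d * k2 + of_nat d * k3 + of_nat d * k4 =
    A + B + C + of_nat d * (k1 + k2 + k3 + k4)"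
    by (simp add: distrib_left add.assoc)
  ultimately show ?thesis by (simp only:)
qed

lemma der_F'':
  fixes d :: nat and A B c W k2 k3 k4 :: S
  defines "X \<equiv> varx ^ d" and "Y \<equiv> vary ^ d" and "Z \<equiv> varz ^ d"
  assumes "d > 0"
    and W: "c * varz ^ (d - 1) = W"
    and 2: "B * Y + W = k2 * (Y + Z)"
    and 3: "A * X + W = k3 * (X + Z)"
    and 4: "A * X + B * Y + W = k4 * (X + Y + Z)"
  shows "der (varx * A, vary * B, c) (F'' d) =
    (A + B + of_nat d * (k2 + k3 + k4)) * F'' d"
proof -
  let ?\<theta> = "(varx * A, vary * B, c)"
  have vars: "der ?\<theta> varx = A * varx" "der ?\<theta> vary = B * vary"
    by simp_all
  have pow: "der ?\<theta> X = of_nat d * (A * X)" "der ?\<theta> Y = of_nat d * (B * Y)"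
    unfolding X_def Y_def by (rule der_log_power; simp add: \<open>d > 0\<close>)+
  have Z: "der ?\<theta> Z = of_nat d * W"
    unfolding Z_def W[symmetric] by (simp add: der.power mult.assoc mult.commute)
  have lines: "der ?\<theta> (Y + Z) = of_nat d * k2 * (Y + Z)"
    "der ?\<theta> (X + Z) = of_nat d * k3 * (X + Z)"
    "der ?\<theta> (X + Y + Z) = of_nat d * k4 * (X + Y + Z)"
    by (simp_all only: der.add pow Z mult.assoc distrib_left[symmetric] 2 3 4)
  have "der ?\<theta> (varx * vary * (Y + Z) * (X + Z) * (X + Y + Z)) =
    (A + B + of_nat d * k2 + of_nat d * k3 + of_nat d * k4) *
    (varx * vary * (Y + Z) * (X + Z) * (X + Y + Z))"
    by (intro der_log_mult vars lines)
  moreover have "F'' d = varx * vary * (Y + Z) * (X + Z) * (X + Y + Z)"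
    by (simp add: F''_def X_def Y_def Z_def)
  moreover have "A + B + of_nat d * k2 + of_nat d * k3 + of_nat d * k4 =
    A + B + of_nat d * (k2 + k3 + k4)"
    by (simp add: distrib_left add.assoc)
  ultimately show ?thesis by (simp only:)
qed

lemma Euler_F':
  assumes "d > 0"
  shows "der Euler (F' d) = of_nat (4 * d + 3) * F' d"
  using der_F'[OF assms, of 1 1 1 1 1 1 1] by (simp add: algebra_simps)

lemma Euler_F'':
  assumes "d > 0"
  shows "der Euler (F'' d) = of_nat (3 * d + 2) * F'' d"
proof -
  have "varz * varz ^ (d - 1) = varz ^ d"
    using assms by (cases d) simp_all
  then show ?thesis
    using der_F''[OF assms, of varz "varz ^ d" 1 1 1 1 1] by (simp add: algebra_simps)
qed

lemma der_minus_Euler_mem_D0: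
  assumes "der Euler G = of_nat n * G" "der (a, b, c) G = k * G"
  shows "(of_nat n * a - k * varx, of_nat n * b - k * vary, of_nat n * c - k * varz) \<in> D0 G"
proof -
  have "der (of_nat n * a - k * varx, of_nat n * b - k * vary, of_nat n * c - k * varz) G =
    of_nat n * der (a, b, c) G - k * der Euler G"
    by (simp add: der_def algebra_simps)
  then show ?thesis by (simp add: mem_D0_iff assms)
qed

lemma free_F':
  assumes "d > 0"
  shows "free_with_exponents (F' d) (2 * d + 1) (2 * d + 1)"
proof -
  define X Y Z where XYZ: "X = varx ^ d" "Y = vary ^ d" "Z = varz ^ d"
  define P Q R where PQR: "P = X + Y" "Q = Y + Z" "R = X + Z"
  define N D where "N = (of_nat (4 * d + 3) :: S)" and "D = (of_nat d :: S)"
  \<comment> \<open>Subtracting a multiple of E makes the third coefficient 0. The determinant is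
    then xyz (A1 B2 - B1 A2), up to the factor N^2, and P + Q + R = 2 (X + Y + Z) turns A1 B2 - B1
    A2 into 2 P Q R (X + Y + Z).\<close>
  define A1 B1 where AB1: "A1 = - (R * (P + Q))" "B1 = - (Q * R)"
  define A2 B2 where AB2: "A2 = R * P" "B2 = - (Q * P)"
  \<comment> \<open>Inside the factor after \<open>D\<close> stand the cofactors on X + Y, Y + Z, X
    + Z and X + Y + Z, in this order; likewise for \<open>K2\<close>.\<close>
  define K1 where "K1 = A1 + B1 + 0 + D * (- (R * (X + Y + Z)) - Y * R - X * (P + Q) - R * P)"
  define K2 where "K2 = A2 + B2 + 0 + D * ((X - Y) * (X + Y + Z) - Y * P + X * P + P * (X - Y))"
  define \<theta>1 where
    "\<theta>1 = (N * (varx * A1) - K1 * varx, N * (vary * B1) - K1 * vary, N * (varz * 0) - K1 * varz)"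
  define \<theta>2 where
    "\<theta>2 = (N * (varx * A2) - K2 * varx, N * (vary * B2) - K2 * vary, N * (varz * 0) - K2 * varz)"
  have 1: "\<theta>1 \<in> D0 (F' d)"
    unfolding \<theta>1_def N_def
  proof (rule der_minus_Euler_mem_D0[OF Euler_F'[OF assms]])
    show "der (varx * A1, vary * B1, varz * 0) (F' d) = K1 * F' d"
      unfolding K1_def D_def
      by (subst der_F'[OF assms, of _ _ "- (R * (X + Y + Z))" _ "- (Y * R)" "- (X * (P + Q))" "- (R * P)"])
        (simp_all add: XYZ[symmetric] AB1 PQR algebra_simps)
  qed
  have 2: "\<theta>2 \<in> D0 (F' d)"
    unfolding \<theta>2_def N_def
  proof (rule der_minus_Euler_mem_D0[OF Euler_F'[OF assms]])
    show "der (varx * A2, vary * B2, varz * 0) (F' d) = K2 * F' d"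
      unfolding K2_def D_def
      by (subst der_F'[OF assms, of _ _ "(X - Y) * (X + Y + Z)" _ "- (Y * P)" "X * P" "P * (X - Y)"])
        (simp_all add: XYZ[symmetric] AB2 PQR algebra_simps)
  qed
  \<comment> \<open>The multiples of E subtracted from the last two rows do not affect the
    determinant; scaling these rows gives N^2.\<close>
  have "det3 Euler \<theta>1 \<theta>2 = N * N * (varx * vary * varz * (A1 * B2 - B1 * A2))"
    by (simp add: \<theta>1_def \<theta>2_def det3_def algebra_simps)
  also have "A1 * B2 - B1 * A2 = 2 * (P * Q * R * (X + Y + Z))"
    by (simp add: AB1 AB2 PQR algebra_simps)
  also have "N * N * (varx * vary * varz * (2 * (P * Q * R * (X + Y + Z)))) = 2 * N * N * F' d"
    by (simp add: F'_def XYZ PQR mult_ac)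
  also have "2 * N * N = of_nat (2 * (4 * d + 3) * (4 * d + 3))"
    by (simp add: N_def)
  finally have det: "det3 Euler \<theta>1 \<theta>2 = const3 (of_nat (2 * (4 * d + 3) * (4 * d + 3))) * F' d"
    by (simp only: of_nat_S)
  have basis: "\<theta>1 \<noteq> \<theta>2 \<and> is_basis_of {\<theta>1, \<theta>2} (D0 (F' d))"
    by (rule Saito_criterion[OF squarefree_F'[OF assms] Euler_F'[OF assms] _ 1 2 det])
      (simp, simp only: of_nat_eq_0_iff, simp)
  have XYZ_hom: "homogeneous d X" "homogeneous d Y" "homogeneous d Z"
    by (simp_all add: XYZ homogeneous_var_power)
  have AK: "homogeneous (d + d) A1" "homogeneous (d + d) B1" "homogeneous (d + d) A2"
    "homogeneous (d + d) B2" "homogeneous (d + d) K1" "homogeneous (d + d) K2"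
    unfolding AB1 AB2 K1_def K2_def PQR D_def
    by (intro homogeneous_intros XYZ_hom)+
  \<comment> \<open>The degree has the shape 1 + (d + d) and the variables are moved to the front,
    so that the product rule assigns degree 1 to the variable.\<close>
  have "homogeneous_derivation (1 + (d + d)) \<theta>1" "homogeneous_derivation (1 + (d + d)) \<theta>2"
    unfolding \<theta>1_def \<theta>2_def homogeneous_derivation_def N_def prod.case mult.commute[of _ varx]
      mult.commute[of _ vary] mult.commute[of _ varz]
    by (intro conjI homogeneous_intros AK)+
  moreover have "1 + (d + d) = 2 * d + 1" by simp
  ultimately show ?thesis
    unfolding free_with_exponents_def using basis reduced_curve_F'[OF assms] by metis
qed

lemma free_F'':
  assumes "d > 0"
  shows "free_with_exponents (F'' d) (d + 1) (2 * d)"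
proof -
  define X Y Z where XYZ: "X = varx ^ d" "Y = vary ^ d" "Z = varz ^ d"
  define z1 where "z1 = varz ^ (d - 1)"
  have z1: "varz * z1 = Z"
    using assms by (cases d) (simp_all add: z1_def XYZ)
  define N D where "N = (of_nat (3 * d + 2) :: S)" and "D = (of_nat d :: S)"
  \<comment> \<open>This belongs to X (X + Z) d/dX - Y (Y + Z) d/dY, whose cofactors on Y + Z, X + Z
    and X + Y + Z are -Y, X and X - Y.\<close>
  define K1 where "K1 = (X + Z) + (- Y - Z) + D * (- Y + X + (X - Y))"
  define K2 where "K2 = (X + Y + Z) + X + D * (0 + X + X)"
  define \<theta>1 where
    "\<theta>1 = (N * (varx * (X + Z)) - K1 * varx, N * (vary * (- Y - Z)) - K1 * vary, N * 0 - K1 * varz)"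
  \<comment> \<open>The source is X (X + Y + Z) d/dX + X Y d/dY - X Y d/dZ. Multiplication by
    \<open>z1\<close> clears the denominator in the lift of d/dZ, so the z-coefficient is -X Y
    without \<open>z1\<close>.\<close>
  define \<theta>2 where
    "\<theta>2 = (N * (varx * (z1 * (X + Y + Z))) - z1 * K2 * varx, N * (vary * (z1 * X)) - z1 * K2 * vary,
       N * (- (X * Y)) - z1 * K2 * varz)"
  have 1: "\<theta>1 \<in> D0 (F'' d)"
    unfolding \<theta>1_def N_def
  proof (rule der_minus_Euler_mem_D0[OF Euler_F''[OF assms]])
    show "der (varx * (X + Z), vary * (- Y - Z), 0) (F'' d) = K1 * F'' d"
      unfolding K1_def D_def
      by (subst der_F''[OF assms, of _ 0 _ "- Y" _ X "X - Y"])
        (simp_all add: XYZ[symmetric] algebra_simps)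
  qed
  have 2: "\<theta>2 \<in> D0 (F'' d)"
    unfolding \<theta>2_def N_def
  proof (rule der_minus_Euler_mem_D0[OF Euler_F''[OF assms]])
    show "der (varx * (z1 * (X + Y + Z)), vary * (z1 * X), - (X * Y)) (F'' d) = z1 * K2 * F'' d"
      unfolding K2_def D_def
      by (subst der_F''[OF assms, of _ "- (X * Y * z1)" _ 0 _ "z1 * X" "z1 * X"])
        (simp_all add: XYZ[symmetric] z1_def algebra_simps)
  qed
  have "det3 Euler \<theta>1 \<theta>2 = N * N * (varx * vary *
      ((Y + Z) * (X * Y) + (X + Z) * (X * Y) + varz * z1 * ((X + Z) * X + (Y + Z) * (X + Y + Z))))"
    by (simp add: \<theta>1_def \<theta>2_def det3_def algebra_simps)
  also have "(Y + Z) * (X * Y) + (X + Z) * (X * Y) + varz * z1 * ((X + Z) * X + (Y + Z) * (X + Y + Z))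
    = (Y + Z) * (X + Z) * (X + Y + Z)"
    by (simp add: z1 algebra_simps)
  also have "N * N * (varx * vary * ((Y + Z) * (X + Z) * (X + Y + Z))) = N * N * F'' d"
    by (simp add: F''_def XYZ mult_ac)
  also have "N * N = of_nat ((3 * d + 2) * (3 * d + 2))"
    by (simp only: N_def of_nat_mult)
  finally have det: "det3 Euler \<theta>1 \<theta>2 = const3 (of_nat ((3 * d + 2) * (3 * d + 2))) * F'' d"
    by (simp only: of_nat_S)
  have basis: "\<theta>1 \<noteq> \<theta>2 \<and> is_basis_of {\<theta>1, \<theta>2} (D0 (F'' d))"
    by (rule Saito_criterion[OF squarefree_F''[OF assms] Euler_F''[OF assms] _ 1 2 det])
      (simp, simp only: of_nat_eq_0_iff, simp)
  have XYZ_hom: "homogeneous d X" "homogeneous d Y" "homogeneous d Z"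
    by (simp_all add: XYZ homogeneous_var_power)
  have K: "homogeneous d K1" "homogeneous d K2"
    unfolding K1_def K2_def D_def by (intro homogeneous_intros XYZ_hom)+
  have "homogeneous_derivation (1 + d) \<theta>1"
    unfolding \<theta>1_def homogeneous_derivation_def N_def prod.case mult.commute[of K1]
    by (intro conjI homogeneous_intros XYZ_hom K)
  moreover have "homogeneous_derivation (d + d) \<theta>2"
  proof -
    \<comment> \<open>As d > 0, the truncated difference satisfies 1 + (d - 1) = d, so these degrees
      agree with that of X Y.\<close>
    have h: "homogeneous (1 + (d - 1 + d)) (varx * (z1 * (X + Y + Z)))"
      "homogeneous (1 + (d - 1 + d)) (varx * (z1 * K2))"
      "homogeneous (1 + (d - 1 + d)) (vary * (z1 * X))"
      "homogeneous (1 + (d - 1 + d)) (vary * (z1 * K2))"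
      "homogeneous (1 + (d - 1 + d)) (varz * (z1 * K2))"
      "homogeneous (d + d) (X * Y)"
      unfolding z1_def by (intro homogeneous_intros XYZ_hom K)+
    have eq: "1 + (d - 1 + d) = d + d" using assms by simp
    show ?thesis
      unfolding \<theta>2_def homogeneous_derivation_def N_def prod.case mult.commute[of "z1 * K2"]
      by (intro conjI homogeneous_diff homogeneous_of_nat_mult homogeneous_minus h[unfolded eq])
  qed
  moreover have "1 + d = d + 1" "d + d = 2 * d" by simp_all
  ultimately show ?thesis
    unfolding free_with_exponents_def using basis reduced_curve_F''[OF assms] by metis
qed

subsection \<open>The complete local ring\<close>

interpretation dv: derivation dv
  unfolding dv_def by (rule derivation_fps_deriv)

interpretation du: derivation du
proof
  fix f g :: local_ring
  show "du (f + g) = du f + du g"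
    by (rule fps_ext) (simp add: du_def)
  show "du (f * g) = du f * g + f * du g"
    by (rule fps_ext)
      (simp add: du_def fps_mult_nth derivation.sum[OF derivation_fps_deriv] sum.distrib
        add.commute)
qed

lemma partial_local [simp]:
  "du lu = 1" "du lv = 0" "dv lu = 0" "dv lv = 1" "du (lconst c) = 0" "dv (lconst c) = 0"
  by (rule fps_ext; simp add: du_def lu_def lv_def lconst_def)
    (rule fps_ext; simp add: du_def lu_def lv_def lconst_def |
      simp add: dv_def lu_def lv_def lconst_def)+

lemma local_unit:
  assumes "fps_nth (fps_nth w 0) 0 \<noteq> 0"
  obtains w' :: local_ring where "w * w' = 1"
proof -
  have "fps_nth w 0 * inverse (fps_nth w 0) = 1"
    using assms by (simp add: inverse_mult_eq_1')
  then have "w * fps_right_inverse w (inverse (fps_nth w 0)) = 1"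
    by (rule fps_right_inverse)
  then show thesis by (rule that)
qed

text \<open>
  Formal coordinates \<open>s, t\<close> of the local ring, where \<open>k f i j\<close> is the coefficient of
  \<open>s\<^sup>i t\<^sup>j\<close> in \<open>f\<close>; this treats \<open>u, v\<close> symmetrically.
\<close>

locale local_coordinates =
  fixes s t :: local_ring and k :: "local_ring \<Rightarrow> nat \<Rightarrow> nat \<Rightarrow> complex"
    and Ds Dt :: "local_ring \<Rightarrow> local_ring"
  assumes k_add: "k (f + g) i j = k f i j + k g i j"
    and k_lconst_mult: "k (lconst c * f) i j = c * k f i j"
    and k_one: "k 1 i j = (if i = 0 \<and> j = 0 then 1 else 0)"
    and k_s_mult: "k (s * f) i j = (if i = 0 then 0 else k f (i - 1) j)"
    and k_t_mult: "k (t * f) i j = (if j = 0 then 0 else k f i (j - 1))"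
    and unit: "k f 0 0 \<noteq> 0 \<Longrightarrow> \<exists>f'. f * f' = 1"
    and decompose: "\<exists>g h. f = lconst (k f 0 0) + s * g + t * h"
    and Ds: "derivation Ds" "Ds s = 1" "Ds t = 0" "\<And>c. Ds (lconst c) = 0"
    and Dt: "derivation Dt" "Dt s = 0" "Dt t = 1" "\<And>c. Dt (lconst c) = 0"
begin

lemma k_zero: "k 0 i j = 0"
  using k_add[of 0 0] by simp

lemma k_minus: "k (- f) i j = - k f i j"
  using k_add[of f "- f"] by (simp add: k_zero add_eq_0_iff)

lemma k_diff: "k (f - g) i j = k f i j - k g i j"
  using k_add[of f "- g"] by (simp add: k_minus)

lemma k_lconst: "k (lconst c) i j = (if i = 0 \<and> j = 0 then c else 0)"
  using k_lconst_mult[of c 1] by (simp add: k_one)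

lemma k_s: "k s i j = (if i = 1 \<and> j = 0 then 1 else 0)"
  using k_s_mult[of 1 i j] by (auto simp: k_one)

lemma k_t: "k t i j = (if i = 0 \<and> j = 1 then 1 else 0)"
  using k_t_mult[of 1 i j] by (auto simp: k_one)

lemmas k_simps = k_s k_t k_add k_lconst_mult k_one k_s_mult k_t_mult k_zero k_minus k_diff k_lconst

text \<open>Reduction modulo (s^n, t), which leaves only pure powers of s. Each step splits off the
  constant term of the cofactor of s^n, and comparison of coefficients identifies this term with the
  coefficient of s^n in f.\<close>

lemma decompose_s_power:
  "\<exists>g h. f = (\<Sum>i<n. lconst (k f i 0) * s ^ i) + s ^ n * g + t * h"
proof (induction n)
  case 0
  have "f = (\<Sum>i<0. lconst (k f i 0) * s ^ i) + s ^ 0 * f + t * 0" by simp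
  then show ?case by blast
next
  case (Suc n)
  then obtain g h where f: "f = (\<Sum>i<n. lconst (k f i 0) * s ^ i) + s ^ n * g + t * h" by blast
  obtain g' h' where g: "g = lconst (k g 0 0) + s * g' + t * h'" using decompose by blast
  have k_pow: "k (s ^ m * q) i j = (if i < m then 0 else k q (i - m) j)" for m q i j
    by (induction m arbitrary: i) (auto simp: k_s_mult mult.assoc)
  have k_sum: "k (\<Sum>i<m. lconst (c i) * s ^ i) m 0 = 0" for c m
  proof -
    have "k (\<Sum>i<l. lconst (c i) * s ^ i) m 0 = 0" if "l \<le> m" for l
      using that k_pow[of _ 1] by (induction l) (simp_all add: k_simps)
    then show ?thesis by blast
  qed
  have "k f n 0 = k g 0 0"
    by (subst f) (simp add: k_add k_sum k_pow k_t_mult)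
  then have "f = (\<Sum>i<Suc n. lconst (k f i 0) * s ^ i) + s ^ Suc n * g' + t * (s ^ n * h' + h)"
    by (subst f, subst g) (simp add: algebra_simps)
  then show ?case by blast
qed

end

interpretation uv: local_coordinates lu lv "\<lambda>f i j. fps_nth (fps_nth f j) i" du dv
proof
  fix f g :: local_ring and i j :: nat and c :: complex
  show "fps_nth (fps_nth (lconst c * f) j) i = c * fps_nth (fps_nth f j) i"
    by (simp add: lconst_def)
  show "fps_nth (fps_nth (1 :: local_ring) j) i = (if i = 0 \<and> j = 0 then 1 else 0)"
    by simp
  show "fps_nth (fps_nth (lu * f) j) i = (if i = 0 then 0 else fps_nth (fps_nth f j) (i - 1))"
    by (simp add: lu_def)
  show "fps_nth (fps_nth (lv * f) j) i = (if j = 0 then 0 else fps_nth (fps_nth f (j - 1)) i)"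
    by (simp add: lv_def)
  have "f = fps_const (fps_nth f 0) + lv * fps_shift 1 f"
    by (rule fps_ext) (simp add: lv_def)
  moreover have "fps_nth f 0 = fps_const (fps_nth (fps_nth f 0) 0) + fps_X * fps_shift 1 (fps_nth f 0)"
    by (rule fps_ext) simp
  then have "fps_const (fps_nth f 0) =
      lconst (fps_nth (fps_nth f 0) 0) + lu * fps_const (fps_shift 1 (fps_nth f 0))"
    by (metis fps_const_add fps_const_mult lconst_def lu_def)
  ultimately show "\<exists>g h. f = lconst (fps_nth (fps_nth f 0) 0) + lu * g + lv * h" by metis
  show "\<exists>f'. f * f' = 1" if "fps_nth (fps_nth f 0) 0 \<noteq> 0"
    using local_unit[OF that] by blast
qed (simp_all add: du.add du.mult dv.add dv.mult)

interpretation vu: local_coordinates lv lu "\<lambda>f i j. fps_nth (fps_nth f i) j" dv du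
proof
  fix f :: local_ring
  show "\<exists>g h. f = lconst (fps_nth (fps_nth f 0) 0) + lv * g + lu * h"
    using uv.decompose[of f] by (metis add.assoc add.commute)
  show "\<exists>f'. f * f' = 1" if "fps_nth (fps_nth f 0) 0 \<noteq> 0"
    using that by (rule uv.unit)
qed (simp_all add: uv.k_simps du.add du.mult dv.add dv.mult)

section \<open>Ideals of the local ring\<close>

lemma ideal_gen_base: "f \<in> A \<Longrightarrow> f \<in> ideal_gen A"
  unfolding ideal_gen_def by (rule module.span_base[OF module_local_ring])

lemma ideal_gen_add: "f \<in> ideal_gen A \<Longrightarrow> g \<in> ideal_gen A \<Longrightarrow> f + g \<in> ideal_gen A"
  unfolding ideal_gen_def by (rule module.span_add[OF module_local_ring])

lemma ideal_gen_diff: "f \<in> ideal_gen A \<Longrightarrow> g \<in> ideal_gen A \<Longrightarrow> f - g \<in> ideal_gen A"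
  unfolding ideal_gen_def by (rule module.span_diff[OF module_local_ring])

lemma ideal_gen_mult: "f \<in> ideal_gen A \<Longrightarrow> h * f \<in> ideal_gen A"
  unfolding ideal_gen_def by (rule module.span_scale[OF module_local_ring])

lemma ideal_gen_mult_right: "f \<in> ideal_gen A \<Longrightarrow> f * h \<in> ideal_gen A"
  using ideal_gen_mult[of f A h] by (simp add: mult.commute)

lemmas ideal_gen_intros = ideal_gen_add ideal_gen_diff ideal_gen_mult ideal_gen_mult_right

lemma ideal_gen_mono_gen:
  assumes "A \<subseteq> ideal_gen B"
  shows "ideal_gen A \<subseteq> ideal_gen B"
  using module.span_minimal[OF module_local_ring] module.subspace_span[OF module_local_ring] assms
  unfolding ideal_gen_def by blast

lemma ideal_gen_eqI: "A \<subseteq> ideal_gen B \<Longrightarrow> B \<subseteq> ideal_gen A \<Longrightarrow> ideal_gen A = ideal_gen B"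
  by (meson ideal_gen_mono_gen subset_antisym)

subsection \<open>Colengths\<close>

interpretation lsp: vector_space "\<lambda>c f. lconst c * f"
  by unfold_locales (simp_all add: algebra_simps lconst.rules)

lemma colength_le:
  assumes "finite B" "lsp.span (B \<union> I) = UNIV"
  shows "colength I \<le> enat (card B)"
  unfolding colength_def by (rule INF_lower) (use assms in auto)

text \<open>The map P, built from the functionals, fixes each \<open>b i\<close> and kills I. It
  therefore carries any set that spans modulo I to a set whose span contains all \<open>b i\<close>.
  These are independent by duality, so the set has at least n elements.\<close>

lemma colength_ge:
  fixes \<phi> :: "nat \<Rightarrow> local_ring \<Rightarrow> complex" and b :: "nat \<Rightarrow> local_ring"
  assumes \<phi>_add: "\<And>i f g. i < n \<Longrightarrow> \<phi> i (f + g) = \<phi> i f + \<phi> i g"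
    and \<phi>_scale: "\<And>i c f. i < n \<Longrightarrow> \<phi> i (lconst c * f) = c * \<phi> i f"
    and \<phi>_I: "\<And>i f. i < n \<Longrightarrow> f \<in> I \<Longrightarrow> \<phi> i f = 0"
    and dual: "\<And>i j. i < n \<Longrightarrow> j < n \<Longrightarrow> \<phi> i (b j) = (if i = j then 1 else 0)"
  shows "enat n \<le> colength I"
  unfolding colength_def
proof (rule INF_greatest)
  fix B assume "B \<in> {B. finite B \<and> lsp.span (B \<union> I) = UNIV}"
  then have B: "finite B" "lsp.span (B \<union> I) = UNIV" by auto
  define P where "P f = (\<Sum>j<n. lconst (\<phi> j f) * b j)" for f
  have P_add: "P (f + g) = P f + P g" for f g
    by (simp add: P_def \<phi>_add lconst.add distrib_right sum.distrib)
  have P_scale: "P (lconst c * f) = lconst c * P f" for c f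
  proof -
    have "P (lconst c * f) = (\<Sum>j<n. lconst c * (lconst (\<phi> j f) * b j))"
      unfolding P_def by (rule sum.cong) (simp_all add: \<phi>_scale)
    then show ?thesis by (simp add: P_def sum_distrib_left)
  qed
  have "Vector_Spaces.linear (\<lambda>c f. lconst c * f) (\<lambda>c f. lconst c * f) P"
    by (intro Vector_Spaces.linear.intro lsp.vector_space_axioms module_hom.intro
        module_lconst module_hom_axioms.intro P_add P_scale)
  then interpret P: Vector_Spaces.linear "\<lambda>c f. lconst c * f" "\<lambda>c f. lconst c * f" P .
  have Pb: "P (b i) = b i" if "i < n" for i
  proof -
    have "P (b i) = (\<Sum>j<n. if j = i then b i else 0)"
      unfolding P_def by (rule sum.cong) (simp_all add: dual that lconst.one lconst.zero)
    then show ?thesis using that by simp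
  qed
  have "b ` {..<n} \<subseteq> lsp.span (P ` B)"
  proof
    fix y assume "y \<in> b ` {..<n}"
    then have "y = P y" using Pb by auto
    moreover have "P y \<in> P ` lsp.span (B \<union> I)" by (simp add: B(2))
    moreover have "P ` lsp.span (B \<union> I) = lsp.span (P ` (B \<union> I))"
      by (rule P.span_image[symmetric])
    moreover have "lsp.span (P ` (B \<union> I)) \<subseteq> lsp.span (P ` B)"
    proof (rule lsp.span_minimal)
      have "P f = 0" if "f \<in> I" for f
        using that by (simp add: P_def \<phi>_I lconst.zero)
      then show "P ` (B \<union> I) \<subseteq> lsp.span (P ` B)"
        by (auto intro: lsp.span_base lsp.span_zero)
    qed (rule lsp.subspace_span)
    ultimately show "y \<in> lsp.span (P ` B)" by auto
  qed
  moreover have inj: "inj_on b {..<n}"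
    by (rule inj_onI) (metis dual lessThan_iff zero_neq_one)
  have "lsp.independent (b ` {..<n})"
    unfolding lsp.dependent_finite[OF finite_imageI[OF finite_lessThan]]
  proof safe
    fix c i
    assume "(\<Sum>v\<in>b ` {..<n}. lconst (c v) * v) = 0" and i: "i < n" and "c (b i) \<noteq> 0"
    then have 0: "(\<Sum>j<n. lconst (c (b j)) * b j) = 0"
      by (simp add: sum.reindex[OF inj])
    have "\<phi> i 0 = 0" using \<phi>_add[OF i, of 0 0] by simp
    have "\<phi> i (\<Sum>j\<in>J. lconst (c (b j)) * b j) = (\<Sum>j\<in>J. c (b j) * \<phi> i (b j))" for J
      by (induction J rule: infinite_finite_induct) (simp_all add: \<phi>_add \<phi>_scale i \<open>\<phi> i 0 = 0\<close>)
    then have "(\<Sum>j<n. c (b j) * \<phi> i (b j)) = 0"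
      using 0 \<open>\<phi> i 0 = 0\<close> by metis
    moreover have "(\<Sum>j<n. c (b j) * \<phi> i (b j)) = (\<Sum>j<n. if j = i then c (b i) else 0)"
      by (rule sum.cong) (simp_all add: dual i)
    ultimately show False using i \<open>c (b i) \<noteq> 0\<close> by simp
  qed
  ultimately have "card (b ` {..<n}) \<le> card (P ` B)"
    using lsp.independent_span_bound B(1) by blast
  also have "\<dots> \<le> card B" using B(1) by (rule card_image_le)
  finally show "enat n \<le> enat (card B)" by (simp add: card_image[OF inj])
qed

text \<open>The functionals read off the coordinates of a normal form modulo I: duality makes the
  classes of the \<open>b i\<close> independent, and \<open>rest\<close> says that they span the
  quotient.\<close>

lemma colength_eq:
  fixes \<phi> :: "nat \<Rightarrow> local_ring \<Rightarrow> complex" and b :: "nat \<Rightarrow> local_ring"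
  assumes \<phi>_add: "\<And>i f g. i < n \<Longrightarrow> \<phi> i (f + g) = \<phi> i f + \<phi> i g"
    and \<phi>_scale: "\<And>i c f. i < n \<Longrightarrow> \<phi> i (lconst c * f) = c * \<phi> i f"
    and \<phi>_I: "\<And>i f. i < n \<Longrightarrow> f \<in> I \<Longrightarrow> \<phi> i f = 0"
    and dual: "\<And>i j. i < n \<Longrightarrow> j < n \<Longrightarrow> \<phi> i (b j) = (if i = j then 1 else 0)"
    and rest: "\<And>f. f - (\<Sum>j<n. lconst (\<phi> j f) * b j) \<in> I"
  shows "colength I = enat n"
proof (rule antisym)
  show "enat n \<le> colength I" using assms(1-4) by (rule colength_ge)
  have "f \<in> lsp.span (b ` {..<n} \<union> I)" for f
  proof -
    have "(\<Sum>j<n. lconst (\<phi> j f) * b j) + (f - (\<Sum>j<n. lconst (\<phi> j f) * b j)) \<in>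
        lsp.span (b ` {..<n} \<union> I)"
      by (intro lsp.span_add lsp.span_sum lsp.span_scale lsp.span_base)
        (use rest in auto)
    then show ?thesis by simp
  qed
  then have "colength I \<le> enat (card (b ` {..<n}))"
    by (intro colength_le) auto
  also have "\<dots> \<le> enat n"
    using card_image_le[of "{..<n}" b] by simp
  finally show "colength I \<le> enat n" .
qed

subsection \<open>Tjurina numbers\<close>

text \<open>D(w g) = D(w) g + w D(g) is congruent to w D(g) modulo g for each derivation D. Thus the
  Tjurina ideal depends on the germ of the curve and not on the chosen equation.\<close>

lemma ideal_gen_partials_unit_mult:
  fixes w g :: local_ring
  assumes "w * w' = 1"
  shows "ideal_gen {w * g, du (w * g), dv (w * g)} = ideal_gen {g, du g, dv g}"
proof (rule ideal_gen_eqI)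
  have "g \<in> ideal_gen {g, du g, dv g}" "du g \<in> ideal_gen {g, du g, dv g}"
    "dv g \<in> ideal_gen {g, du g, dv g}"
    by (simp_all add: ideal_gen_base)
  then have "{w * g, du w * g + w * du g, dv w * g + w * dv g} \<subseteq> ideal_gen {g, du g, dv g}"
    by (simp add: ideal_gen_add ideal_gen_mult)
  then show "{w * g, du (w * g), dv (w * g)} \<subseteq> ideal_gen {g, du g, dv g}"
    by (simp add: du.mult dv.mult)
  let ?I = "ideal_gen {w * g, du (w * g), dv (w * g)}"
  have "w' * (w * g) \<in> ?I" by (intro ideal_gen_intros ideal_gen_base) simp
  moreover have g: "w' * (w * h) = h" for h
    using assms by (metis mult.assoc mult.commute mult_1)
  ultimately have "g \<in> ?I" by simp
  moreover have "D g \<in> ?I" if "derivation D" "D (w * g) \<in> ?I" for D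
  proof -
    have "w' * (D (w * g) - D w * g) \<in> ?I"
      using that(2) \<open>g \<in> ?I\<close> by (intro ideal_gen_mult ideal_gen_diff)
    then show ?thesis using that(1) by (simp add: derivation.mult g)
  qed
  ultimately show "{g, du g, dv g} \<subseteq> ?I"
    using du.derivation_axioms dv.derivation_axioms by (simp add: ideal_gen_base)
qed

lemma tjurina_eq:
  assumes "germ F p = w * g" "fps_nth (fps_nth w 0) 0 \<noteq> 0"
  shows "tjurina F p = colength (ideal_gen {g, du g, dv g})"
  using local_unit[OF assms(2)] ideal_gen_partials_unit_mult
  unfolding tjurina_def Let_def assms(1) by metis

text \<open>Coefficient functionals are not linear over the local ring, so they are tested on all
  multiples of the generators.\<close>

lemma ideal_gen_functional_eq_0:
  fixes \<phi> :: "local_ring \<Rightarrow> complex"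
  assumes "f \<in> ideal_gen A" "\<And>f g. \<phi> (f + g) = \<phi> f + \<phi> g"
    and "\<And>g h. g \<in> A \<Longrightarrow> \<phi> (g * h) = 0"
  shows "\<phi> f = 0"
proof (rule module.span_induct_alt[OF module_local_ring, where h = "\<lambda>f. \<phi> f = 0"])
  show "f \<in> module.span (*) A" using assms(1) by (simp add: ideal_gen_def)
  show "\<phi> 0 = 0" using assms(2)[of 0 0] by simp
  show "\<phi> (c * x + y) = 0" if "x \<in> A" "\<phi> y = 0" for c x y
    using assms(2)[of "c * x" y] assms(3)[OF that(1), of c] that(2) by (simp add: mult.commute[of c x])
qed

section \<open>Tjurina algebras of the node, D4 and D6\<close>

context local_coordinates
begin

text \<open>The cut is chosen for the quotients below: the remainder monomials s^5, s^3 t, s t^2 and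
  t^3 lie in the Tjurina ideals of both D4 and D6.\<close>

lemma decompose_low_order:
  "\<exists>p q r1 r2. f = lconst (k f 0 0) + lconst (k f 1 0) * s + lconst (k f 2 0) * s ^ 2
      + lconst (k f 3 0) * s ^ 3 + lconst (k f 4 0) * s ^ 4 + s ^ 5 * p
      + t * (lconst (k f 0 1) + lconst (k f 1 1) * s + lconst (k f 2 1) * s ^ 2 + s ^ 3 * q)
      + t ^ 2 * (lconst (k f 0 2) + s * r1 + t * r2)"
proof -
  obtain p q where f: "f = lconst (k f 0 0) + lconst (k f 1 0) * s + lconst (k f 2 0) * s ^ 2
      + lconst (k f 3 0) * s ^ 3 + lconst (k f 4 0) * s ^ 4 + s ^ 5 * p + t * q"
    using decompose_s_power[of f 5] by (auto simp: eval_nat_numeral)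
  obtain p' q' where q: "q = lconst (k q 0 0) + lconst (k q 1 0) * s + lconst (k q 2 0) * s ^ 2
      + s ^ 3 * p' + t * q'"
    using decompose_s_power[of q 3] by (auto simp: eval_nat_numeral)
  obtain r1 r2 where q': "q' = lconst (k q' 0 0) + s * r1 + t * r2"
    using decompose by blast
  have k1: "k q 0 0 = k f 0 1" "k q 1 0 = k f 1 1" "k q 2 0 = k f 2 1" "k q 0 1 = k f 0 2"
    using arg_cong[OF f, of "\<lambda>x. k x 0 1"] arg_cong[OF f, of "\<lambda>x. k x 1 1"]
      arg_cong[OF f, of "\<lambda>x. k x 2 1"] arg_cong[OF f, of "\<lambda>x. k x 0 2"]
    by (simp_all add: k_simps eval_nat_numeral mult.assoc)
  have k2: "k q' 0 0 = k q 0 1"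
    using arg_cong[OF q, of "\<lambda>x. k x 0 1"]
    by (simp add: k_simps eval_nat_numeral mult.assoc)
  have q'_eq: "q' = lconst (k f 0 2) + s * r1 + t * r2"
    using q' unfolding k2 k1 .
  have q_eq: "q = lconst (k f 0 1) + lconst (k f 1 1) * s + lconst (k f 2 1) * s ^ 2
      + s ^ 3 * p' + t * (lconst (k f 0 2) + s * r1 + t * r2)"
    using q unfolding k1 q'_eq .
  have "t * (a + t * e) = t * a + t ^ 2 * e" for a e
    by (simp add: algebra_simps power2_eq_square)
  then have tq: "t * q = t * (lconst (k f 0 1) + lconst (k f 1 1) * s + lconst (k f 2 1) * s ^ 2 + s ^ 3 * p')
      + t ^ 2 * (lconst (k f 0 2) + s * r1 + t * r2)"
    unfolding q_eq .
  show ?thesis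
    using f unfolding tq add.assoc by blast
qed

lemma colength_maximal_ideal: "colength (ideal_gen {s * t, t, s}) = 1"
  unfolding one_enat_def
proof (rule colength_eq[of _ "\<lambda>_ f. k f 0 0" _ "\<lambda>_. 1"])
  fix f assume "f \<in> ideal_gen {s * t, t, s}"
  then show "k f 0 0 = 0"
    by (rule ideal_gen_functional_eq_0) (auto simp: k_simps mult.assoc)
next
  fix f
  obtain g h where "f = lconst (k f 0 0) + s * g + t * h" using decompose by blast
  then have "f - lconst (k f 0 0) = s * g + t * h" by (metis add.assoc add_diff_cancel_left')
  then show "f - (\<Sum>j<1 :: nat. lconst (k f 0 0) * 1) \<in> ideal_gen {s * t, t, s}"
    by (simp add: ideal_gen_add ideal_gen_mult_right ideal_gen_base)
qed (auto simp: k_simps)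

lemma ideal_gen_lconst_cancel:
  assumes "lconst c * f \<in> ideal_gen A" "c \<noteq> 0"
  shows "f \<in> ideal_gen A"
proof -
  have "lconst (inverse c) * (lconst c * f) \<in> ideal_gen A"
    using assms(1) by (rule ideal_gen_mult)
  moreover have "lconst (inverse c) * (lconst c * f) = f"
    using assms(2) by (simp add: lconst.one)
  ultimately show ?thesis by (simp only:)
qed

text \<open>The last two generators are the partial derivatives of the first. The ideal contains s
  t, s^3 and t^3, and the relation t^2 = -3 s^2 leaves the basis 1, s, t, s^2.\<close>

lemma colength_D4: "colength (ideal_gen {s * (s ^ 2 + t ^ 2), 3 * s ^ 2 + t ^ 2, 2 * s * t}) = 4"
proof -
  define I where "I = ideal_gen {s * (s ^ 2 + t ^ 2), 3 * s ^ 2 + t ^ 2, 2 * s * t}"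
  have num: "(numeral n :: local_ring) = lconst (numeral n)" for n
    by (simp add: lconst.numeral)
  have gens: "s * (s ^ 2 + t ^ 2) \<in> I" "3 * s ^ 2 + t ^ 2 \<in> I" "2 * s * t \<in> I"
    by (auto simp: I_def intro: ideal_gen_base)
  have I_add: "f \<in> I \<Longrightarrow> h \<in> I \<Longrightarrow> f + h \<in> I" and I_diff: "f \<in> I \<Longrightarrow> h \<in> I \<Longrightarrow> f - h \<in> I"
    and I_mult: "f \<in> I \<Longrightarrow> a * f \<in> I" "f \<in> I \<Longrightarrow> f * a \<in> I" for f h a
    unfolding I_def by (simp_all add: ideal_gen_intros)
  have "lconst 2 * (s * t) \<in> I" using gens(3) by (simp add: num mult.assoc)
  then have st: "s * t \<in> I"
    unfolding I_def by (rule ideal_gen_lconst_cancel) simp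
  have "s * (3 * s ^ 2 + t ^ 2) - t * (s * t) \<in> I"
    by (intro I_diff I_mult(1) gens st)
  moreover have "s * (3 * s ^ 2 + t ^ 2) - t * (s * t) = lconst 3 * s ^ 3"
    by (simp add: num[symmetric] algebra_simps power2_eq_square power3_eq_cube)
  ultimately have s3: "s ^ 3 \<in> I"
    unfolding I_def by (metis ideal_gen_lconst_cancel zero_neq_numeral)
  have "t * (3 * s ^ 2 + t ^ 2) - 3 * s * (s * t) \<in> I"
    by (intro I_diff I_mult(1) gens st)
  moreover have "t * (3 * s ^ 2 + t ^ 2) - 3 * s * (s * t) = t ^ 3"
    by (simp add: algebra_simps power2_eq_square power3_eq_cube)
  ultimately have t3: "t ^ 3 \<in> I" by simp
  \<comment> \<open>Since t^2 becomes -3 s^2, the coefficient of t^2 enters the coordinate of s^2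
    with the factor -3.\<close>
  define \<phi> where "\<phi> i f = [k f 0 0, k f 1 0, k f 0 1, k f 2 0 - 3 * k f 0 2] ! i" for i f
  define b where "b i = [1, s, t, s ^ 2] ! i" for i
  note less_4 = less_Suc_eq eval_nat_numeral
  have "colength I = enat 4"
  proof (rule colength_eq[of _ \<phi> _ b])
    fix i f assume "i < (4 :: nat)" "f \<in> I"
    show "\<phi> i f = 0"
    proof (rule ideal_gen_functional_eq_0)
      show "f \<in> ideal_gen {s * (s ^ 2 + t ^ 2), 3 * s ^ 2 + t ^ 2, 2 * s * t}"
        using \<open>f \<in> I\<close> by (simp add: I_def)
    qed (use \<open>i < 4\<close> in \<open>auto simp: less_4 \<phi>_def k_simps distrib_right mult.assoc
        num power2_eq_square\<close>)
  next
    fix f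
    obtain p q r1 r2 where f: "f = lconst (k f 0 0) + lconst (k f 1 0) * s + lconst (k f 2 0) * s ^ 2
      + lconst (k f 3 0) * s ^ 3 + lconst (k f 4 0) * s ^ 4 + s ^ 5 * p
      + t * (lconst (k f 0 1) + lconst (k f 1 1) * s + lconst (k f 2 1) * s ^ 2 + s ^ 3 * q)
      + t ^ 2 * (lconst (k f 0 2) + s * r1 + t * r2)"
      using decompose_low_order by blast
    have "f - (\<Sum>j<4. lconst (\<phi> j f) * b j) =
      s ^ 3 * (lconst (k f 3 0) + lconst (k f 4 0) * s + s ^ 2 * p)
      + s * t * (lconst (k f 1 1) + lconst (k f 2 1) * s + s ^ 2 * q + t * r1)
      + (3 * s ^ 2 + t ^ 2) * lconst (k f 0 2) + t ^ 3 * r2"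
      by (subst f) (simp add: \<phi>_def b_def eval_nat_numeral lconst.rules algebra_simps)
    also have "\<dots> \<in> I"
      by (intro I_add I_mult(2) s3 st gens t3)
    finally show "f - (\<Sum>j<4. lconst (\<phi> j f) * b j) \<in> I" .
  qed (auto simp: less_4 \<phi>_def b_def k_simps, simp_all add: algebra_simps)
  then show ?thesis by (simp add: I_def numeral_eq_enat)
qed

text \<open>The germ consists of both axes and a smooth branch tangent to t = 0. As t + c is a unit,
  the ideal contains s t^2, s^3 t, t^3 and s^5; the relations 2 c s t = -s^3 and c t^2 = -3 s^2 t
  leave the basis 1, s, s^2, t, s^3, s^4.\<close>

lemma colength_D6:
  assumes "c \<noteq> 0"
  defines "g \<equiv> s * t * (s ^ 2 + t * (t + lconst c))"
  shows "colength (ideal_gen {g, Ds g, Dt g}) = 6"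
proof -
  define I where "I = ideal_gen {g, Ds g, Dt g}"
  have num: "(numeral n :: local_ring) = lconst (numeral n)" for n
    by (simp add: lconst.numeral)
  have Dsg: "Ds g = t * (3 * s ^ 2 + t * (t + lconst c))"
    unfolding g_def using Ds(2-4) by (simp add: derivation.rules[OF Ds(1)] algebra_simps power2_eq_square)
  have Dtg: "Dt g = s * (s ^ 2 + 3 * t ^ 2 + 2 * lconst c * t)"
    unfolding g_def using Dt(2-4) by (simp add: derivation.rules[OF Dt(1)] algebra_simps power2_eq_square)
  have gens: "g \<in> I" "Ds g \<in> I" "Dt g \<in> I"
    by (auto simp: I_def intro: ideal_gen_base)
  obtain e where e: "(t + lconst c) * e = 1"
    using unit[of "t + lconst c"] assms(1) k_t_mult[of 1] by (auto simp: k_simps)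
  have I_add: "f \<in> I \<Longrightarrow> h \<in> I \<Longrightarrow> f + h \<in> I" and I_diff: "f \<in> I \<Longrightarrow> h \<in> I \<Longrightarrow> f - h \<in> I"
    and I_mult: "f \<in> I \<Longrightarrow> a * f \<in> I" "f \<in> I \<Longrightarrow> f * a \<in> I" for f h a
    unfolding I_def by (simp_all add: ideal_gen_intros)
  have I_cancel: "f \<in> I" if "f * (t + lconst c) \<in> I" for f
    using I_mult(2)[OF that, of e] e by (simp add: mult.assoc)
  have "3 * g - s * Ds g \<in> I" by (intro I_diff I_mult(1) gens)
  moreover have "3 * g - s * Ds g = lconst 2 * (s * t ^ 2 * (t + lconst c))"
    unfolding Dsg by (simp add: g_def num[symmetric] algebra_simps power2_eq_square)
  ultimately have "s * t ^ 2 * (t + lconst c) \<in> I"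
    unfolding I_def by (metis ideal_gen_lconst_cancel zero_neq_numeral)
  then have st2: "s * t ^ 2 \<in> I" by (rule I_cancel)
  have "g - (s * t ^ 2) * (t + lconst c) \<in> I" by (intro I_diff I_mult(2) gens st2)
  moreover have "g - (s * t ^ 2) * (t + lconst c) = s ^ 3 * t"
    by (simp add: g_def algebra_simps power2_eq_square power3_eq_cube)
  ultimately have s3t: "s ^ 3 * t \<in> I" by simp
  have "t * Ds g - (s * t ^ 2) * (3 * s) \<in> I" by (intro I_diff I_mult gens st2)
  moreover have "t * Ds g - (s * t ^ 2) * (3 * s) = t ^ 3 * (t + lconst c)"
    unfolding Dsg by (simp add: algebra_simps power2_eq_square power3_eq_cube)
  ultimately have t3: "t ^ 3 \<in> I" using I_cancel by simp
  have "Ds g - t ^ 3 \<in> I" by (intro I_diff gens t3)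
  moreover have "Ds g - t ^ 3 = 3 * s ^ 2 * t + lconst c * t ^ 2"
    unfolding Dsg by (simp add: algebra_simps power2_eq_square power3_eq_cube)
  ultimately have r1: "3 * s ^ 2 * t + lconst c * t ^ 2 \<in> I" by simp
  have "Dt g - 3 * (s * t ^ 2) \<in> I" by (intro I_diff I_mult(1) gens st2)
  moreover have "Dt g - 3 * (s * t ^ 2) = s ^ 3 + 2 * lconst c * s * t"
    unfolding Dtg by (simp add: algebra_simps power2_eq_square power3_eq_cube)
  ultimately have r2: "s ^ 3 + 2 * lconst c * s * t \<in> I" by simp
  have "s ^ 2 * (s ^ 3 + 2 * lconst c * s * t) - 2 * lconst c * (s ^ 3 * t) \<in> I"
    by (intro I_diff I_mult(1) r2 s3t)
  moreover have "s ^ 2 * (s ^ 3 + 2 * lconst c * s * t) - 2 * lconst c * (s ^ 3 * t) = s ^ 5"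
    by (simp add: algebra_simps eval_nat_numeral)
  ultimately have s5: "s ^ 5 \<in> I" by simp
  \<comment> \<open>In the quotient s t = -s^3/(2c), s^2 t = -s^4/(2c) and t^2 = 3 s^4/(2 c^2); the
    last two functionals add these contributions to the coordinates of s^3 and s^4.\<close>
  define \<phi> where "\<phi> i f = [k f 0 0, k f 1 0, k f 2 0, k f 0 1, k f 3 0 - k f 1 1 / (2 * c),
    k f 4 0 - k f 2 1 / (2 * c) + 3 * k f 0 2 / (2 * c\<^sup>2)] ! i" for i f
  define b where "b i = [1, s, s ^ 2, t, s ^ 3, s ^ 4] ! i" for i
  note less_6 = less_Suc_eq eval_nat_numeral
  have "colength I = enat 6"
  proof (rule colength_eq[of _ \<phi> _ b])
    fix i f assume "i < (6 :: nat)" "f \<in> I"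
    show "\<phi> i f = 0"
    proof (rule ideal_gen_functional_eq_0)
      show "f \<in> ideal_gen {g, Ds g, Dt g}" using \<open>f \<in> I\<close> by (simp add: I_def)
    next
      fix a h assume "a \<in> {g, Ds g, Dt g}"
      then consider "a = g" | "a = Ds g" | "a = Dt g" by blast
      then show "\<phi> i (a * h) = 0"
      proof cases
        case 1
        have "a * h = s * (s * (s * (t * h))) + s * (t * (t * (t * h))) + lconst c * (s * (t * (t * h)))"
          by (simp add: 1 g_def algebra_simps power2_eq_square)
        then show ?thesis using \<open>i < 6\<close>
          by (auto simp: less_6 \<phi>_def k_simps)
      next
        case 2
        have "a * h = lconst 3 * (s * (s * (t * h))) + t * (t * (t * h)) + lconst c * (t * (t * h))"
          unfolding 2 Dsg by (simp add: num[symmetric] algebra_simps power2_eq_square)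
        then show ?thesis using \<open>i < 6\<close> assms(1)
          by (auto simp: less_6 \<phi>_def k_simps divide_simps power2_eq_square)
      next
        case 3
        have "a * h = s * (s * (s * h)) + lconst 3 * (s * (t * (t * h))) + lconst (2 * c) * (s * (t * h))"
          unfolding 3 Dtg by (simp add: lconst.mult num[symmetric] algebra_simps power2_eq_square)
        then show ?thesis using \<open>i < 6\<close> assms(1)
          by (auto simp: less_6 \<phi>_def k_simps divide_simps)
      qed
    qed (use \<open>i < 6\<close> in \<open>auto simp: less_6 \<phi>_def k_simps add_divide_distrib\<close>)
  next
    fix f
    obtain p q v w where f: "f = lconst (k f 0 0) + lconst (k f 1 0) * s + lconst (k f 2 0) * s ^ 2
      + lconst (k f 3 0) * s ^ 3 + lconst (k f 4 0) * s ^ 4 + s ^ 5 * p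
      + t * (lconst (k f 0 1) + lconst (k f 1 1) * s + lconst (k f 2 1) * s ^ 2 + s ^ 3 * q)
      + t ^ 2 * (lconst (k f 0 2) + s * v + t * w)"
      using decompose_low_order by blast
    \<comment> \<open>With these scaled coefficients the expansion modulo the ideal becomes a
      polynomial identity without division, which is \<open>identity\<close> below.\<close>
    define \<alpha> \<beta> where \<alpha>: "\<alpha> = k f 1 1 / (2 * c)" and \<beta>: "\<beta> = k f 2 1 / (2 * c)"
    define \<gamma> where \<gamma>: "\<gamma> = k f 0 2 / (2 * c\<^sup>2)"
    have k: "lconst (k f 1 1) = 2 * lconst c * lconst \<alpha>"
      "lconst (k f 2 1) = 2 * lconst c * lconst \<beta>"
      "lconst (k f 0 2) = 2 * lconst c * lconst c * lconst \<gamma>"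
      unfolding num lconst.mult[symmetric] using assms(1) by (simp_all add: \<alpha> \<beta> \<gamma> power2_eq_square)
    have "3 * k f 0 2 / (2 * c\<^sup>2) = 3 * \<gamma>" by (simp add: \<gamma>)
    then have \<phi>: "lconst (\<phi> 0 f) = lconst (k f 0 0)" "lconst (\<phi> 1 f) = lconst (k f 1 0)"
      "lconst (\<phi> 2 f) = lconst (k f 2 0)" "lconst (\<phi> 3 f) = lconst (k f 0 1)"
      "lconst (\<phi> 4 f) = lconst (k f 3 0) - lconst \<alpha>"
      "lconst (\<phi> 5 f) = lconst (k f 4 0) - lconst \<beta> + 3 * lconst \<gamma>"
      unfolding num lconst.mult[symmetric] by (simp_all add: \<phi>_def \<alpha> \<beta> lconst.add lconst.diff)
    have b: "b 0 = 1" "b 1 = s" "b 2 = s ^ 2" "b 3 = t" "b 4 = s ^ 3" "b 5 = s ^ 4"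
      by (simp_all add: b_def)
    have sum_6: "(\<Sum>j<6. h j) = h 0 + h 1 + h 2 + h 3 + h 4 + h 5" for h :: "nat \<Rightarrow> local_ring"
      by (simp add: eval_nat_numeral)
    have identity: "a0 + a1 * s + a2 * s ^ 2 + a3 * s ^ 3 + a4 * s ^ 4 + s ^ 5 * p
        + t * (a5 + 2 * C * x * s + 2 * C * y * s ^ 2 + s ^ 3 * q)
        + t ^ 2 * (2 * C * C * z + s * v + t * w)
        - (a0 * 1 + a1 * s + a2 * s ^ 2 + a5 * t + (a3 - x) * s ^ 3 + (a4 - y + 3 * z) * s ^ 4) =
      (s ^ 3 + 2 * C * s * t) * (x + y * s - 3 * z * s)
      + (3 * s ^ 2 * t + C * t ^ 2) * (2 * C * z)
      + s ^ 5 * p + s ^ 3 * t * q + s * t ^ 2 * v + t ^ 3 * w"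
      for a0 a1 a2 a3 a4 a5 C x y z :: local_ring
      by (simp add: algebra_simps eval_nat_numeral)
    have "f - (\<Sum>j<6. lconst (\<phi> j f) * b j) =
      (s ^ 3 + 2 * lconst c * s * t) * (lconst \<alpha> + lconst \<beta> * s - 3 * lconst \<gamma> * s)
      + (3 * s ^ 2 * t + lconst c * t ^ 2) * (2 * lconst c * lconst \<gamma>)
      + s ^ 5 * p + s ^ 3 * t * q + s * t ^ 2 * v + t ^ 3 * w"
      by (subst f, unfold sum_6 \<phi> b k, rule identity)
    also have "\<dots> \<in> I"
      by (intro I_add I_mult(2) r1 r2 s5 s3t st2 t3)
    finally show "f - (\<Sum>j<6. lconst (\<phi> j f) * b j) \<in> I" .
  qed (auto simp: less_6 \<phi>_def b_def k_simps, simp_all add: add_divide_distrib algebra_simps)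
  then show ?thesis by (simp add: I_def numeral_eq_enat)
qed

end

subsection \<open>Analytic equivalence to the normal forms\<close>

lemma holomorphic2_on_const: "holomorphic2_on (\<lambda>p. c) U"
  unfolding holomorphic2_on_def
  by (rule ballI, rule exI[of _ 0], rule exI[of _ 0]) (simp add: case_prod_unfold)

lemma holomorphic2_on_fst: "holomorphic2_on fst U"
  unfolding holomorphic2_on_def
  by (rule ballI, rule exI[of _ 1], rule exI[of _ 0])
    (simp add: case_prod_unfold has_derivative_fst[OF has_derivative_ident])

lemma holomorphic2_on_snd: "holomorphic2_on snd U"
  unfolding holomorphic2_on_def
  by (rule ballI, rule exI[of _ 0], rule exI[of _ 1])
    (simp add: case_prod_unfold has_derivative_snd[OF has_derivative_ident])

lemma holomorphic2_on_add:
  assumes "holomorphic2_on f U" "holomorphic2_on g U"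
  shows "holomorphic2_on (\<lambda>p. f p + g p) U"
  unfolding holomorphic2_on_def
proof
  fix p assume "p \<in> U"
  then obtain a b c d where
    "(f has_derivative (\<lambda>(h, k). a * h + b * k)) (at p)"
    "(g has_derivative (\<lambda>(h, k). c * h + d * k)) (at p)"
    using assms unfolding holomorphic2_on_def by blast
  then have "((\<lambda>p. f p + g p) has_derivative
      (\<lambda>x. (case x of (h, k) \<Rightarrow> a * h + b * k) + (case x of (h, k) \<Rightarrow> c * h + d * k))) (at p)"
    by (rule has_derivative_add)
  moreover have "(\<lambda>x. (case x of (h, k) \<Rightarrow> a * h + b * k) + (case x of (h, k) \<Rightarrow> c * h + d * k)) =
      (\<lambda>(h, k). (a + c) * h + (b + d) * k)"
    by (auto simp: algebra_simps)
  ultimately show "\<exists>a b. ((\<lambda>p. f p + g p) has_derivative (\<lambda>(h, k). a * h + b * k)) (at p)"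
    by metis
qed

lemma holomorphic2_on_mult:
  assumes "holomorphic2_on f U" "holomorphic2_on g U"
  shows "holomorphic2_on (\<lambda>p. f p * g p) U"
  unfolding holomorphic2_on_def
proof
  fix p assume "p \<in> U"
  then obtain a b c d where
    "(f has_derivative (\<lambda>(h, k). a * h + b * k)) (at p)"
    "(g has_derivative (\<lambda>(h, k). c * h + d * k)) (at p)"
    using assms unfolding holomorphic2_on_def by blast
  then have "((\<lambda>p. f p * g p) has_derivative
      (\<lambda>x. f p * (case x of (h, k) \<Rightarrow> c * h + d * k) + (case x of (h, k) \<Rightarrow> a * h + b * k) * g p)) (at p)"
    by (rule has_derivative_mult)
  moreover have "(\<lambda>x. f p * (case x of (h, k) \<Rightarrow> c * h + d * k) + (case x of (h, k) \<Rightarrow> a * h + b * k) * g p) =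
      (\<lambda>(h, k). (f p * c + a * g p) * h + (f p * d + b * g p) * k)"
    by (auto simp: algebra_simps)
  ultimately show "\<exists>a b. ((\<lambda>p. f p * g p) has_derivative (\<lambda>(h, k). a * h + b * k)) (at p)"
    by metis
qed

lemma holomorphic2_on_minus:
  "holomorphic2_on f U \<Longrightarrow> holomorphic2_on (\<lambda>p. - f p) U"
  using holomorphic2_on_mult[OF holomorphic2_on_const[of "-1"]] by fastforce

lemma holomorphic2_on_diff:
  "holomorphic2_on f U \<Longrightarrow> holomorphic2_on g U \<Longrightarrow> holomorphic2_on (\<lambda>p. f p - g p) U"
  using holomorphic2_on_add[OF _ holomorphic2_on_minus] by fastforce

lemma holomorphic2_on_power:
  "holomorphic2_on f U \<Longrightarrow> holomorphic2_on (\<lambda>p. f p ^ n) U"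
  by (induction n) (auto intro: holomorphic2_on_const holomorphic2_on_mult)

lemma holomorphic2_on_csqrt:
  assumes "holomorphic2_on f U" "\<And>p. p \<in> U \<Longrightarrow> f p \<notin> \<real>\<^sub>\<le>\<^sub>0"
  shows "holomorphic2_on (\<lambda>p. csqrt (f p)) U"
  unfolding holomorphic2_on_def
proof
  fix p assume p: "p \<in> U"
  then obtain a b where "(f has_derivative (\<lambda>(h, k). a * h + b * k)) (at p)"
    using assms unfolding holomorphic2_on_def by blast
  moreover have "(csqrt has_field_derivative inverse (2 * csqrt (f p))) (at (f p))"
    using assms(2)[OF p] by (rule has_field_derivative_csqrt)
  ultimately have "((\<lambda>p. csqrt (f p)) has_derivative
      (\<lambda>x. inverse (2 * csqrt (f p)) * (case x of (h, k) \<Rightarrow> a * h + b * k))) (at p)"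
    unfolding has_field_derivative_def by (rule has_derivative_compose)
  moreover have "(\<lambda>x. inverse (2 * csqrt (f p)) * (case x of (h, k) \<Rightarrow> a * h + b * k)) =
      (\<lambda>(h, k). (inverse (2 * csqrt (f p)) * a) * h + (inverse (2 * csqrt (f p)) * b) * k)"
    by (auto simp: algebra_simps)
  ultimately show "\<exists>a b. ((\<lambda>p. csqrt (f p)) has_derivative (\<lambda>(h, k). a * h + b * k)) (at p)"
    by metis
qed

lemmas holomorphic2_intros = holomorphic2_on_const holomorphic2_on_fst holomorphic2_on_snd
  holomorphic2_on_add holomorphic2_on_diff holomorphic2_on_mult holomorphic2_on_power

lemma holomorphic2_on_swap:
  assumes "holomorphic2_on f U"
  shows "holomorphic2_on (f \<circ> prod.swap) (prod.swap -` U)"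
  unfolding holomorphic2_on_def
proof
  fix p :: "complex \<times> complex" assume "p \<in> prod.swap -` U"
  then obtain a b where "(f has_derivative (\<lambda>(h, k). a * h + b * k)) (at (prod.swap p))"
    using assms unfolding holomorphic2_on_def by blast
  moreover have "(prod.swap has_derivative prod.swap) (at p)"
    unfolding prod.swap_def
    by (intro has_derivative_Pair has_derivative_fst has_derivative_snd has_derivative_ident)
  ultimately have "(f \<circ> prod.swap has_derivative (\<lambda>(h, k). a * h + b * k) \<circ> prod.swap) (at p)"
    by (rule diff_chain_at[rotated])
  moreover have "(\<lambda>(h, k). a * h + b * k) \<circ> prod.swap = (\<lambda>(h, k). b * h + a * k)"
    by (auto simp: algebra_simps)
  ultimately show "\<exists>a b. (f \<circ> prod.swap has_derivative (\<lambda>(h, k). a * h + b * k)) (at p)"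
    by metis
qed

lemma holomorphic2_on_subset:
  "holomorphic2_on f U \<Longrightarrow> U' \<subseteq> U \<Longrightarrow> holomorphic2_on f U'"
  unfolding holomorphic2_on_def by blast

lemma holomorphic2_on_imp_continuous_on:
  "holomorphic2_on f U \<Longrightarrow> continuous_on U f"
  unfolding holomorphic2_on_def
  by (metis continuous_at_imp_continuous_on has_derivative_continuous)

lemma continuous_on_if_components:
  assumes "holomorphic2_on (fst \<circ> \<phi>) U" "holomorphic2_on (snd \<circ> \<phi>) U"
  shows "continuous_on U \<phi>"
proof -
  have "continuous_on U (\<lambda>p. ((fst \<circ> \<phi>) p, (snd \<circ> \<phi>) p))"
    by (intro continuous_on_Pair holomorphic2_on_imp_continuous_on assms)
  then show ?thesis by simp
qed

text \<open>It suffices that the unit \<open>w\<close> does not vanish at the origin: shrink the neighbourhoods.\<close>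

lemma analytically_equivalentI:
  fixes \<phi> \<psi> :: "complex \<times> complex \<Rightarrow> complex \<times> complex"
  assumes open_U: "open U" and open_V: "open V" and 0: "(0, 0) \<in> U" "\<phi> (0, 0) = (0, 0)"
    and \<phi>: "\<And>p. p \<in> U \<Longrightarrow> \<phi> p \<in> V" "\<And>p. p \<in> U \<Longrightarrow> \<psi> (\<phi> p) = p"
    and \<psi>: "\<And>q. q \<in> V \<Longrightarrow> \<psi> q \<in> U" "\<And>q. q \<in> V \<Longrightarrow> \<phi> (\<psi> q) = q"
    and hol: "holomorphic2_on (fst \<circ> \<phi>) U" "holomorphic2_on (snd \<circ> \<phi>) U"
      "holomorphic2_on (fst \<circ> \<psi>) V" "holomorphic2_on (snd \<circ> \<psi>) V" "holomorphic2_on w U"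
    and w: "w (0, 0) \<noteq> 0"
    and f: "\<And>p. p \<in> U \<Longrightarrow> f p = w p * g (\<phi> p)"
  shows "analytically_equivalent f g"
proof -
  define U' V' where "U' = U \<inter> w -` (- {0})" and "V' = V \<inter> (w \<circ> \<psi>) -` (- {0})"
  have cont: "continuous_on U \<phi>" "continuous_on V \<psi>" "continuous_on U w"
    using hol by (auto intro: continuous_on_if_components holomorphic2_on_imp_continuous_on)
  moreover have "\<psi> ` V \<subseteq> U" using \<psi>(1) by blast
  ultimately have "continuous_on V (w \<circ> \<psi>)"
    by (meson continuous_on_compose continuous_on_subset)
  then have "open U'" "open V'"
    unfolding U'_def V'_def using cont(3) open_U open_V
    by (auto intro!: continuous_open_preimage)
  moreover have "(0, 0) \<in> U'" using 0 w by (simp add: U'_def)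
  moreover have "homeomorphism U' V' \<phi> \<psi>"
  proof (rule homeomorphismI)
    show "continuous_on U' \<phi>" "continuous_on V' \<psi>"
      using cont by (auto simp: U'_def V'_def intro: continuous_on_subset)
  qed (use \<phi> \<psi> in \<open>auto simp: U'_def V'_def\<close>)
  moreover have "U' \<subseteq> U" "V' \<subseteq> V" by (auto simp: U'_def V'_def)
  moreover have "\<forall>p\<in>U'. w p \<noteq> 0" by (auto simp: U'_def)
  ultimately show ?thesis
    unfolding analytically_equivalent_def
    using 0(2) hol f by (intro exI[of _ U'] exI[of _ V'] exI[of _ \<phi>] exI[of _ \<psi>] exI[of _ w])
      (auto intro: holomorphic2_on_subset)
qed

text \<open>At (e, 0, 1) the two chart coordinates exchange the roles that they have at (0, e, 1);
  this carries the D6 equivalence over.\<close>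

lemma analytically_equivalent_swap:
  assumes "analytically_equivalent f g"
  shows "analytically_equivalent (f \<circ> prod.swap) g"
proof -
  obtain U V \<phi> \<psi> w where *: "open U" "open V" "(0, 0) \<in> U" "\<phi> (0, 0) = (0, 0)"
    "homeomorphism U V \<phi> \<psi>"
    "holomorphic2_on (fst \<circ> \<phi>) U" "holomorphic2_on (snd \<circ> \<phi>) U"
    "holomorphic2_on (fst \<circ> \<psi>) V" "holomorphic2_on (snd \<circ> \<psi>) V"
    "holomorphic2_on w U" "\<forall>p\<in>U. w p \<noteq> 0" "\<forall>p\<in>U. f p = w p * g (\<phi> p)"
    using assms unfolding analytically_equivalent_def by blast
  show ?thesis
  proof (rule analytically_equivalentI[of "prod.swap -` U" V "\<phi> \<circ> prod.swap" "prod.swap \<circ> \<psi>"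
        "w \<circ> prod.swap"])
    show "open (prod.swap -` U)"
      using *(1) by (auto intro!: open_vimage continuous_on_swap)
    show "holomorphic2_on (fst \<circ> (\<phi> \<circ> prod.swap)) (prod.swap -` U)"
      "holomorphic2_on (snd \<circ> (\<phi> \<circ> prod.swap)) (prod.swap -` U)"
      "holomorphic2_on (w \<circ> prod.swap) (prod.swap -` U)"
      using *(6,7,10) by (simp_all only: o_assoc holomorphic2_on_swap)
    show "holomorphic2_on (fst \<circ> (prod.swap \<circ> \<psi>)) V" "holomorphic2_on (snd \<circ> (prod.swap \<circ> \<psi>)) V"
      using *(8,9) by (simp_all add: o_def)
  qed (use * in \<open>auto simp: homeomorphism_def\<close>)
qed

text \<open>With s = (u + v)/2 and t = -i (u - v)/2 one has u v = s^2 + t^2; the inverse is u = s +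
  i t, v = s - i t.\<close>

lemma ADE_A1:
  assumes "\<And>p. f p = w p * (fst p * snd p)" "holomorphic2_on w UNIV" "w (0, 0) \<noteq> 0"
  shows "\<exists>g\<in>ADE_normal_forms. analytically_equivalent f g"
proof
  show "(\<lambda>(s, t). s ^ 2 + t ^ (1 + 1)) \<in> ADE_normal_forms"
    unfolding ADE_normal_forms_def by blast
  show "analytically_equivalent f (\<lambda>(s, t). s ^ 2 + t ^ (1 + 1))"
  proof (rule analytically_equivalentI[of UNIV UNIV
        "\<lambda>p. (fst p * (1 / 2) + snd p * (1 / 2), fst p * (- \<i> / 2) - snd p * (- \<i> / 2))"
        "\<lambda>p. (fst p + \<i> * snd p, fst p - \<i> * snd p)" w])
    show "f p = w p * (case (fst p * (1 / 2) + snd p * (1 / 2), fst p * (- \<i> / 2) - snd p * (- \<i> / 2)) of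
        (s, t) \<Rightarrow> s ^ 2 + t ^ (1 + 1))" for p
      by (simp add: assms(1) field_simps power2_eq_square)
    show "holomorphic2_on (fst \<circ> (\<lambda>p. (fst p * (1 / 2) + snd p * (1 / 2), fst p * (- \<i> / 2) - snd p * (- \<i> / 2)))) UNIV"
      "holomorphic2_on (snd \<circ> (\<lambda>p. (fst p * (1 / 2) + snd p * (1 / 2), fst p * (- \<i> / 2) - snd p * (- \<i> / 2)))) UNIV"
      unfolding o_def fst_conv snd_conv by (intro holomorphic2_intros)+
  qed (use assms(2,3) in \<open>auto simp: o_def field_simps intro!: holomorphic2_intros\<close>)
qed

text \<open>The cubic u (u^2 + v^2) is the normal form itself for s = v, t = u.\<close>

lemma ADE_D4:
  assumes "\<And>p. f p = w p * (fst p * (fst p ^ 2 + snd p ^ 2))"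
    "holomorphic2_on w UNIV" "w (0, 0) \<noteq> 0"
  shows "\<exists>g\<in>ADE_normal_forms. analytically_equivalent f g"
proof
  show "(\<lambda>(s, t). s ^ 2 * t + t ^ (4 - 1)) \<in> ADE_normal_forms"
    unfolding ADE_normal_forms_def by blast
  show "analytically_equivalent f (\<lambda>(s, t). s ^ 2 * t + t ^ (4 - 1))"
  proof (rule analytically_equivalentI[of UNIV UNIV prod.swap prod.swap w])
    show "f p = w p * (case prod.swap p of (s, t) \<Rightarrow> s ^ 2 * t + t ^ (4 - 1))" for p
      by (cases p) (simp add: assms(1) algebra_simps power2_eq_square power3_eq_cube)
  qed (use assms(2,3) in \<open>auto simp: o_def intro!: holomorphic2_intros\<close>)
qed

lemma Re_csqrt_pos:
  assumes "z \<notin> \<real>\<^sub>\<le>\<^sub>0"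
  shows "Re (csqrt z) > 0"
proof (rule ccontr)
  assume "\<not> Re (csqrt z) > 0"
  then have "Re (csqrt z) = 0" using Re_csqrt[of z] by linarith
  then have "Re ((csqrt z)\<^sup>2) \<le> 0" "Im ((csqrt z)\<^sup>2) = 0"
    unfolding Re_power2 Im_power2 by simp_all
  then show False using assms unfolding power2_csqrt by (simp add: complex_nonpos_Reals_iff)
qed

text \<open>
  With \<open>W = v (v + 2\<epsilon>)\<close> the curve is \<open>u W (W + u\<^sup>2) = u ((W + u\<^sup>2/2)\<^sup>2 - u\<^sup>4/4)\<close>, and
  \<open>((1 + \<i>)/2)\<^sup>4 = -1/4\<close>. Since \<open>1 - W = (1 - \<epsilon> v)\<^sup>2\<close>, the coordinate \<open>v\<close> is recovered from
  \<open>W\<close> by a square root.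
\<close>

lemma ADE_D6:
  fixes \<epsilon> :: complex
  assumes \<epsilon>: "\<epsilon>\<^sup>2 = -1"
    and f: "\<And>p. f p = w p * (fst p * (snd p * (snd p + 2 * \<epsilon>)) *
      (fst p ^ 2 + snd p * (snd p + 2 * \<epsilon>)))"
    and w: "holomorphic2_on w UNIV" "w (0, 0) \<noteq> 0"
  shows "\<exists>g\<in>ADE_normal_forms. analytically_equivalent f g"
proof
  \<comment> \<open>With t = (1 + i)/2 u the term -u^4/4 becomes t^4. The remaining factor is u = (1
    - i) t, and 1 - i goes into the unit.\<close>
  define \<phi> where "\<phi> p = (snd p * (snd p + 2 * \<epsilon>) + fst p ^ 2 * (1 / 2), (1 + \<i>) / 2 * fst p)" for p
  \<comment> \<open>This is 1 - W in the new coordinates: u^2/2 = -i t^2, so W = s + i t^2.\<close>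
  define r where "r q = 1 - (fst q + \<i> * snd q ^ 2)" for q :: "complex \<times> complex"
  define \<psi> where "\<psi> q = ((1 - \<i>) * snd q, \<epsilon> * (csqrt (r q) - 1))" for q
  \<comment> \<open>Squaring maps the right half plane bijectively onto the plane without the
    nonpositive reals, with the principal root as inverse; U and V are the corresponding
    domains.\<close>
  define U :: "(complex \<times> complex) set" where "U = {p. Re (1 - \<epsilon> * snd p) > 0}"
  define V where "V = r -` (- \<real>\<^sub>\<le>\<^sub>0)"
  have eps: "\<epsilon> * \<epsilon> = -1" using \<epsilon> by (simp add: power2_eq_square)
  have eps': "\<epsilon> * (\<epsilon> * x) = - x" for x
    by (simp add: eps mult.assoc[symmetric])
  have ii: "\<i> * (\<i> * x) = - x" for x
    by (simp add: mult.assoc[symmetric])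
  have r\<phi>: "r (\<phi> p) = (1 - \<epsilon> * snd p)\<^sup>2" for p
  proof -
    have c2: "((1 + \<i>) / 2)\<^sup>2 = \<i> / 2" by (simp add: power2_eq_square field_simps)
    have h: "\<i> * ((1 + \<i>) / 2 * u)\<^sup>2 = - (u\<^sup>2 / 2)" for u
      unfolding power_mult_distrib c2 by simp
    have "r (\<phi> p) = 1 - 2 * (\<epsilon> * snd p) - snd p * snd p"
      unfolding r_def \<phi>_def fst_conv snd_conv h by (simp add: algebra_simps)
    also have "\<dots> = (1 - \<epsilon> * snd p)\<^sup>2"
      by (simp add: power2_eq_square algebra_simps eps')
    finally show ?thesis .
  qed
  have f_eq: "w p * (u * (v * (v + 2 * \<epsilon>)) * (u ^ 2 + v * (v + 2 * \<epsilon>))) = (w p * (1 - \<i>)) *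
    ((v * (v + 2 * \<epsilon>) + u ^ 2 * (1 / 2)) ^ 2 * ((1 + \<i>) / 2 * u) + ((1 + \<i>) / 2 * u) ^ (6 - 1))"
    for u v p
  proof -
    define W where "W = v * (v + 2 * \<epsilon>)"
    have c: "(1 - \<i>) * ((1 + \<i>) / 2) = 1" "((1 + \<i>) / 2) ^ 4 = - 1 / 4"
      by (simp_all add: eval_nat_numeral field_simps)
    have "(1 - \<i>) * ((W + u ^ 2 * (1 / 2)) ^ 2 * ((1 + \<i>) / 2 * u) + ((1 + \<i>) / 2 * u) ^ 5) =
      (1 - \<i>) * ((1 + \<i>) / 2) * u * ((W + u ^ 2 * (1 / 2)) ^ 2 + ((1 + \<i>) / 2) ^ 4 * u ^ 4)"
    proof -
      have "e * (A ^ 2 * (c * u) + (c * u) ^ 5) = e * c * u * (A ^ 2 + c ^ 4 * u ^ 4)"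
        for A c e :: complex
        by (simp add: eval_nat_numeral algebra_simps)
      then show ?thesis .
    qed
    also have "\<dots> = u * (W * (u ^ 2 + W))"
      unfolding c by (simp add: eval_nat_numeral algebra_simps)
    finally show ?thesis by (simp add: W_def mult.assoc)
  qed
  have "(6 :: nat) \<ge> 4" by simp
  then show "(\<lambda>(s, t). s ^ 2 * t + t ^ (6 - 1)) \<in> ADE_normal_forms"
    unfolding ADE_normal_forms_def by blast
  show "analytically_equivalent f (\<lambda>(s, t). s ^ 2 * t + t ^ (6 - 1))"
  proof (rule analytically_equivalentI[of U V \<phi> \<psi> "\<lambda>p. w p * (1 - \<i>)"])
    show "open U"
      unfolding U_def by (intro open_Collect_less continuous_intros)
    have "continuous_on UNIV r" unfolding r_def by (intro continuous_intros)
    then show "open V" unfolding V_def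
      by (intro open_vimage open_Compl closed_nonpos_Reals_complex)
    show "(0, 0) \<in> U" "\<phi> (0, 0) = (0, 0)" by (simp_all add: U_def \<phi>_def)
    show "w (0, 0) * (1 - \<i>) \<noteq> 0"
    proof -
      have "1 - \<i> \<noteq> 0" by (simp add: complex_eq_iff)
      then show ?thesis using w(2) by simp
    qed
    show "f p = w p * (1 - \<i>) * (case \<phi> p of (s, t) \<Rightarrow> s ^ 2 * t + t ^ (6 - 1))" for p
      unfolding f f_eq \<phi>_def by simp
    show "\<phi> p \<in> V" if "p \<in> U" for p
    proof -
      have pos: "Re (1 - \<epsilon> * snd p) > 0" using that by (simp add: U_def)
      have "z\<^sup>2 \<notin> \<real>\<^sub>\<le>\<^sub>0" if "Re z > 0" for z
        using that by (auto simp: complex_nonpos_Reals_iff Re_power2 Im_power2)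
      then show ?thesis using pos unfolding V_def by (simp add: r\<phi>)
    qed
    show "\<psi> (\<phi> p) = p" if "p \<in> U" for p
    proof -
      have "csqrt (r (\<phi> p)) = 1 - \<epsilon> * snd p"
        unfolding r\<phi> by (rule csqrt_square) (use that in \<open>simp add: U_def\<close>)
      then have "snd (\<psi> (\<phi> p)) = \<epsilon> * (1 - \<epsilon> * snd p - 1)"
        by (simp only: \<psi>_def snd_conv)
      then have "snd (\<psi> (\<phi> p)) = snd p" by (simp add: eps')
      moreover have "fst (\<psi> (\<phi> p)) = fst p"
        by (simp add: \<psi>_def \<phi>_def field_simps)
      ultimately show ?thesis by (simp add: prod_eq_iff)
    qed
    show "\<psi> q \<in> U" if "q \<in> V" for q
    proof -
      have "1 - \<epsilon> * snd (\<psi> q) = csqrt (r q)"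
      proof -
        have "1 - \<epsilon> * (\<epsilon> * (c - 1)) = c" for c unfolding eps' by simp
        then show ?thesis by (simp only: \<psi>_def snd_conv)
      qed
      moreover have "Re (csqrt (r q)) > 0" using Re_csqrt_pos[of "r q"] that by (simp only: V_def) auto
      ultimately show ?thesis by (simp only: U_def mem_Collect_eq)
    qed
    show "\<phi> (\<psi> q) = q" for q
    proof -
      have "e * (c - 1) * (e * (c - 1) + 2 * e) = (e * e) * (c\<^sup>2 - 1)" for e c :: complex
        by (simp add: algebra_simps power2_eq_square)
      then have "snd (\<psi> q) * (snd (\<psi> q) + 2 * \<epsilon>) = (\<epsilon> * \<epsilon>) * ((csqrt (r q))\<^sup>2 - 1)"
        by (simp only: \<psi>_def snd_conv)
      also have "\<dots> = - 1 * ((csqrt (r q))\<^sup>2 - 1)" by (simp only: eps)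
      also have "\<dots> = 1 - r q" by simp
      finally have "fst (\<phi> (\<psi> q)) = 1 - r q + ((1 - \<i>) * snd q)\<^sup>2 * (1 / 2)"
        by (simp add: \<phi>_def \<psi>_def)
      also have "\<dots> = fst q"
        by (simp add: r_def power2_eq_square field_simps ii)
      finally have "fst (\<phi> (\<psi> q)) = fst q" .
      moreover have "snd (\<phi> (\<psi> q)) = snd q"
        by (simp add: \<psi>_def \<phi>_def field_simps)
      ultimately show ?thesis by (simp add: prod_eq_iff)
    qed
    show "holomorphic2_on (fst \<circ> \<phi>) U" "holomorphic2_on (snd \<circ> \<phi>) U"
      "holomorphic2_on (fst \<circ> \<psi>) V"
      unfolding o_def \<phi>_def \<psi>_def fst_conv snd_conv by (intro holomorphic2_intros)+
    show "holomorphic2_on (snd \<circ> \<psi>) V"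
      unfolding o_def \<psi>_def snd_conv r_def
      by (intro holomorphic2_intros holomorphic2_on_csqrt) (auto simp: V_def r_def)
    show "holomorphic2_on (\<lambda>p. w p * (1 - \<i>)) U"
      by (intro holomorphic2_intros holomorphic2_on_subset[OF w(1)]) simp
  qed
qed

subsection \<open>The case \<open>d = 2\<close>\<close>

lemma power2_eq_minus_one_iff: "z\<^sup>2 = -1 \<longleftrightarrow> z = \<i> \<or> z = -\<i>" for z :: complex
proof -
  have "z\<^sup>2 = -1 \<longleftrightarrow> z\<^sup>2 = \<i>\<^sup>2" by simp
  then show ?thesis by (simp only: power2_eq_iff)
qed

text \<open>A coordinate line passes through the point where a line of the arrangement touches the
  conic: x = 0 and y = e z at (0, e, 1), and symmetrically at (e, 0, 1), for e^2 = -1.\<close>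

definition D6_points :: "(complex \<times> complex \<times> complex) set" where
  "D6_points = {(0, \<i>, 1), (0, -\<i>, 1), (\<i>, 0, 1), (-\<i>, 0, 1)}"

text \<open>Three lines are concurrent here: x = 0 with the pair x^2 + z^2 = 0, or y = 0 with the
  pair y^2 + z^2 = 0.\<close>

definition D4_points :: "(complex \<times> complex \<times> complex) set" where
  "D4_points = {(0, 1, 0), (1, 0, 0)}"

definition A1_points :: "(complex \<times> complex \<times> complex) set" where
  "A1_points = {(0, 0, 1), (\<i>, \<i>, 1), (\<i>, -\<i>, 1), (-\<i>, \<i>, 1), (-\<i>, -\<i>, 1)}"

lemma eval_F''_2:
  fixes a b c :: complex
  defines "R \<equiv> a\<^sup>2 + b\<^sup>2 + c\<^sup>2"
  shows "eval (F'' 2) (a, b, c) = a * b * (b\<^sup>2 + c\<^sup>2) * (a\<^sup>2 + c\<^sup>2) * R"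
    "eval (dx (F'' 2)) (a, b, c) =
      b * (b\<^sup>2 + c\<^sup>2) * ((a\<^sup>2 + c\<^sup>2) * R + 2 * a\<^sup>2 * R + 2 * a\<^sup>2 * (a\<^sup>2 + c\<^sup>2))"
    "eval (dy (F'' 2)) (a, b, c) =
      a * (a\<^sup>2 + c\<^sup>2) * ((b\<^sup>2 + c\<^sup>2) * R + 2 * b\<^sup>2 * R + 2 * b\<^sup>2 * (b\<^sup>2 + c\<^sup>2))"
    "eval (dz (F'' 2)) (a, b, c) =
      2 * a * b * c * ((a\<^sup>2 + c\<^sup>2) * R + (b\<^sup>2 + c\<^sup>2) * R + (b\<^sup>2 + c\<^sup>2) * (a\<^sup>2 + c\<^sup>2))"
  by (simp_all add: F''_def partial_rules eval_rules, simp_all add: R_def algebra_simps power2_eq_square)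

lemma singular_points_F''_2: "singular_points (F'' 2) = D6_points \<union> D4_points \<union> A1_points"
proof (intro set_eqI iffI)
  fix p assume "p \<in> singular_points (F'' 2)"
  then obtain a b c where p: "p = (a, b, c)" and P2: "(a, b, c) \<in> P2"
    and sing: "eval (F'' 2) (a, b, c) = 0" "eval (dx (F'' 2)) (a, b, c) = 0"
      "eval (dy (F'' 2)) (a, b, c) = 0"
    by (cases p) (auto simp: singular_points_def curve_def)
  consider "c = 1" | "c = 0" "b = 1" | "c = 0" "b = 0" "a = 1"
    using P2 by (auto simp: P2_def)
  then show "p \<in> D6_points \<union> D4_points \<union> A1_points"
  proof cases
    case 1
    \<comment> \<open>The equation makes one of its five factors vanish; in each case a partial
      derivative then forces a second one to vanish.\<close>
    define A B where "A = a\<^sup>2 + 1" and "B = b\<^sup>2 + 1"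
    have sq: "a\<^sup>2 = A - 1" "b\<^sup>2 = B - 1" by (simp_all add: A_def B_def)
    have G: "a * b * B * A * (a\<^sup>2 + B) = 0"
      and Gx: "b * B * (A * (a\<^sup>2 + B) + 2 * a\<^sup>2 * (a\<^sup>2 + B) + 2 * a\<^sup>2 * A) = 0"
      and Gy: "a * A * (B * (a\<^sup>2 + B) + 2 * b\<^sup>2 * (a\<^sup>2 + B) + 2 * b\<^sup>2 * B) = 0"
      using sing unfolding eval_F''_2 1 A_def B_def by (simp_all add: add.assoc)
    consider "a = 0" | "b = 0" | "a \<noteq> 0" "b \<noteq> 0" "B = 0" | "a \<noteq> 0" "b \<noteq> 0" "A = 0"
      | "a \<noteq> 0" "b \<noteq> 0" "A \<noteq> 0" "B \<noteq> 0" "a\<^sup>2 + B = 0"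
      using G by auto
    then have "(a = 0 \<or> a\<^sup>2 = -1) \<and> (b = 0 \<or> b\<^sup>2 = -1)"
    proof cases
      case 1
      then have "b * B * B = 0" using Gx by (simp add: A_def)
      then show ?thesis using 1 by (auto simp: B_def eq_neg_iff_add_eq_0)
    next
      case 2
      then have "a * A * (a\<^sup>2 + 1) = 0" using Gy by (simp add: B_def)
      then show ?thesis using 2 by (auto simp: A_def eq_neg_iff_add_eq_0)
    next
      case 3
      then have "A = 0" using Gy by auto
      then show ?thesis using 3 by (simp add: A_def B_def eq_neg_iff_add_eq_0)
    next
      case 4
      then have "a\<^sup>2 + B \<noteq> 0" using sq by (auto simp: eq_diff_eq)
      then have "B = 0" using 4 Gx by auto
      then show ?thesis using 4 by (simp add: A_def B_def eq_neg_iff_add_eq_0)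
    next
      case 5
      then show ?thesis using Gx by auto
    qed
    then show ?thesis
      unfolding p 1 power2_eq_minus_one_iff
      by (auto simp: D6_points_def D4_points_def A1_points_def)
  next
    case 2
    have "a = 0 \<or> a\<^sup>2 = -1"
      using sing(1) unfolding eval_F''_2 2 by (auto simp: eq_neg_iff_add_eq_0)
    \<comment> \<open>Of all components only the conic passes through (e, 1, 0) with e^2 = -1, so
      the curve is smooth there.\<close>
    moreover have "a\<^sup>2 \<noteq> -1"
    proof
      assume "a\<^sup>2 = -1"
      then show False using sing(2) unfolding eval_F''_2 2 by simp
    qed
    ultimately show ?thesis using 2 by (auto simp: p D4_points_def)
  next
    case 3
    then show ?thesis by (auto simp: p D4_points_def)
  qed
next
  fix p assume "p \<in> D6_points \<union> D4_points \<union> A1_points"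
  then show "p \<in> singular_points (F'' 2)"
    by (auto simp: D6_points_def D4_points_def A1_points_def singular_points_def curve_def P2_def
        eval_F''_2)
qed

lemma germ_F''_2:
  "germ (F'' 2) p = (let X = germ varx p; Y = germ vary p; Z = germ varz p in
     X * Y * (Y\<^sup>2 + Z\<^sup>2) * (X\<^sup>2 + Z\<^sup>2) * (X\<^sup>2 + Y\<^sup>2 + Z\<^sup>2))"
  by (simp add: F''_def germ.rules Let_def)

text \<open>Near a root e of the quadratic, one factor is the local coordinate and the other, x + 2
  e, has the nonzero value 2 e.\<close>

lemma translated_square_plus_one:
  fixes e x :: "'a::comm_ring_1"
  assumes "e\<^sup>2 = -1"
  shows "(e + x)\<^sup>2 + 1 = x * (x + 2 * e)"
  using assms by (simp add: power2_eq_square algebra_simps)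

lemma tjurina_D6:
  assumes "p \<in> D6_points"
  shows "tjurina (F'' 2) p = 6"
proof -
  consider e where "e\<^sup>2 = -1" "p = (0, e, 1)" | e where "e\<^sup>2 = -1" "p = (e, 0, 1)"
    using assms power2_eq_minus_one_iff by (auto simp: D6_points_def)
  then show ?thesis
  proof cases
    case (1 e)
    then have e: "2 * e \<noteq> 0" "(lconst e)\<^sup>2 = -1"
      by (auto simp flip: lconst.power simp: lconst.minus lconst.one)
    have "germ (F'' 2) p = ((lconst e + lv) * (lu\<^sup>2 + 1) * (lv + lconst (2 * e))) * (lu * lv * (lu\<^sup>2 + lv * (lv + lconst (2 * e))))"
      by (simp add: 1(2) germ_F''_2 germ_vars Let_def lconst.rules add.assoc
          translated_square_plus_one[OF e(2)] mult_ac)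
    moreover have "fps_nth (fps_nth ((lconst e + lv) * (lu\<^sup>2 + 1) * (lv + lconst (2 * e))) 0) 0 \<noteq> 0"
      using e by (auto simp: power2_eq_square lconst_def lu_def lv_def)
    ultimately show ?thesis
      using uv.colength_D6[OF e(1)] by (simp add: tjurina_eq)
  next
    case (2 e)
    then have e: "2 * e \<noteq> 0" "(lconst e)\<^sup>2 = -1"
      by (auto simp flip: lconst.power simp: lconst.minus lconst.one)
    have "germ (F'' 2) p = ((lconst e + lu) * (lv\<^sup>2 + 1) * (lu + lconst (2 * e))) * (lv * lu * (lv\<^sup>2 + lu * (lu + lconst (2 * e))))"
      by (simp add: 2(2) germ_F''_2 germ_vars Let_def lconst.rules add.assoc add.left_commute[of _ "lv\<^sup>2"]
          translated_square_plus_one[OF e(2)] mult_ac)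
    moreover have "fps_nth (fps_nth ((lconst e + lu) * (lv\<^sup>2 + 1) * (lu + lconst (2 * e))) 0) 0 \<noteq> 0"
      using e by (auto simp: power2_eq_square lconst_def lu_def lv_def)
    ultimately show ?thesis
      using vu.colength_D6[OF e(1)] by (simp add: tjurina_eq insert_commute)
  qed
qed

lemma ideal_gen_D4:
  "ideal_gen {lu * (lu\<^sup>2 + lv\<^sup>2), du (lu * (lu\<^sup>2 + lv\<^sup>2)), dv (lu * (lu\<^sup>2 + lv\<^sup>2))} =
   ideal_gen {lu * (lu ^ 2 + lv ^ 2), 3 * lu ^ 2 + lv ^ 2, 2 * lu * lv}"
proof -
  have "du (lu * (lu\<^sup>2 + lv\<^sup>2)) = 3 * lu ^ 2 + lv ^ 2" "dv (lu * (lu\<^sup>2 + lv\<^sup>2)) = 2 * lu * lv"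
    by (simp_all add: du.rules dv.rules algebra_simps power2_eq_square)
  then show ?thesis by simp
qed

lemma tjurina_D4:
  assumes "p \<in> D4_points"
  shows "tjurina (F'' 2) p = 4"
proof -
  have "p = (0, 1, 0) \<or> p = (1, 0, 0)" using assms by (auto simp: D4_points_def)
  then have "germ (F'' 2) p = ((1 + lv\<^sup>2) * (1 + lu\<^sup>2 + lv\<^sup>2)) * (lu * (lu\<^sup>2 + lv\<^sup>2))"
    by (auto simp: germ_F''_2 germ_vars Let_def lconst.rules ac_simps)
  moreover have "fps_nth (fps_nth ((1 + lv\<^sup>2) * (1 + lu\<^sup>2 + lv\<^sup>2)) 0) 0 \<noteq> 0"
    by (simp add: power2_eq_square lu_def lv_def)
  ultimately show ?thesis
    using uv.colength_D4 by (simp add: tjurina_eq ideal_gen_D4)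
qed

lemma tjurina_A1:
  assumes "p \<in> A1_points"
  shows "tjurina (F'' 2) p = 1"
proof -
  have col: "colength (ideal_gen {lu * lv, du (lu * lv), dv (lu * lv)}) = 1"
    using uv.colength_maximal_ideal by (simp add: du.mult dv.mult)
  consider "p = (0, 0, 1)" | e e' where "e\<^sup>2 = -1" "e'\<^sup>2 = -1" "p = (e, e', 1)"
    using assms power2_eq_minus_one_iff by (auto simp: A1_points_def)
  then show ?thesis
  proof cases
    case 1
    have "germ (F'' 2) p = ((lv\<^sup>2 + 1) * (lu\<^sup>2 + 1) * (lu\<^sup>2 + lv\<^sup>2 + 1)) * (lu * lv)"
      by (simp add: 1 germ_F''_2 germ_vars Let_def lconst.rules mult_ac)
    moreover have "fps_nth (fps_nth ((lv\<^sup>2 + 1) * (lu\<^sup>2 + 1) * (lu\<^sup>2 + lv\<^sup>2 + 1)) 0) 0 \<noteq> 0"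
      by (simp add: power2_eq_square lu_def lv_def)
    ultimately show ?thesis by (simp add: tjurina_eq col)
  next
    case (2 e e')
    then have e: "e \<noteq> 0" "e' \<noteq> 0" "(lconst e)\<^sup>2 = -1" "(lconst e')\<^sup>2 = -1"
      by (auto simp flip: lconst.power simp: lconst.minus lconst.one)
    let ?w = "(lconst e + lu) * (lconst e' + lv) * (lv + 2 * lconst e') * (lu + 2 * lconst e) *
      ((lconst e + lu)\<^sup>2 + (lconst e' + lv)\<^sup>2 + 1)"
    have "germ (F'' 2) p = ?w * (lu * lv)"
      by (simp add: 2(3) germ_F''_2 germ_vars Let_def lconst.rules
          translated_square_plus_one[OF e(3)] translated_square_plus_one[OF e(4)] mult_ac)
    \<comment> \<open>The last factor is -1, since the conic misses the four crossings of x^2 + z^2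
      = 0 with y^2 + z^2 = 0.\<close>
    moreover have "fps_nth (fps_nth ?w 0) 0 = e * e' * (2 * e') * (2 * e) * (e\<^sup>2 + e'\<^sup>2 + 1)"
      by (simp add: power2_eq_square lu_def lv_def lconst_def)
    then have "fps_nth (fps_nth ?w 0) 0 \<noteq> 0" using e 2 by simp
    ultimately show ?thesis by (metis tjurina_eq col)
  qed
qed

lemma total_tjurina_F''_2: "total_tjurina (F'' 2) = 37"
proof -
  have ne: "\<i> \<noteq> -\<i>" by (simp add: complex_eq_iff)
  have card: "card D6_points = 4" "card D4_points = 2" "card A1_points = 5"
    "finite D6_points" "finite D4_points" "finite A1_points"
    using ne ne[symmetric] by (simp_all add: D6_points_def D4_points_def A1_points_def)
  have disj: "D6_points \<inter> D4_points = {}" "(D6_points \<union> D4_points) \<inter> A1_points = {}"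
    by (auto simp: D6_points_def D4_points_def A1_points_def)
  have "total_tjurina (F'' 2) = (\<Sum>p\<in>D6_points. 6) + (\<Sum>p\<in>D4_points. 4) + (\<Sum>p\<in>A1_points. 1)"
    unfolding total_tjurina_def singular_points_F''_2
    by (simp only: sum.union_disjoint card disj finite_Un simp_thms tjurina_D6 tjurina_D4 tjurina_A1
        cong: sum.cong)
  also have "\<dots> = 37" by (simp add: card)
  finally show ?thesis .
qed

lemma ADE_singularity_F''_2:
  assumes "p \<in> singular_points (F'' 2)"
  shows "ADE_singularity (F'' 2) p"
proof -
  have eval_chart: "(\<lambda>q. eval (F'' 2) (chart (\<lambda>c. c) p q)) = f"
    if "\<And>u v. eval (F'' 2) (chart (\<lambda>c. c) p (u, v)) = f (u, v)" for f
    using that by auto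
  consider e where "e\<^sup>2 = -1" "p = (0, e, 1)" | e where "e\<^sup>2 = -1" "p = (e, 0, 1)"
    | "p \<in> D4_points" | "p = (0, 0, 1)" | e e' where "e\<^sup>2 = -1" "e'\<^sup>2 = -1" "p = (e, e', 1)"
    using assms power2_eq_minus_one_iff unfolding singular_points_F''_2
    by (auto simp: D6_points_def A1_points_def)
  then show ?thesis
  proof cases
    case (1 e)
    then have "e \<noteq> 0" by auto
    show ?thesis
      unfolding ADE_singularity_def
    proof (rule ADE_D6[OF 1(1), where w = "\<lambda>p. (e + snd p) * (fst p ^ 2 + 1)"])
      show "eval (F'' 2) (chart (\<lambda>c. c) p q) = (e + snd q) * (fst q ^ 2 + 1) *
        (fst q * (snd q * (snd q + 2 * e)) * (fst q ^ 2 + snd q * (snd q + 2 * e)))" for q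
        by (cases q) (simp add: 1(2) chart_def eval_F''_2 add.assoc translated_square_plus_one[OF 1(1)]
            mult_ac)
    qed (use \<open>e \<noteq> 0\<close> in \<open>auto intro!: holomorphic2_intros\<close>)
  next
    case (2 e)
    then have "e \<noteq> 0" by auto
    have "\<exists>g\<in>ADE_normal_forms. analytically_equivalent
        (\<lambda>q. (e + snd q) * (fst q ^ 2 + 1) *
          (fst q * (snd q * (snd q + 2 * e)) * (fst q ^ 2 + snd q * (snd q + 2 * e)))) g"
      by (rule ADE_D6[OF 2(1), where w = "\<lambda>p. (e + snd p) * (fst p ^ 2 + 1)"])
        (use \<open>e \<noteq> 0\<close> in \<open>auto intro!: holomorphic2_intros\<close>)
    then obtain g where g: "g \<in> ADE_normal_forms" "analytically_equivalent
        ((\<lambda>q. (e + snd q) * (fst q ^ 2 + 1) *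
          (fst q * (snd q * (snd q + 2 * e)) * (fst q ^ 2 + snd q * (snd q + 2 * e)))) \<circ> prod.swap) g"
      using analytically_equivalent_swap by blast
    moreover have "(\<lambda>q. eval (F'' 2) (chart (\<lambda>c. c) p q)) =
        (\<lambda>q. (e + snd q) * (fst q ^ 2 + 1) *
          (fst q * (snd q * (snd q + 2 * e)) * (fst q ^ 2 + snd q * (snd q + 2 * e)))) \<circ> prod.swap"
      by (rule eval_chart) (simp add: 2(2) chart_def eval_F''_2 add.assoc add.left_commute[of "(e + _)\<^sup>2"]
          translated_square_plus_one[OF 2(1)] mult_ac)
    ultimately show ?thesis by (auto simp: ADE_singularity_def)
  next
    case 3
    show ?thesis
      unfolding ADE_singularity_def
    proof (rule ADE_D4[where w = "\<lambda>p. (1 + snd p ^ 2) * (1 + fst p ^ 2 + snd p ^ 2)"])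
      show "eval (F'' 2) (chart (\<lambda>c. c) p q) = (1 + snd q ^ 2) * (1 + fst q ^ 2 + snd q ^ 2) *
        (fst q * (fst q ^ 2 + snd q ^ 2))" for q
        using 3 by (cases q) (auto simp: D4_points_def chart_def eval_F''_2 ac_simps)
    qed (auto intro!: holomorphic2_intros)
  next
    case 4
    show ?thesis
      unfolding ADE_singularity_def
    proof (rule ADE_A1[where w =
          "\<lambda>p. (snd p ^ 2 + 1) * (fst p ^ 2 + 1) * (fst p ^ 2 + snd p ^ 2 + 1)"])
      show "eval (F'' 2) (chart (\<lambda>c. c) p q) =
        (snd q ^ 2 + 1) * (fst q ^ 2 + 1) * (fst q ^ 2 + snd q ^ 2 + 1) * (fst q * snd q)" for q
        by (cases q) (simp add: 4 chart_def eval_F''_2 mult_ac)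
    qed (auto intro!: holomorphic2_intros)
  next
    case (5 e e')
    then have "e \<noteq> 0" "e' \<noteq> 0" by auto
    show ?thesis
      unfolding ADE_singularity_def
    proof (rule ADE_A1[where w = "\<lambda>p. (e + fst p) * (e' + snd p) * (snd p + 2 * e') * (fst p + 2 * e) *
          ((e + fst p) ^ 2 + (e' + snd p) ^ 2 + 1)"])
      show "eval (F'' 2) (chart (\<lambda>c. c) p q) =
        (e + fst q) * (e' + snd q) * (snd q + 2 * e') * (fst q + 2 * e) *
          ((e + fst q) ^ 2 + (e' + snd q) ^ 2 + 1) * (fst q * snd q)" for q
        by (cases q) (simp add: 5(3) chart_def eval_F''_2 translated_square_plus_one[OF 5(1)]
            translated_square_plus_one[OF 5(2)] mult_ac)
    qed (use 5 \<open>e \<noteq> 0\<close> \<open>e' \<noteq> 0\<close> in \<open>auto intro!: holomorphic2_intros\<close>)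
  qed
qed

lemma maximizing_curve_F''_2: "maximizing_curve 8 (F'' 2)"
proof -
  have "reduced_curve 8 (F'' 2)" using reduced_curve_F''[of 2] by simp
  moreover have "finite (singular_points (F'' 2))"
    unfolding singular_points_F''_2 by (simp add: D6_points_def D4_points_def A1_points_def)
  moreover have "\<exists>m. 8 = 2 * m \<and> total_tjurina (F'' 2) = enat (3 * m * (m - 1) + 1)"
    by (rule exI[of _ 4]) (simp add: total_tjurina_F''_2 numeral_eq_enat)
  ultimately show ?thesis
    using ADE_singularity_F''_2 by (simp add: maximizing_curve_def)
qed

subsection \<open>Inflection points of the Fermat curve\<close>

text \<open>Taylor expansion to second order with explicit remainder, in a general commutative ring
  so that it applies to germs. The exponent n + 2 avoids truncated subtraction.\<close>

lemma binomial_low_order: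
  fixes x y :: "'a::comm_ring_1"
  shows "\<exists>q. (x + y) ^ (n + 2) = x ^ (n + 2) + of_nat (n + 2) * x ^ (n + 1) * y
    + of_nat ((n + 2) choose 2) * x ^ n * y\<^sup>2 + y ^ 3 * q"
proof (induction n)
  case 0
  have c: "of_nat ((0 + 2) choose 2) = (1 :: 'a)"
    using binomial_n_n[of 2] by (metis add_0 of_nat_1)
  have "(x + y) ^ (0 + 2) = x ^ (0 + 2) + of_nat (0 + 2) * x ^ (0 + 1) * y
    + of_nat ((0 + 2) choose 2) * x ^ 0 * y\<^sup>2 + y ^ 3 * 0"
    unfolding c by (simp add: power2_eq_square algebra_simps)
  then show ?case by blast
next
  case (Suc n)
  then obtain q where q: "(x + y) ^ (n + 2) = x ^ (n + 2) + of_nat (n + 2) * x ^ (n + 1) * y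
    + of_nat ((n + 2) choose 2) * x ^ n * y\<^sup>2 + y ^ 3 * q" by blast
  have "(Suc n + 2) choose 2 = (n + 2) + ((n + 2) choose 2)"
    by (simp add: numeral_2_eq_2)
  then have c: "of_nat ((Suc n + 2) choose 2) = (of_nat (n + 2) + of_nat ((n + 2) choose 2) :: 'a)"
    by simp
  have step: "(x + y) * (x * x * p + m * (x * p) * y + k * p * y\<^sup>2 + y ^ 3 * q) =
      x * (x * x * p) + (m + 1) * (x * x * p) * y + (m + k) * (x * p) * y\<^sup>2 + y ^ 3 * (k * p + (x + y) * q)"
    for m k p :: 'a
    by (simp add: algebra_simps eval_nat_numeral)
  have "(x + y) ^ (Suc n + 2) = (x + y) * (x * x * x ^ n + of_nat (n + 2) * (x * x ^ n) * y
      + of_nat ((n + 2) choose 2) * x ^ n * y\<^sup>2 + y ^ 3 * q)"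
    using q by (simp add: mult.assoc)
  also have "\<dots> = x ^ (Suc n + 2) + of_nat (Suc n + 2) * x ^ (Suc n + 1) * y
    + of_nat ((Suc n + 2) choose 2) * x ^ Suc n * y\<^sup>2
    + y ^ 3 * (of_nat ((n + 2) choose 2) * x ^ n + (x + y) * q)"
    unfolding step c by (simp add: add.commute mult.assoc)
  finally show ?case by blast
qed

context local_coordinates
begin

text \<open>Both generators lie in (s^3, t), so the coefficients of 1, s and s^2 vanish on the
  ideal.\<close>

lemma colength_ge_3:
  assumes "s ^ 3 dvd f - t * h" "t dvd g"
  shows "enat 3 \<le> colength (ideal_gen {f, g})"
proof -
  obtain p q where "f - t * h = s ^ 3 * p" and g: "g = t * q" using assms by (auto elim!: dvdE)
  then have f: "f = s ^ 3 * p + t * h" by (metis diff_add_cancel)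
  show ?thesis
  proof (rule colength_ge[of _ "\<lambda>i f. k f i 0" _ "\<lambda>i. s ^ i"])
    fix i x assume "i < (3 :: nat)" "x \<in> ideal_gen {f, g}"
    then show "k x i 0 = 0"
      by (elim ideal_gen_functional_eq_0)
        (auto simp: f g k_simps distrib_right mult.assoc eval_nat_numeral)
  next
    fix i j assume "i < (3 :: nat)" "j < (3 :: nat)"
    then show "k (s ^ j) i 0 = (if i = j then 1 else 0)"
      by (auto simp: less_Suc_eq eval_nat_numeral k_simps)
  qed (simp_all add: k_simps)
qed

text \<open>
  On the line \<open>\<alpha> s + \<beta> t = 0\<close> the function \<open>f\<close> restricts to a power series of order exactly 2.
\<close>

lemma colength_le_2:
  assumes g: "g = lconst \<alpha> * s + lconst \<beta> * t"
    and f: "f = g + lconst c1 * s\<^sup>2 + lconst c2 * t\<^sup>2 + s ^ 3 * p + t ^ 3 * q"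
    and "\<beta> \<noteq> 0" "c1 * \<beta>\<^sup>2 + c2 * \<alpha>\<^sup>2 \<noteq> 0"
  shows "colength (ideal_gen {f, g}) \<le> 2"
proof -
  define I where "I = ideal_gen {f, g}"
  have I_add: "x \<in> I \<Longrightarrow> y \<in> I \<Longrightarrow> x + y \<in> I" and I_diff: "x \<in> I \<Longrightarrow> y \<in> I \<Longrightarrow> x - y \<in> I"
    and I_mult: "x \<in> I \<Longrightarrow> a * x \<in> I" "x \<in> I \<Longrightarrow> x * a \<in> I" for x y a
    unfolding I_def by (simp_all add: ideal_gen_intros)
  have gens: "f \<in> I" "g \<in> I" by (simp_all add: I_def ideal_gen_base)
  \<comment> \<open>The line g = 0 is t = \<rho> s.\<close>
  define \<rho> where "\<rho> = - \<alpha> / \<beta>"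
  define m where "m = lconst \<rho>"
  have "lconst \<beta> * m = - lconst \<alpha>"
    unfolding m_def lconst.mult[symmetric] lconst.minus[symmetric] using assms(3) by (simp add: \<rho>_def)
  moreover have "b * (t - m * s) = a * s + b * t" if "b * m = - a" for a b
    using that by (metis (no_types, lifting) add.commute diff_minus_eq_add minus_mult_left mult.assoc
        right_diff_distrib)
  ultimately have "lconst \<beta> * (t - m * s) = g" unfolding g by blast
  then have e: "t - m * s \<in> I"
    using gens(2) assms(3) unfolding I_def by (metis ideal_gen_lconst_cancel)
  \<comment> \<open>Replacing t by m s in f - g leaves s^2 w. The constant term of w is (c1
    \<beta>^2 + c2 \<alpha>^2)/\<beta>^2, so w is a unit and s^2 lies in the ideal.\<close>
  define w where "w = lconst c1 + lconst c2 * m\<^sup>2 + s * (p + m ^ 3 * q)"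
  have "f - g - (t - m * s) * (lconst c2 * (t + m * s) + (t\<^sup>2 + t * (m * s) + (m * s)\<^sup>2) * q) \<in> I"
    by (intro I_diff I_mult(2) gens e)
  moreover have "g + C1 * s\<^sup>2 + C2 * t\<^sup>2 + s ^ 3 * p + t ^ 3 * q - g -
      (t - m * s) * (C2 * (t + m * s) + (t\<^sup>2 + t * (m * s) + (m * s)\<^sup>2) * q) =
      s\<^sup>2 * (C1 + C2 * m\<^sup>2 + s * (p + m ^ 3 * q))" for C1 C2 g m
    by (simp add: algebra_simps eval_nat_numeral)
  ultimately have "s\<^sup>2 * w \<in> I" unfolding f w_def by simp
  have "w = lconst (c1 + c2 * \<rho>\<^sup>2) + s * (p + m ^ 3 * q)"
    unfolding w_def m_def by (simp only: lconst.add lconst.mult lconst.power)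
  then have "k w 0 0 = c1 + c2 * \<rho>\<^sup>2"
    by (simp add: k_simps)
  moreover have "\<rho> * \<beta> = - \<alpha>" using assms(3) by (simp add: \<rho>_def)
  then have "\<rho>\<^sup>2 * \<beta>\<^sup>2 = \<alpha>\<^sup>2" by (metis power_mult_distrib power2_minus)
  then have "(c1 + c2 * \<rho>\<^sup>2) * \<beta>\<^sup>2 = c1 * \<beta>\<^sup>2 + c2 * \<alpha>\<^sup>2"
    by (simp add: distrib_right mult.assoc)
  ultimately have "k w 0 0 \<noteq> 0" using assms(4) by (metis mult_zero_left)
  then obtain w' where w': "w * w' = 1" using unit by blast
  have s2: "s\<^sup>2 \<in> I"
    using I_mult(2)[OF \<open>s\<^sup>2 * w \<in> I\<close>, of w'] by (simp add: mult.assoc w')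
  have "x \<in> lsp.span ({1, s} \<union> I)" for x
  proof -
    obtain x1 x2 where x: "x = lconst (k x 0 0) + lconst (k x 1 0) * s + s\<^sup>2 * x1 + t * x2"
      using decompose_s_power[of x 2] by (auto simp: numeral_2_eq_2)
    obtain y1 y2 where y: "x2 = lconst (k x2 0 0) + s * y1 + t * y2" using decompose by blast
    have "a + b * s + s\<^sup>2 * x1 + t * (c + s * y1 + t * y2) =
        a * 1 + (b + c * m) * s + ((t - m * s) * (c + s * y1 + t * y2 + m * s * y2)
          + s\<^sup>2 * (x1 + m * y1 + m * m * y2))" for a b c
      by (simp add: algebra_simps power2_eq_square)
    then have "x = lconst (k x 0 0) * 1 + (lconst (k x 1 0) + lconst (k x2 0 0) * m) * s
      + ((t - m * s) * (lconst (k x2 0 0) + s * y1 + t * y2 + m * s * y2)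
          + s\<^sup>2 * (x1 + m * y1 + m * m * y2))"
      using x y by metis
    moreover have "lconst (k x 1 0) + lconst (k x2 0 0) * m = lconst (k x 1 0 + k x2 0 0 * \<rho>)"
      unfolding m_def by (simp only: lconst.add lconst.mult)
    ultimately have x_eq: "x = lconst (k x 0 0) * 1 + lconst (k x 1 0 + k x2 0 0 * \<rho>) * s
      + ((t - m * s) * (lconst (k x2 0 0) + s * y1 + t * y2 + m * s * y2)
          + s\<^sup>2 * (x1 + m * y1 + m * m * y2))" by simp
    have "(t - m * s) * (lconst (k x2 0 0) + s * y1 + t * y2 + m * s * y2)
        + s\<^sup>2 * (x1 + m * y1 + m * m * y2) \<in> I"
      by (intro I_add I_mult(2) e s2)
    then show ?thesis
      by (subst x_eq, intro lsp.span_add lsp.span_scale lsp.span_base) auto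
  qed
  then have "colength I \<le> enat (card {1, s})"
    by (intro colength_le) auto
  also have "\<dots> \<le> enat 2" by (simp add: card_insert_if)
  finally show ?thesis by (simp add: I_def numeral_eq_enat)
qed

end

section \<open>Tangents of the Fermat curve at the points with xyz = 0\<close>

lemma eval_Fermat:
  "eval (Fermat d) (a, b, c) = a ^ d + b ^ d + c ^ d"
  "eval (dx (Fermat d)) (a, b, c) = of_nat d * a ^ (d - 1)"
  "eval (dy (Fermat d)) (a, b, c) = of_nat d * b ^ (d - 1)"
  "eval (dz (Fermat d)) (a, b, c) = of_nat d * c ^ (d - 1)"
  by (simp_all add: Fermat_def partial_rules eval_rules)

lemma singular_points_Fermat:
  assumes "d \<ge> 2"
  shows "singular_points (Fermat d) = {}"
  using assms by (auto simp: singular_points_def curve_def P2_def eval_Fermat)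

text \<open>The set is given by coordinates, not by contact order, so that for d = 2 it still yields
  the points whose tangents form the arrangement.\<close>

definition Fermat_flexes :: "nat \<Rightarrow> (complex \<times> complex \<times> complex) set" where
  "Fermat_flexes d = {(a, b, c) \<in> curve (Fermat d). a * b * c = 0}"

lemma root_of_minus_one_nonzero: "d \<ge> 2 \<Longrightarrow> r ^ d = -1 \<Longrightarrow> r \<noteq> (0 :: complex)"
  by (auto simp: zero_power)

lemma Fermat_flexes_eq:
  assumes "d \<ge> 2"
  shows "Fermat_flexes d = (\<lambda>r. (0, r, 1)) ` {r. r ^ d = -1} \<union> (\<lambda>r. (r, 0, 1)) ` {r. r ^ d = -1}
    \<union> (\<lambda>r. (r, 1, 0)) ` {r. r ^ d = -1}"
    (is "_ = ?A \<union> ?B \<union> ?C")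
proof (intro equalityI subsetI)
  have 0: "0 ^ d = (0 :: complex)" using assms by simp
  {
    fix p assume "p \<in> Fermat_flexes d"
    then obtain a b c where p: "p = (a, b, c)" and P2: "(a, b, c) \<in> P2"
      and eq: "a ^ d + b ^ d + c ^ d = 0" and abc: "a * b * c = 0"
      by (cases p) (auto simp: Fermat_flexes_def curve_def eval_Fermat)
    consider "c = 1" "a = 0" | "c = 1" "b = 0" | "c = 0" "b = 1" | "c = 0" "b = 0" "a = 1"
      using P2 abc by (auto simp: P2_def)
    then show "p \<in> ?A \<union> ?B \<union> ?C"
    proof cases
      case 1
      then have "b ^ d = -1" using eq by (simp add: 0 eq_neg_iff_add_eq_0)
      then show ?thesis using p 1 by blast
    next
      case 2
      then have "a ^ d = -1" using eq by (simp add: 0 eq_neg_iff_add_eq_0)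
      then show ?thesis using p 2 by blast
    next
      case 3
      then have "a ^ d = -1" using eq by (simp add: 0 eq_neg_iff_add_eq_0)
      then show ?thesis using p 3 by blast
    next
      case 4
      then show ?thesis using eq by (simp add: 0)
    qed
  }
  fix p assume "p \<in> ?A \<union> ?B \<union> ?C"
  then obtain r where r: "r ^ d = -1" and p: "p = (0, r, 1) \<or> p = (r, 0, 1) \<or> p = (r, 1, 0)"
    by blast
  show "p \<in> Fermat_flexes d"
    using p assms by (elim disjE; simp add: Fermat_flexes_def curve_def eval_Fermat P2_def 0 r)
qed

lemma Fermat_flexes_cases:
  assumes "d \<ge> 2" "p \<in> Fermat_flexes d"
  obtains r where "r ^ d = -1" "p = (0, r, 1)" | r where "r ^ d = -1" "p = (r, 0, 1)"
    | r where "r ^ d = -1" "p = (r, 1, 0)"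
  using assms by (auto simp: Fermat_flexes_eq)

lemma card_Fermat_flexes:
  assumes "d \<ge> 2"
  shows "card (Fermat_flexes d) = 3 * d"
proof -
  have R: "card {r :: complex. r ^ d = -1} = d"
    using assms by (intro card_nth_roots) auto
  then have fin: "finite {r :: complex. r ^ d = -1}"
    using assms by (intro card_ge_0_finite) auto
  define A B C where "A = (\<lambda>r :: complex. (0 :: complex, r, 1 :: complex)) ` {r. r ^ d = -1}"
    and "B = (\<lambda>r :: complex. (r, 0 :: complex, 1 :: complex)) ` {r. r ^ d = -1}"
    and "C = (\<lambda>r :: complex. (r, 1 :: complex, 0 :: complex)) ` {r. r ^ d = -1}"
  have "card A = d" "card B = d" "card C = d"
    unfolding A_def B_def C_def by (subst card_image; simp add: inj_on_def R)+
  moreover have "finite A" "finite B" "finite C"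
    unfolding A_def B_def C_def using fin by simp_all
  moreover have "A \<inter> B = {}" "(A \<union> B) \<inter> C = {}"
  proof -
    have "fst p = 0" if "p \<in> A" for p using that by (auto simp: A_def)
    moreover have "fst p \<noteq> 0" if "p \<in> B" for p
      using that root_of_minus_one_nonzero[OF assms] by (auto simp: B_def)
    ultimately show "A \<inter> B = {}" by blast
    have "snd (snd p) \<noteq> 0" if "p \<in> A \<union> B" for p using that by (auto simp: A_def B_def)
    moreover have "snd (snd p) = 0" if "p \<in> C" for p using that by (auto simp: C_def)
    ultimately show "(A \<union> B) \<inter> C = {}" by blast
  qed
  ultimately have "card (A \<union> B \<union> C) = 3 * d"
    by (simp add: card_Un_disjoint)
  then show ?thesis
    unfolding Fermat_flexes_eq[OF assms] A_def B_def C_def .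
qed

text \<open>As r^(d-1) = -1/r, the gradient at (0, r, 1) is proportional to (0, -1/r, 1), and
  similarly at the other points. The entry at the zero coordinate vanishes because d - 1 >
  0.\<close>

lemma tangent_line_Fermat:
  assumes "d \<ge> 2" "r ^ d = -1"
  shows "tangent_line (Fermat d) (0, r, 1) = {(x, y, z) \<in> P2. y = r * z}"
    "tangent_line (Fermat d) (r, 0, 1) = {(x, y, z) \<in> P2. x = r * z}"
    "tangent_line (Fermat d) (r, 1, 0) = {(x, y, z) \<in> P2. x = r * y}"
proof -
  have d: "of_nat d \<noteq> (0 :: complex)" "0 ^ (d - 1) = (0 :: complex)" using assms(1) by auto
  have r: "r \<noteq> 0" "r * r ^ (d - 1) = -1"
    using assms root_of_minus_one_nonzero[OF assms] by (auto simp: power_eq_if[of r d])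
  have root: "of_nat d * r ^ (d - 1) * x + of_nat d * y = 0 \<longleftrightarrow> x = r * y" for x y
  proof -
    have "of_nat d * r ^ (d - 1) * x + of_nat d * y = of_nat d * (r ^ (d - 1) * x + y)"
      by (simp add: algebra_simps)
    then have "of_nat d * r ^ (d - 1) * x + of_nat d * y = 0 \<longleftrightarrow> r * (r ^ (d - 1) * x + y) = 0"
      using d(1) r(1) by simp
    also have "r * (r ^ (d - 1) * x + y) = r * y - x"
      using r(2) by (simp add: distrib_left mult.assoc[symmetric])
    finally show ?thesis by auto
  qed
  show "tangent_line (Fermat d) (0, r, 1) = {(x, y, z) \<in> P2. y = r * z}"
    "tangent_line (Fermat d) (r, 0, 1) = {(x, y, z) \<in> P2. x = r * z}"
    "tangent_line (Fermat d) (r, 1, 0) = {(x, y, z) \<in> P2. x = r * y}"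
    by (auto simp: tangent_line_def curve_def tangent_form_def eval_Fermat eval_rules
        root[unfolded One_nat_def] d(2)[unfolded One_nat_def])
qed

text \<open>The tangent at one of these points contains none of the others, so it determines its
  point of contact.\<close>

lemma inj_on_tangent_line_Fermat:
  assumes "d \<ge> 2"
  shows "inj_on (tangent_line (Fermat d)) (Fermat_flexes d)"
proof (rule inj_onI)
  fix p q assume p: "p \<in> Fermat_flexes d" and q: "q \<in> Fermat_flexes d"
    and eq: "tangent_line (Fermat d) p = tangent_line (Fermat d) q"
  have "p \<in> tangent_line (Fermat d) p"
    using assms p by (elim Fermat_flexes_cases) (auto simp: tangent_line_Fermat[OF assms] P2_def)
  then have "p \<in> tangent_line (Fermat d) q" by (simp add: eq)
  then show "p = q"
    by (rule_tac Fermat_flexes_cases[OF assms p]; rule_tac Fermat_flexes_cases[OF assms q])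
      (auto simp: tangent_line_Fermat[OF assms] dest: root_of_minus_one_nonzero[OF assms])
qed

lemma Union_tangent_lines_Fermat:
  assumes "d \<ge> 2"
  shows "\<Union> (tangent_line (Fermat d) ` Fermat_flexes d) = curve (Fermat_arr d)"
proof -
  \<comment> \<open>The form x^d + y^d splits into the lines x = r y. For y = 0 the equivalence
    needs some root r to exist, which the count of roots provides.\<close>
  have root: "x ^ d + y ^ d = 0 \<longleftrightarrow> (\<exists>r. r ^ d = -1 \<and> x = r * y)" for x y :: complex
  proof (cases "y = 0")
    case True
    have "card {r :: complex. r ^ d = -1} = d"
      using assms by (intro card_nth_roots) auto
    then have "{r :: complex. r ^ d = -1} \<noteq> {}" using assms by force
    moreover have "0 ^ d = (0 :: complex)" using assms by simp
    ultimately show ?thesis using True assms by (auto simp: \<open>0 ^ d = 0\<close>)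
  next
    case False
    have "x ^ d + y ^ d = 0 \<longleftrightarrow> x ^ d = - (y ^ d)"
      by (rule eq_neg_iff_add_eq_0[symmetric])
    also have "\<dots> \<longleftrightarrow> (x / y) ^ d = -1"
      using False by (simp add: power_divide divide_eq_eq)
    finally have "x ^ d + y ^ d = 0 \<longleftrightarrow> (x / y) ^ d = -1" .
    moreover have "x = r * y \<longleftrightarrow> r = x / y" for r using False by (auto simp: field_simps)
    ultimately show ?thesis by auto
  qed
  show ?thesis
  proof (rule set_eqI)
    fix p :: "complex \<times> complex \<times> complex"
    obtain x y z where p: "p = (x, y, z)" by (cases p)
    have "p \<in> \<Union> (tangent_line (Fermat d) ` Fermat_flexes d) \<longleftrightarrow>
      (\<exists>r. r ^ d = -1 \<and> (p \<in> tangent_line (Fermat d) (0, r, 1) \<or>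
        p \<in> tangent_line (Fermat d) (r, 0, 1) \<or> p \<in> tangent_line (Fermat d) (r, 1, 0)))"
      unfolding Fermat_flexes_eq[OF assms] by blast
    also have "\<dots> \<longleftrightarrow> (\<exists>r. r ^ d = -1 \<and> p \<in> P2 \<and> (y = r * z \<or> x = r * z \<or> x = r * y))"
      by (intro ex_cong1 conj_cong refl) (auto simp: tangent_line_Fermat[OF assms] p)
    also have "\<dots> \<longleftrightarrow> p \<in> P2 \<and> (y ^ d + z ^ d = 0 \<or> x ^ d + z ^ d = 0 \<or> x ^ d + y ^ d = 0)"
      unfolding root by blast
    also have "\<dots> \<longleftrightarrow> p \<in> curve (Fermat_arr d)"
      by (auto simp: curve_def Fermat_arr_def eval_rules p)
    finally show "p \<in> \<Union> (tangent_line (Fermat d) ` Fermat_flexes d) \<longleftrightarrow> p \<in> curve (Fermat_arr d)" .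
  qed
qed

section \<open>Contact orders along the Fermat curve\<close>

lemma germ_tangent_form:
  "germ (tangent_form F p) p = germ (const3 (eval (dx F) p)) p * germ varx p +
    germ (const3 (eval (dy F) p)) p * germ vary p + germ (const3 (eval (dz F) p)) p * germ varz p"
  by (simp only: tangent_form_def germ.add germ.mult)

lemma germ_linear_form:
  "lconst a * (lconst x + u) + lconst b * (lconst y + v) + lconst c * lconst z =
    lconst (a * x + b * y + c * z) + (lconst a * u + lconst b * v)"
proof -
  have "a * (x + u) + b * (y + v) + c * z = (a * x + b * y + c * z) + (a * u + b * v)"
    for a b c x y z :: local_ring
    by (simp add: algebra_simps)
  then show ?thesis by (simp only: lconst.add lconst.mult)
qed

lemma dvd_power_diff: "y dvd (x + y) ^ n - (x :: 'a::comm_ring_1) ^ n"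
  by (subst power_diff_sumr2) simp

text \<open>At (0, r, 1) the germ is u^d + ((r + v)^d + 1), whose bracket is a multiple of v, and
  the tangent form is a multiple of v. Both thus lie in (u^3, v) for d \<ge> 3. At the other two
  types of points u and v are exchanged.\<close>

lemma intersection_mult_Fermat_flex:
  assumes "d \<ge> 3" "p \<in> Fermat_flexes d"
  shows "intersection_mult (Fermat d) (tangent_form (Fermat d) p) p \<ge> enat 3"
proof -
  have d: "d \<ge> 2" "0 ^ (d - 1) = (0 :: complex)" using assms(1) by auto
  \<comment> \<open>Euler's relation at the point: the constant term of the tangent form is
    0.\<close>
  have lin: "a * r ^ (d - 1) * r + a = 0" if "r ^ d = -1" for a r :: complex
  proof -
    have "r ^ (d - 1) * r = -1" using that d by (simp add: power_eq_if[of r d] mult.commute)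
    then show ?thesis by (simp add: mult.assoc)
  qed
  have pow: "\<exists>h. (lconst r + x) ^ d + 1 = x * h" if "r ^ d = -1" for r x
  proof -
    have "lconst r ^ d = -1"
      using that by (simp only: lconst.power[symmetric] lconst.minus lconst.one)
    then show ?thesis using dvd_power_diff[of x "lconst r" d] by (auto elim: dvdE)
  qed
  from d(1) assms(2) show ?thesis
  proof (cases rule: Fermat_flexes_cases)
    case (1 r)
    obtain h where h: "(lconst r + lv) ^ d + 1 = lv * h" using pow[OF 1(1)] by blast
    have "germ (Fermat d) p - lv * h = lu ^ d"
      by (simp add: 1(2) Fermat_def germ.rules germ_vars lconst.zero lconst.one add.assoc h)
    moreover have "lu ^ 3 dvd lu ^ d" using assms(1) by (rule le_imp_power_dvd)
    moreover have "lv dvd germ (tangent_form (Fermat d) p) p"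
    proof -
      have "germ (tangent_form (Fermat d) p) p =
          lconst 0 * (lconst 0 + lu) + lconst (of_nat d * r ^ (d - 1)) * (lconst r + lv) + lconst (of_nat d) * lconst 1"
        by (simp add: d(2)[unfolded One_nat_def] germ_tangent_form 1(2) germ_vars eval_Fermat)
      also have "\<dots> = lconst (of_nat d * r ^ (d - 1)) * lv"
        unfolding germ_linear_form using lin[OF 1(1)] by (simp add: lconst.zero)
      finally show ?thesis by simp
    qed
    ultimately show ?thesis unfolding intersection_mult_def by (intro uv.colength_ge_3[where h = h]) simp_all
  next
    case (2 r)
    obtain h where h: "(lconst r + lu) ^ d + 1 = lu * h" using pow[OF 2(1)] by blast
    have "germ (Fermat d) p - lu * h = lv ^ d"
      unfolding h[symmetric]
      by (simp add: 2(2) Fermat_def germ.rules germ_vars lconst.zero lconst.one)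
    moreover have "lv ^ 3 dvd lv ^ d" using assms(1) by (rule le_imp_power_dvd)
    moreover have "lu dvd germ (tangent_form (Fermat d) p) p"
    proof -
      have "germ (tangent_form (Fermat d) p) p =
          lconst (of_nat d * r ^ (d - 1)) * (lconst r + lu) + lconst 0 * (lconst 0 + lv) + lconst (of_nat d) * lconst 1"
        by (simp add: d(2)[unfolded One_nat_def] germ_tangent_form 2(2) germ_vars eval_Fermat)
      also have "\<dots> = lconst (of_nat d * r ^ (d - 1)) * lu"
        unfolding germ_linear_form using lin[OF 2(1)] by (simp add: lconst.zero)
      finally show ?thesis by simp
    qed
    ultimately show ?thesis unfolding intersection_mult_def by (intro vu.colength_ge_3[where h = h]) simp_all
  next
    case (3 r)
    obtain h where h: "(lconst r + lu) ^ d + 1 = lu * h" using pow[OF 3(1)] by blast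
    have "germ (Fermat d) p - lu * h = lv ^ d"
      unfolding h[symmetric]
      by (simp add: 3(2) Fermat_def germ.rules germ_vars lconst.zero lconst.one)
    moreover have "lv ^ 3 dvd lv ^ d" using assms(1) by (rule le_imp_power_dvd)
    moreover have "lu dvd germ (tangent_form (Fermat d) p) p"
    proof -
      have "germ (tangent_form (Fermat d) p) p =
          lconst (of_nat d * r ^ (d - 1)) * (lconst r + lu) + lconst 0 * (lconst 0 + lv) + lconst (of_nat d) * lconst 1"
        by (simp add: d(2)[unfolded One_nat_def] germ_tangent_form 3(2) germ_vars eval_Fermat)
      also have "\<dots> = lconst (of_nat d * r ^ (d - 1)) * lu"
        unfolding germ_linear_form using lin[OF 3(1)] by (simp add: lconst.zero)
      finally show ?thesis by simp
    qed
    ultimately show ?thesis unfolding intersection_mult_def by (intro vu.colength_ge_3[where h = h]) simp_all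
  qed
qed

text \<open>The last coordinate is nonzero, hence 1. The tangent form is the linear part of the
  germ, so the binomial expansion leaves a diagonal quadratic part, which is nonzero along the
  tangent.\<close>

lemma intersection_mult_Fermat_non_flex:
  assumes "d \<ge> 2" "p \<in> curve (Fermat d)" "p \<notin> Fermat_flexes d"
  shows "intersection_mult (Fermat d) (tangent_form (Fermat d) p) p \<le> 2"
proof -
  obtain a b where p: "p = (a, b, 1)" and ab: "a \<noteq> 0" "b \<noteq> 0" "a ^ d + b ^ d = -1"
    using assms(2,3) by (cases p) (auto simp: Fermat_flexes_def curve_def P2_def eval_Fermat eq_neg_iff_add_eq_0)
  obtain n where n: "d = n + 2" using assms(1) by (metis add.commute le_Suc_ex)
  define \<kappa> where "\<kappa> = (of_nat (d choose 2) :: complex)"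
  have "d choose 2 \<noteq> 0" using assms(1) by simp
  then have \<kappa>: "\<kappa> \<noteq> 0" unfolding \<kappa>_def by (simp only: of_nat_eq_0_iff not_False_eq_True)
  define \<alpha> \<beta> where "\<alpha> = of_nat d * a ^ (d - 1)" and "\<beta> = of_nat d * b ^ (d - 1)"
  obtain P where P: "(lconst a + lu) ^ d = lconst a ^ d + of_nat d * lconst a ^ (n + 1) * lu
    + of_nat (d choose 2) * lconst a ^ n * lu\<^sup>2 + lu ^ 3 * P"
    using binomial_low_order unfolding n by blast
  obtain Q where Q: "(lconst b + lv) ^ d = lconst b ^ d + of_nat d * lconst b ^ (n + 1) * lv
    + of_nat (d choose 2) * lconst b ^ n * lv\<^sup>2 + lv ^ 3 * Q"
    using binomial_low_order unfolding n by blast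
  have lc: "of_nat d * lconst a ^ (n + 1) = lconst \<alpha>" "of_nat d * lconst b ^ (n + 1) = lconst \<beta>"
    "of_nat (d choose 2) * lconst a ^ n = lconst (\<kappa> * a ^ n)"
    "of_nat (d choose 2) * lconst b ^ n = lconst (\<kappa> * b ^ n)"
    unfolding \<alpha>_def \<beta>_def \<kappa>_def by (simp_all only: lconst.mult lconst.power lconst.of_nat n) simp_all
  have sum: "lconst a ^ d + lconst b ^ d + 1 = 0"
    using ab(3) by (simp only: lconst.power[symmetric] lconst.add[symmetric] lconst.minus lconst.one) simp
  have g: "germ (tangent_form (Fermat d) p) p = lconst \<alpha> * lu + lconst \<beta> * lv"
  proof -
    have "germ (tangent_form (Fermat d) p) p =
        lconst \<alpha> * (lconst a + lu) + lconst \<beta> * (lconst b + lv) + lconst (of_nat d) * lconst 1"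
      by (simp add: germ_tangent_form p germ_vars eval_Fermat \<alpha>_def \<beta>_def)
    moreover have "\<alpha> * a + \<beta> * b + of_nat d * 1 = of_nat d * (a ^ d + b ^ d + 1)"
      by (simp add: \<alpha>_def \<beta>_def n algebra_simps)
    ultimately show ?thesis unfolding germ_linear_form using ab(3) by (simp add: lconst.zero)
  qed
  have f: "germ (Fermat d) p = germ (tangent_form (Fermat d) p) p + lconst (\<kappa> * a ^ n) * lu\<^sup>2
    + lconst (\<kappa> * b ^ n) * lv\<^sup>2 + lu ^ 3 * P + lv ^ 3 * Q"
  proof -
    have "germ (Fermat d) p = (lconst a + lu) ^ d + (lconst b + lv) ^ d + 1"
      by (simp add: p Fermat_def germ.rules germ_vars lconst.one)
    moreover have "(A + x + y + z) + (B + x' + y' + z') + 1 = (A + B + 1) + (x + x' + y + y' + z + z')"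
      for A B x y z x' y' z' :: local_ring by simp
    ultimately show ?thesis by (simp only: P Q lc sum g add_0)
  qed
  have "\<beta> \<noteq> 0" using ab(2) assms(1) by (simp add: \<beta>_def)
  moreover have "\<kappa> * a ^ n * \<beta>\<^sup>2 + \<kappa> * b ^ n * \<alpha>\<^sup>2 \<noteq> 0"
  proof -
    \<comment> \<open>After d^2 (a b)^n is factored out, what remains is a^d + b^d = -1 by the
      equation of the curve.\<close>
    have "\<kappa> * a ^ n * \<beta>\<^sup>2 + \<kappa> * b ^ n * \<alpha>\<^sup>2 = \<kappa> * (of_nat d)\<^sup>2 * (a * b) ^ n * (a ^ d + b ^ d)"
      by (simp add: \<alpha>_def \<beta>_def n power_mult_distrib power2_eq_square algebra_simps)
    then show ?thesis using \<kappa> ab assms(1) by simp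
  qed
  ultimately show ?thesis
    unfolding intersection_mult_def using uv.colength_le_2[OF g f] by blast
qed

lemma inflection_points_Fermat:
  assumes "d \<ge> 3"
  shows "inflection_points (Fermat d) = Fermat_flexes d"
proof -
  have d: "d \<ge> 2" using assms by simp
  \<comment> \<open>Subtraction on \<open>enat\<close> is truncated and fixes infinity: values up to
    2 give order 0, values from 3 on give positive order.\<close>
  have ge: "x - 2 > 0" if "x \<ge> enat 3" for x :: enat
    using that by (cases x) (simp_all add: numeral_eq_enat zero_enat_def)
  have le: "\<not> x - 2 > 0" if "x \<le> 2" for x :: enat
    using that by (cases x) (simp_all add: numeral_eq_enat zero_enat_def)
  have "inflection_order (Fermat d) p > 0" "p \<in> curve (Fermat d)" if "p \<in> Fermat_flexes d" for p
    using that ge[OF intersection_mult_Fermat_flex[OF assms that]]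
    by (auto simp: inflection_order_def Fermat_flexes_def)
  moreover have "p \<in> Fermat_flexes d"
    if "inflection_order (Fermat d) p > 0" "p \<in> curve (Fermat d)" for p
    using that le[OF intersection_mult_Fermat_non_flex[OF d]] unfolding inflection_order_def by blast
  ultimately show ?thesis
    unfolding inflection_points_def smooth_points_def singular_points_Fermat[OF d] by blast
qed

theorem theorem1p7:
  fixes d :: nat
  assumes "d \<ge> 2"
  shows
    "plane_curve d (Fermat d) \<and> singular_points (Fermat d) = {} \<and>
     (\<exists>T \<subseteq> tangent_line (Fermat d) ` curve (Fermat d).
        card T = 3 * d \<and> \<Union> T = curve (Fermat_arr d) \<and>
        (d \<ge> 3 \<longrightarrow> inflectional_tangents (Fermat d) = T)) \<and>
     curve (F' d) =
       curve (Fermat d) \<union> curve (Fermat_arr d) \<union> curve varx \<union> curve vary \<union> curve varz \<and>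
     plane_curve (4 * d + 3) (F' d) \<and>
     free_with_exponents (F' d) (2 * d + 1) (2 * d + 1) \<and>
     curve (F'' d) \<subseteq> curve (F' d) \<and>
     plane_curve (3 * d + 2) (F'' d) \<and>
     free_with_exponents (F'' d) (d + 1) (2 * d) \<and>
     (d = 2 \<longrightarrow> maximizing_curve 8 (F'' d))"
proof (intro conjI impI)
  have d: "d > 0" using assms by simp
  show "plane_curve d (Fermat d)" using d by (rule plane_curve_Fermat)
  show "singular_points (Fermat d) = {}" using assms by (rule singular_points_Fermat)
  show "\<exists>T \<subseteq> tangent_line (Fermat d) ` curve (Fermat d).
      card T = 3 * d \<and> \<Union> T = curve (Fermat_arr d) \<and>
      (d \<ge> 3 \<longrightarrow> inflectional_tangents (Fermat d) = T)"
  proof (intro exI[of _ "tangent_line (Fermat d) ` Fermat_flexes d"] conjI impI)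
    show "tangent_line (Fermat d) ` Fermat_flexes d \<subseteq> tangent_line (Fermat d) ` curve (Fermat d)"
      by (rule image_mono) (auto simp: Fermat_flexes_def)
    show "card (tangent_line (Fermat d) ` Fermat_flexes d) = 3 * d"
      using inj_on_tangent_line_Fermat[OF assms] card_Fermat_flexes[OF assms]
      by (simp add: card_image)
    show "\<Union> (tangent_line (Fermat d) ` Fermat_flexes d) = curve (Fermat_arr d)"
      using assms by (rule Union_tangent_lines_Fermat)
    show "inflectional_tangents (Fermat d) = tangent_line (Fermat d) ` Fermat_flexes d" if "d \<ge> 3"
      using that by (simp add: inflectional_tangents_def inflection_points_Fermat)
  qed
  show "curve (F' d) =
       curve (Fermat d) \<union> curve (Fermat_arr d) \<union> curve varx \<union> curve vary \<union> curve varz"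
    by (auto simp: curve_def F'_def Fermat_def Fermat_arr_def eval.rules)
  show "plane_curve (4 * d + 3) (F' d)" "plane_curve (3 * d + 2) (F'' d)"
    using reduced_curve_F'[OF d] reduced_curve_F''[OF d] by (simp_all add: reduced_curve_def)
  show "free_with_exponents (F' d) (2 * d + 1) (2 * d + 1)" using d by (rule free_F')
  show "free_with_exponents (F'' d) (d + 1) (2 * d)" using d by (rule free_F'')
  show "curve (F'' d) \<subseteq> curve (F' d)"
    by (auto simp: curve_def F'_def F''_def eval.rules)
  show "maximizing_curve 8 (F'' d)" if "d = 2"
    using that maximizing_curve_F''_2 by simp
qed

end
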